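(* Assume $\lambda_C<\mu_{\mathcal{S}(C)}$ for every nonempty $C\subseteq\mathcal{C}$. Let $D_{c_i}(t)$, $i=1,\dots,I$, be the departure process of customers of type $c_i$ from the stationary parallel FCFS Redundancy Service queue, or from the stationary parallel FCFS matching queue. Then: (i) $D_{c_i}(t)$, $i=1,\dots,I$, are independent Poisson processes of rates $\lambda_{c_i}$. (ii) The ordered sequence of customers in the system at time $t$ for either system, given by $X^m(t)$ or $X^r(t)$ respectively, is independent of past departures $D_{c_i}(s)$, $i=1,\dots,I$, for all $s<t$.
   Context: Customer types are $\mathcal{C}=\{c_1,\dots,c_I\}$, server types are $\mathcal{S}=\{s_1,\dots,s_J\}$, and $\mathfrak{E}\subseteq\mathcal{S}\times\mathcal{C}$ is a compatibility relation. $\mathcal{S}(c_i)$ is the set of server types compatible with $c_i$; $\mathcal{S}(C)=\bigcup_{c\in C}\mathcal{S}(c)$. Rates $\lambda_{c_i}>0$, $\mu_{s_j}>0$ are given; $\lambda_C=\sum_{c\in C}\lambda_c$, $\mu_S=\sum_{s\in S}\mu_s$. In both models customers of type $c_i$ arrive in independent Poisson streams of rates $\lambda_{c_i}$. Redundancy Service queue: there are $J$ servers $s_1,\dots,s_J$, each with its own FCFS queue, with independent exponential service times of rate $\mu_{s_j}$ at $s_j$. An arriving customer of type $c_i$ places a copy in the queue of every server in $\mathcal{S}(c_i)$; several servers may process copies of the same customer simultaneously; the customer and all its copies leave when the first copy completes service. $X^r(t)=(c^1,\dots,c^L)$ lists the types of all customers in the system in order of arrival (oldest first). FCFS matching queue: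 servers of type $s_j$ arrive in Poisson streams of rates $\mu_{s_j}$, independent of each other and of the customer arrivals. Customers queue in order of arrival. An arriving server is matched with the longest waiting compatible customer and both leave immediately; if there is none, the server leaves immediately alone. $X^m(t)=(c^1,\dots,c^L)$ lists the types of the customers in the queue in order of arrival (oldest first). Stationary means that the Markov chain $X^r(t)$ (resp. $X^m(t)$), $-\infty<t<\infty$, is in its stationary regime. Departures of customers in the matching queue are those that leave with a matched server. *)

theory Defs
  imports "HOL-Probability.Probability"
begin

section \<open>Input of the queues\<close>

text \<open>The finite types \<open>'c\<close> and \<open>'s\<close> are the sets of customer types and of server types.\<close>

definition servers :: "('s \<times> 'c) set \<Rightarrow> 'c \<Rightarrow> 's set" where
  "servers E c = {s. (s, c) \<in> E}"

text \<open>Independent exponential variables indexed by \<open>(i, k)\<close>, of rate \<open>r i\<close>. They serve as the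
  gaps of independent Poisson streams, one for each \<open>i\<close>, and as the service times at server \<open>i\<close>.\<close>

definition exponentials :: "('i \<Rightarrow> real) \<Rightarrow> ('i \<times> nat \<Rightarrow> real) measure" where
  "exponentials r = PiM UNIV (\<lambda>(i, k). density lborel (exponential_density (r i)))"

definition epoch :: "('i \<times> nat \<Rightarrow> real) \<Rightarrow> 'i \<Rightarrow> nat \<Rightarrow> real" where
  "epoch g i k = (\<Sum>j\<le>k. g (i, j))"

text \<open>The \<open>n\<close>-th arrival (from 0) in the superposition of the customer streams with gaps \<open>a\<close>.\<close>

primrec arrival_time :: "('c \<times> nat \<Rightarrow> real) \<Rightarrow> nat \<Rightarrow> real" where
  "arrival_time a 0 = Inf {epoch a c k | c k. True}"
| "arrival_time a (Suc n) = Inf {epoch a c k | c k. arrival_time a n < epoch a c k}"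

definition arrival_type :: "('c \<times> nat \<Rightarrow> real) \<Rightarrow> nat \<Rightarrow> 'c" where
  "arrival_type a n = (SOME c. \<exists>k. epoch a c k = arrival_time a n)"

text \<open>All customers of a queue started at time 0 from the list \<open>x\<close>, numbered in order of arrival:
  the members of \<open>x\<close> come first and count as arrived at time 0.\<close>

definition cust_time :: "'c list \<Rightarrow> ('c \<times> nat \<Rightarrow> real) \<Rightarrow> nat \<Rightarrow> real" where
  "cust_time x a n = (if n < length x then 0 else arrival_time a (n - length x))"

definition cust_type :: "'c list \<Rightarrow> ('c \<times> nat \<Rightarrow> real) \<Rightarrow> nat \<Rightarrow> 'c" where
  "cust_type x a n = (if n < length x then x ! n else arrival_type a (n - length x))"

definition content :: "(nat \<Rightarrow> real) \<Rightarrow> (nat \<Rightarrow> 'c) \<Rightarrow> (nat \<Rightarrow> real) \<Rightarrow> real \<Rightarrow> 'c list" where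
  "content ar ty dep u = map ty (sorted_list_of_set {n. ar n \<le> u \<and> u < dep n})"


section \<open>The two queues\<close>

text \<open>Redundancy service queue. The copy of customer \<open>n\<close> at server \<open>s\<close> has service time
  \<open>b (s, n)\<close>. Service of this copy starts when \<open>n\<close> has arrived and all earlier customers with a
  copy at \<open>s\<close> have left the system; \<open>n\<close> leaves when its first copy completes. (A copy whose
  start so computed is later than the departure of \<open>n\<close> is never served, and it does not affect the
  minimum.)\<close>

function redundancy_dep ::
  "('s \<times> 'c) set \<Rightarrow> (nat \<Rightarrow> real) \<Rightarrow> (nat \<Rightarrow> 'c) \<Rightarrow> ('s \<times> nat \<Rightarrow> real) \<Rightarrow> nat \<Rightarrow> real" where
  "redundancy_dep E ar ty b n =
     Min ((\<lambda>s. Max (insert (ar n)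
                      ((\<lambda>m. redundancy_dep E ar ty b m) ` {m. m < n \<and> s \<in> servers E (ty m)}))
               + b (s, n)) ` servers E (ty n))"
  by pat_completeness auto
termination
  by (relation "Wellfounded.measure (\<lambda>(E, ar, ty, b, n). n)") auto

text \<open>FCFS matching queue. The servers of type \<open>s\<close> arrive at the times \<open>epoch v s k\<close>. Customer
  \<open>n\<close> leaves with the first compatible server that arrives after \<open>n\<close> and after the departure of
  every earlier customer compatible with this server.\<close>

function matching_dep ::
  "('s \<times> 'c) set \<Rightarrow> (nat \<Rightarrow> real) \<Rightarrow> (nat \<Rightarrow> 'c) \<Rightarrow> ('s \<times> nat \<Rightarrow> real) \<Rightarrow> nat \<Rightarrow> real" where
  "matching_dep E ar ty v n =
     Inf {epoch v s k | s k. s \<in> servers E (ty n) \<and> ar n < epoch v s k \<and>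
            (\<forall>m\<in>{..<n}. s \<in> servers E (ty m) \<longrightarrow> matching_dep E ar ty v m < epoch v s k)}"
  by pat_completeness auto
termination
  by (relation "Wellfounded.measure (\<lambda>(E, ar, ty, v, n). n)") auto

definition redundancy_state ::
  "('s \<times> 'c) set \<Rightarrow> 'c list \<Rightarrow> ('c \<times> nat \<Rightarrow> real) \<Rightarrow> ('s \<times> nat \<Rightarrow> real) \<Rightarrow> real \<Rightarrow> 'c list" where
  "redundancy_state E x a b =
     content (cust_time x a) (cust_type x a) (redundancy_dep E (cust_time x a) (cust_type x a) b)"

definition matching_state ::
  "('s \<times> 'c) set \<Rightarrow> 'c list \<Rightarrow> ('c \<times> nat \<Rightarrow> real) \<Rightarrow> ('s \<times> nat \<Rightarrow> real) \<Rightarrow> real \<Rightarrow> 'c list" where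
  "matching_state E x a v =
     content (cust_time x a) (cust_type x a) (matching_dep E (cust_time x a) (cust_type x a) v)"

text \<open>Transition functions of \<open>X\<^sup>r\<close> and \<open>X\<^sup>m\<close>: the probability that the queue started from the
  list \<open>x\<close> has content \<open>y\<close> after time \<open>u\<close>. Services in progress and gaps between arrivals are
  started afresh at time 0, as their exponential laws are memoryless.\<close>

definition redundancy_trans ::
  "('s \<times> 'c) set \<Rightarrow> ('c \<Rightarrow> real) \<Rightarrow> ('s \<Rightarrow> real) \<Rightarrow> 'c list \<Rightarrow> real \<Rightarrow> 'c list \<Rightarrow> real" where
  "redundancy_trans E lam mu x u y =
     measure (exponentials lam \<Otimes>\<^sub>M exponentials mu)
       {(a, b) \<in> space (exponentials lam \<Otimes>\<^sub>M exponentials mu). redundancy_state E x a b u = y}"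

definition matching_trans ::
  "('s \<times> 'c) set \<Rightarrow> ('c \<Rightarrow> real) \<Rightarrow> ('s \<Rightarrow> real) \<Rightarrow> 'c list \<Rightarrow> real \<Rightarrow> 'c list \<Rightarrow> real" where
  "matching_trans E lam mu x u y =
     measure (exponentials lam \<Otimes>\<^sub>M exponentials mu)
       {(a, v) \<in> space (exponentials lam \<Otimes>\<^sub>M exponentials mu). matching_state E x a v u = y}"


section \<open>Stationary Markov chains on the whole time axis\<close>

definition jump_paths :: "'w measure \<Rightarrow> (real \<Rightarrow> 'w \<Rightarrow> 'x) \<Rightarrow> bool" where
  "jump_paths M X \<longleftrightarrow>
     (\<forall>\<omega>\<in>space M. \<forall>t. (\<forall>\<^sub>F v in at_right t. X v \<omega> = X t \<omega>) \<and>
                       (\<exists>y. \<forall>\<^sub>F v in at_left t. X v \<omega> = y))"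

definition markov_chain ::
  "'w measure \<Rightarrow> (real \<Rightarrow> 'w \<Rightarrow> 'x) \<Rightarrow> ('x \<Rightarrow> real \<Rightarrow> 'x \<Rightarrow> real) \<Rightarrow> bool" where
  "markov_chain M X P \<longleftrightarrow>
     (\<forall>(n::nat) (t::nat \<Rightarrow> real) (x::nat \<Rightarrow> 'x). (\<forall>i\<le>n. t i < t (Suc i)) \<longrightarrow>
        measure M {\<omega>\<in>space M. \<forall>i\<le>Suc n. X (t i) \<omega> = x i} =
        measure M {\<omega>\<in>space M. \<forall>i\<le>n. X (t i) \<omega> = x i} * P (x n) (t (Suc n) - t n) (x (Suc n)))"

definition stationary :: "'w measure \<Rightarrow> (real \<Rightarrow> 'w \<Rightarrow> 'x) \<Rightarrow> bool" where
  "stationary M X \<longleftrightarrow>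
     (\<forall>h. distr M (PiM UNIV (\<lambda>_. count_space UNIV)) (\<lambda>\<omega> t. X (t + h) \<omega>) =
          distr M (PiM UNIV (\<lambda>_. count_space UNIV)) (\<lambda>\<omega> t. X t \<omega>))"

definition stationary_chain ::
  "'w measure \<Rightarrow> (real \<Rightarrow> 'w \<Rightarrow> 'x) \<Rightarrow> ('x \<Rightarrow> real \<Rightarrow> 'x \<Rightarrow> real) \<Rightarrow> bool" where
  "stationary_chain M X P \<longleftrightarrow>
     prob_space M \<and> (\<forall>t. X t \<in> measurable M (count_space UNIV)) \<and>
     jump_paths M X \<and> markov_chain M X P \<and> stationary M X"


section \<open>Departures and Poisson processes\<close>

text \<open>A type \<open>c\<close> customer departs at \<open>u\<close> if the number of type \<open>c\<close> customers in the system
  drops at \<open>u\<close>. Simultaneous events have probability zero.\<close>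

definition departures :: "(real \<Rightarrow> 'w \<Rightarrow> 'c list) \<Rightarrow> 'c \<Rightarrow> 'w \<Rightarrow> real set" where
  "departures X c \<omega> =
     {u. \<exists>y. (\<forall>\<^sub>F v in at_left u. X v \<omega> = y) \<and> count_list (X u \<omega>) c < count_list y c}"

text \<open>A point process on the line is given by its random set of points; \<open>points_in D s t\<close> is the
  increment over \<open>(s, t]\<close> of its counting process.\<close>

definition points_in :: "('w \<Rightarrow> real set) \<Rightarrow> real \<Rightarrow> real \<Rightarrow> 'w \<Rightarrow> nat" where
  "points_in D s t \<omega> = card (D \<omega> \<inter> {s<..t})"

definition poisson_process :: "'w measure \<Rightarrow> ('w \<Rightarrow> real set) \<Rightarrow> real \<Rightarrow> bool" where
  "poisson_process M D r \<longleftrightarrow>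
     (\<forall>\<omega>\<in>space M. \<forall>s t. finite (D \<omega> \<inter> {s<..t})) \<and>
     (\<forall>s t. points_in D s t \<in> measurable M (count_space UNIV)) \<and>
     (\<forall>s t. s < t \<longrightarrow>
        distr M (count_space UNIV) (points_in D s t) = measure_pmf (poisson_pmf (r * (t - s)))) \<and>
     (\<forall>(n::nat) (t::nat \<Rightarrow> real). (\<forall>i<n. t i < t (Suc i)) \<longrightarrow>
        prob_space.indep_vars M (\<lambda>_. count_space UNIV)
          (\<lambda>i. points_in D (t i) (t (Suc i))) {..<n})"

definition independent_processes :: "'w measure \<Rightarrow> ('i \<Rightarrow> 'w \<Rightarrow> real set) \<Rightarrow> bool" where
  "independent_processes M D \<longleftrightarrow>
     prob_space.indep_vars M (\<lambda>_. PiM UNIV (\<lambda>_. count_space UNIV))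
       (\<lambda>i \<omega>. \<lambda>(s, t). points_in (D i) s t \<omega>) UNIV"

definition independent_elements ::
  "'w measure \<Rightarrow> 'x measure \<Rightarrow> ('w \<Rightarrow> 'x) \<Rightarrow> 'y measure \<Rightarrow> ('w \<Rightarrow> 'y) \<Rightarrow> bool" where
  "independent_elements M S Y T Z \<longleftrightarrow>
     Y \<in> measurable M S \<and> Z \<in> measurable M T \<and>
     prob_space.indep_set M (sets (vimage_algebra (space M) Y S)) (sets (vimage_algebra (space M) Z T))"

text \<open>\<open>prob_space.indep_var\<close> requires both variables to have the same type, hence the
  definition above. Next: joint independence from all the processes \<open>D i\<close> observed strictly
  before time \<open>t\<close>.\<close>

definition independent_of_past ::
  "'w measure \<Rightarrow> ('w \<Rightarrow> 'x) \<Rightarrow> ('i \<Rightarrow> 'w \<Rightarrow> real set) \<Rightarrow> real \<Rightarrow> bool" where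
  "independent_of_past M Y D t \<longleftrightarrow>
     independent_elements M
       (count_space UNIV) Y
       (PiM {(i, r, s). s < t} (\<lambda>_. count_space UNIV))
       (\<lambda>\<omega>. \<lambda>(i, r, s)\<in>{(i, r, s). s < t}. points_in (D i) r s \<omega>)"

end

theory Submission
  imports Defs
begin

text \<open>Both queues have the same generator: in state \<open>(c\<^sup>1, \<dots>, c\<^sup>L)\<close> a new customer of type
  \<open>c\<close> is appended at rate \<open>lam c\<close>, and every server removes at rate \<open>mu s\<close> the first customer
  compatible with it. Its equilibrium is the product form with the weights
  \<open>\<Prod>i. lam c\<^sup>i / (\<Sum>s\<in>S({c\<^sup>1, \<dots>, c\<^sup>i}). mu s)\<close>. Given the state \<open>y\<close> after a
  departure, summing over the possible positions of the departed customer telescopes and gives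
  intensity \<open>lam c\<close> for departures of type \<open>c\<close>, whatever \<open>y\<close> is; this is Burke's argument.

  No semigroup theory is needed. The transition functions are compared with the generator up to
  \<open>O(h\<^sup>2)\<close>, uniformly in the state, directly from the construction with exponential clocks.
  Along a grid of mesh \<open>h\<close> the joint generating function of the numbers of steps with a
  departure is then known up to \<open>O(h)\<close>, jointly with the final state. As the paths are locally
  constant, these numbers are eventually the numbers of departures when the grid is refined, which
  yields their joint law with the state.\<close>

text \<open>The chain is only assumed to be stationary, so its law at a fixed time has to be
  identified before Burke's argument can start: stationarity over a step of length \<open>h\<close>
  is divided by \<open>h\<close>, and the product form is shown to be the only probability invariant
  under the generator. The reversed process is never built. Instead, the generating function is
  carried along the grid together with an arbitrary bounded test function \<open>f\<close> of the
  final state. Splitting off the last step turns \<open>f\<close> into another test function, whose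
  equilibrium mean is that of \<open>f\<close> times a factor independent of \<open>f\<close>; this
  is the form in which the state forgets the past departures. A cell of the grid records at most one
  departure of each type, and cells with several events disappear in the error. Individual
  probabilities are recovered as coefficients of the generating function. Independence of whole
  processes is reduced by cylinder events to finitely many time points, which fit on one
  grid.\<close>

declare redundancy_dep.simps [simp del] matching_dep.simps [simp del]

section \<open>The jumps of the queues\<close>

definition first_ix :: "('s \<times> 'c) set \<Rightarrow> 's \<Rightarrow> 'c list \<Rightarrow> nat" where
  "first_ix E s x = length (takeWhile (\<lambda>d. s \<notin> servers E d) x)"

definition serve :: "('s \<times> 'c) set \<Rightarrow> 's \<Rightarrow> 'c list \<Rightarrow> 'c list" where
  "serve E s x = take (first_ix E s x) x @ drop (Suc (first_ix E s x)) x"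

definition serves :: "('s \<times> 'c) set \<Rightarrow> 's \<Rightarrow> 'c \<Rightarrow> 'c list \<Rightarrow> bool" where
  "serves E s c x \<longleftrightarrow> first_ix E s x < length x \<and> x ! first_ix E s x = c"

text \<open>An event \<open>Inl c\<close> is an arrival, \<open>Inr s\<close> a service by \<open>s\<close>, which is void if no customer
  is compatible with \<open>s\<close>: the chain is uniformised, with event rates independent of the state.\<close>

definition nxt :: "('s \<times> 'c) set \<Rightarrow> 'c list \<Rightarrow> 'c + 's \<Rightarrow> 'c list" where
  "nxt E x e = (case e of Inl c \<Rightarrow> x @ [c] | Inr s \<Rightarrow> serve E s x)"

text \<open>The factor by which a step from \<open>x\<close> to \<open>y\<close> contributes to the generating function in
  the variables \<open>z c\<close> of the numbers of departures.\<close>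

definition drop_factor :: "('c::finite \<Rightarrow> real) \<Rightarrow> 'c list \<Rightarrow> 'c list \<Rightarrow> real" where
  "drop_factor z x y = (\<Prod>c\<in>UNIV. if count_list y c < count_list x c then z c else 1)"

lemma first_ix_Nil [simp]: "first_ix E s [] = 0"
  by (simp add: first_ix_def)

lemma first_ix_Cons [simp]:
  "first_ix E s (c # x) = (if s \<in> servers E c then 0 else Suc (first_ix E s x))"
  by (simp add: first_ix_def)

lemma serve_Nil [simp]: "serve E s [] = []"
  by (simp add: serve_def)

lemma serve_Cons [simp]:
  "serve E s (c # x) = (if s \<in> servers E c then x else c # serve E s x)"
  by (simp add: serve_def)

lemma serves_Nil [simp]: "\<not> serves E s c []"
  by (simp add: serves_def)

lemma serves_Cons [simp]:
  "serves E s c (d # x) = (if s \<in> servers E d then d = c else serves E s c x)"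
  by (auto simp add: serves_def)

lemma first_ix_le: "first_ix E s x \<le> length x"
  by (simp add: first_ix_def length_takeWhile_le)

lemma first_ix_less_iff: "first_ix E s x < length x \<longleftrightarrow> s \<in> (\<Union>c\<in>set x. servers E c)"
  by (induction x) auto

lemma serve_idle: "s \<notin> (\<Union>c\<in>set x. servers E c) \<Longrightarrow> serve E s x = x"
  by (induction x) auto

lemma count_serve:
  "count_list (serve E s x) d = (if serves E s d x then count_list x d - 1 else count_list x d)"
  "serves E s d x \<Longrightarrow> count_list x d > 0"
  by (induction x) (auto split: if_splits)

lemma drop_factor_same [simp]: "drop_factor z x x = 1"
  by (simp add: drop_factor_def)

lemma drop_factor_arrival [simp]: "drop_factor z x (x @ [c]) = 1"
  by (simp add: drop_factor_def)

lemma drop_factor_serve: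
  assumes "serves E s c x" shows "drop_factor z x (serve E s x) = z c"
proof -
  have "serves E s d x \<longleftrightarrow> d = c" for d
    using assms by (auto simp: serves_def)
  then have "drop_factor z x (serve E s x) = (\<Prod>d\<in>UNIV. if d = c then z c else 1)"
    unfolding drop_factor_def using count_serve(2)[OF assms]
    by (intro prod.cong) (auto simp: count_serve(1))
  then show ?thesis by simp
qed

lemma abs_drop_factor_le: "(\<And>c. \<bar>z c\<bar> \<le> 1) \<Longrightarrow> \<bar>drop_factor z x y\<bar> \<le> 1"
  unfolding drop_factor_def abs_prod by (intro prod_le_1) auto

section \<open>Sums over lists, graded by length\<close>

abbreviation lists_of_length :: "nat \<Rightarrow> 'c list set" where
  "lists_of_length n \<equiv> {x. length x = n}"

lemma finite_lists_of_length [simp, intro]: "finite (lists_of_length n :: 'c::finite list set)"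
  using finite_lists_length_eq[of "UNIV :: 'c set" n] by simp

lemma finite_lists_up_to [simp, intro]: "finite {x :: 'c::finite list. length x \<le> n}"
  using finite_lists_length_le[of "UNIV :: 'c set" n] by simp

lemma sum_lists_Cons:
  fixes f :: "'c::finite list \<Rightarrow> 'b::comm_monoid_add"
  shows "(\<Sum>x\<in>lists_of_length (Suc n). f x) = (\<Sum>c\<in>UNIV. \<Sum>x\<in>lists_of_length n. f (c # x))"
proof -
  have "(\<Sum>c\<in>UNIV. \<Sum>x\<in>lists_of_length n. f (c # x)) =
        (\<Sum>p\<in>UNIV \<times> lists_of_length n. f (fst p # snd p))"
    by (simp add: sum.cartesian_product case_prod_unfold)
  also have "\<dots> = (\<Sum>x\<in>lists_of_length (Suc n). f x)"
    by (rule sum.reindex_bij_witness[where i="\<lambda>x. (hd x, tl x)" and j="\<lambda>p. fst p # snd p"])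
       (auto simp: length_Suc_conv)
  finally show ?thesis by simp
qed

lemma sum_lists_snoc:
  fixes f :: "'c::finite list \<Rightarrow> 'b::comm_monoid_add"
  shows "(\<Sum>x\<in>lists_of_length (Suc n). f x) = (\<Sum>x\<in>lists_of_length n. \<Sum>c\<in>UNIV. f (x @ [c]))"
proof -
  have "(\<Sum>x\<in>lists_of_length n. \<Sum>c\<in>UNIV. f (x @ [c])) =
        (\<Sum>p\<in>lists_of_length n \<times> UNIV. f (fst p @ [snd p]))"
    by (simp add: sum.cartesian_product case_prod_unfold)
  also have "\<dots> = (\<Sum>x\<in>lists_of_length (Suc n). f x)"
    by (rule sum.reindex_bij_witness[where i="\<lambda>x. (butlast x, last x)" and j="\<lambda>p. fst p @ [snd p]"])
       (auto simp: snoc_eq_iff_butlast)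
  finally show ?thesis by simp
qed

lemma sum_lists_up_to:
  fixes f :: "'c::finite list \<Rightarrow> 'b::comm_monoid_add"
  shows "(\<Sum>x\<in>{x. length x \<le> n}. f x) = (\<Sum>k\<le>n. \<Sum>x\<in>lists_of_length k. f x)"
proof -
  have "{x :: 'c list. length x \<le> n} = (\<Union>k\<le>n. lists_of_length k)" by auto
  then show ?thesis by (simp only:) (subst sum.UNION_disjoint, auto)
qed

text \<open>Truncation by length makes every mean a limit of finite sums. Events change the length
  by at most one, so balance identities hold exactly between truncations and pass to the limit
  without rearranging infinite sums.\<close>

lemma expectation_lists_limit:
  fixes g :: "'c::finite list \<Rightarrow> real"
  assumes g: "\<And>x. \<bar>g x\<bar> \<le> B"
  shows "(\<lambda>n. \<Sum>x\<in>{x. length x \<le> n}. pmf p x * g x) \<longlonglongrightarrow> measure_pmf.expectation p g"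
proof -
  have "(\<lambda>n. measure_pmf.expectation p (\<lambda>x. g x * indicator {x. length x \<le> n} x)) \<longlonglongrightarrow> measure_pmf.expectation p g"
  proof (rule integral_dominated_convergence[where w="\<lambda>_. B"])
    have "(\<lambda>n. g x * indicator {x. length x \<le> n} x) \<longlonglongrightarrow> g x" for x
      by (rule tendsto_eventually) (auto simp: eventually_sequentially split: split_indicator)
    then show "AE x in p. (\<lambda>n. g x * indicator {x. length x \<le> n} x) \<longlonglongrightarrow> g x" by simp
    have "0 \<le> B" using g[of "[]"] by linarith
    then show "AE x in p. norm (g x * indicator {x. length x \<le> n} x) \<le> B" for n
      using g by (auto split: split_indicator)
  qed auto
  moreover have "measure_pmf.expectation p (\<lambda>x. g x * indicator {x. length x \<le> n} x) =
      (\<Sum>x\<in>{x. length x \<le> n}. pmf p x * g x)" for n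
    by (subst integral_measure_pmf[of "{x. length x \<le> n}"]) (auto split: split_indicator_asm intro!: sum.cong)
  ultimately show ?thesis by simp
qed

section \<open>The product form equilibrium\<close>

locale parallel_fcfs =
  fixes E :: "('s::finite \<times> 'c::finite) set" and lam :: "'c \<Rightarrow> real" and mu :: "'s \<Rightarrow> real"
  assumes lam_pos: "\<And>c. 0 < lam c"
    and mu_pos: "\<And>s. 0 < mu s"
    and stability: "\<And>C. C \<noteq> {} \<Longrightarrow> (\<Sum>c\<in>C. lam c) < (\<Sum>s\<in>(\<Union>c\<in>C. servers E c). mu s)"
begin

definition capacity :: "'c set \<Rightarrow> real" where
  "capacity A = (\<Sum>s\<in>(\<Union>c\<in>A. servers E c). mu s)"

text \<open>\<open>A\<close> is the set of types of the customers ahead of the list; the product form is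
  \<open>weight {}\<close>.\<close>

primrec weight :: "'c set \<Rightarrow> 'c list \<Rightarrow> real" where
  "weight A [] = 1"
| "weight A (c # x) = lam c / capacity (insert c A) * weight (insert c A) x"

lemma capacity_empty [simp]: "capacity {} = 0"
  by (simp add: capacity_def)

lemma capacity_pos: "A \<noteq> {} \<Longrightarrow> 0 < capacity A"
  using stability[of A] lam_pos unfolding capacity_def
  by (meson le_less_trans less_imp_le sum_nonneg)

lemma capacity_nonneg: "0 \<le> capacity A"
  using capacity_pos[of A] by (cases "A = {}") auto

lemma capacity_insert: "capacity (insert c A) = capacity A +
    (\<Sum>s\<in>servers E c - (\<Union>d\<in>A. servers E d). mu s)"
proof -
  have "(\<Union>d\<in>insert c A. servers E d) =
        (\<Union>d\<in>A. servers E d) \<union> (servers E c - (\<Union>d\<in>A. servers E d))" by auto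
  then show ?thesis unfolding capacity_def by (simp add: sum.union_disjoint[symmetric])
qed

lemma weight_pos: "0 < weight A x"
  by (induction x arbitrary: A) (auto intro!: mult_pos_pos divide_pos_pos lam_pos capacity_pos)

lemma weight_sum_nonneg: "0 \<le> (\<Sum>x\<in>B. weight A x)"
  by (intro sum_nonneg less_imp_le weight_pos)

text \<open>The recursion for \<open>weight\<close> peels off the oldest customer, whereas arrivals
  join at the other end; this is the factor gained by the newest customer.\<close>

lemma weight_snoc:
  "weight A (x @ [c]) = weight A x * (lam c / capacity (insert c (A \<union> set x)))"
  by (induction x arbitrary: A) (auto simp: insert_commute)

text \<open>For lists starting with a type in \<open>A\<close> the recursion multiplies by \<open>\<rho> < 1\<close>, the other
  types enlarge \<open>A\<close>; hence the induction on the complement of \<open>A\<close>.\<close>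

lemma weight_bounded: "\<exists>B. \<forall>n. (\<Sum>k\<le>n. \<Sum>x\<in>lists_of_length k. weight A x) \<le> B"
proof (induction "card (- A)" arbitrary: A rule: less_induct)
  case less
  define S where "S A n = (\<Sum>k\<le>n. \<Sum>x\<in>lists_of_length k. weight A x)" for A n
  have S0: "S A 0 = 1" for A by (simp add: S_def)
  have S_Suc: "S A (Suc n) = 1 + (\<Sum>c\<in>UNIV. lam c / capacity (insert c A) * S (insert c A) n)" for A n
    unfolding S_def sum.atMost_Suc_shift sum_lists_Cons
    by (simp add: sum_distrib_left sum.swap[of _ UNIV])
  have S_nonneg: "0 \<le> S A n" for A n
    unfolding S_def by (intro sum_nonneg less_imp_le weight_pos)
  have "\<exists>B. \<forall>n. S (insert c A) n \<le> B" if "c \<notin> A" for c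
    unfolding S_def using that by (intro less) (auto intro!: psubset_card_mono)
  then obtain B where B: "\<And>c n. c \<notin> A \<Longrightarrow> S (insert c A) n \<le> B c" by metis
  define b where "b = 1 + (\<Sum>c\<in>-A. lam c / capacity (insert c A) * B c)"
  define rho where "rho = (\<Sum>c\<in>A. lam c) / capacity A"
  have rho: "0 \<le> rho" "rho < 1"
  proof -
    show "0 \<le> rho" unfolding rho_def
      by (intro divide_nonneg_nonneg sum_nonneg capacity_nonneg less_imp_le[OF lam_pos])
    show "rho < 1"
      using stability[of A] capacity_pos[of A]
      by (cases "A = {}") (auto simp: rho_def capacity_def[symmetric])
  qed
  have step: "S A (Suc n) \<le> b + rho * S A n" for n
  proof -
    have "S A (Suc n) = 1 + ((\<Sum>c\<in>-A. lam c / capacity (insert c A) * S (insert c A) n) +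
        (\<Sum>c\<in>A. lam c / capacity (insert c A) * S (insert c A) n))"
      unfolding S_Suc by (subst sum.union_disjoint[symmetric]) auto
    also have "(\<Sum>c\<in>A. lam c / capacity (insert c A) * S (insert c A) n) = rho * S A n"
      unfolding rho_def sum_divide_distrib sum_distrib_right
      by (intro sum.cong) (auto simp: insert_absorb)
    also have "(\<Sum>c\<in>-A. lam c / capacity (insert c A) * S (insert c A) n) \<le>
        (\<Sum>c\<in>-A. lam c / capacity (insert c A) * B c)"
      by (intro sum_mono mult_left_mono B) (auto intro!: divide_nonneg_nonneg less_imp_le[OF lam_pos] capacity_nonneg)
    finally show ?thesis by (simp add: b_def)
  qed
  have B0: "0 \<le> B c" if "c \<notin> A" for c using B[OF that, of 0] S0 by simp
  have b1: "1 \<le> b" unfolding b_def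
    by (auto intro!: sum_nonneg mult_nonneg_nonneg divide_nonneg_nonneg less_imp_le[OF lam_pos] capacity_nonneg B0)
  \<comment> \<open>The bound is the fixed point of \<open>\<lambda>s. b + rho * s\<close>; it is
    not below the initial value 1 because \<open>1 \<le> b\<close>.\<close>
  have "S A n \<le> b / (1 - rho)" for n
  proof (induction n)
    case 0
    have "1 - rho \<le> b" using b1 rho by linarith
    then show ?case using rho by (simp add: S0 pos_le_divide_eq)
  next
    case (Suc n)
    have "S A (Suc n) \<le> b + rho * (b / (1 - rho))"
      using step[of n] mult_left_mono[OF Suc rho(1)] by linarith
    also have "\<dots> = b / (1 - rho)" using rho by (simp add: field_simps)
    finally show ?case .
  qed
  then show ?case unfolding S_def by blast
qed

text \<open>The sum over all positions at which the served customer can have been inserted into \<open>y\<close>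
  telescopes; the last term vanishes for \<open>A = {}\<close>.\<close>

lemma weight_service_balance:
  "(\<Sum>x\<in>lists_of_length (Suc n). weight A x *
      (\<Sum>s\<in>-(\<Union>d\<in>A. servers E d). mu s * (if serves E s c x then f (serve E s x) else 0))) =
   lam c * (\<Sum>y\<in>lists_of_length n. f y *
      (weight A y - capacity A / capacity (insert c A) * weight (insert c A) y))"
proof -
  define R where "R A f x = (\<Sum>s\<in>-(\<Union>d\<in>A. servers E d).
      mu s * (if serves E s c x then f (serve E s x) else 0))" for A x and f :: "'c list \<Rightarrow> real"
  \<comment> \<open>Total rate of the servers compatible with \<open>c\<close> but with no type in
    \<open>A\<close>, by \<open>capacity_insert\<close>: those that serve a \<open>c\<close> at the
    head of the list.\<close>
  define kappa where "kappa A = capacity (insert c A) - capacity A" for A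
  have R_Cons: "R A f (d # x) = (if d = c then kappa A * f x else 0) +
      R (insert d A) (\<lambda>y. f (d # y)) x" for A f d x
  proof -
    \<comment> \<open>A server not caught by \<open>A\<close> either serves the head
      \<open>d\<close> or is incompatible with it. In the second case it acts on the tail with
      \<open>d\<close> counted as ahead, and \<open>d\<close> reappears at the front of the
      result.\<close>
    have "-(\<Union>d\<in>A. servers E d) = (servers E d - (\<Union>d\<in>A. servers E d)) \<union>
        (-(\<Union>d\<in>insert d A. servers E d))" by auto
    then have "R A f (d # x) =
        (\<Sum>s\<in>servers E d - (\<Union>d\<in>A. servers E d). mu s * (if d = c then f x else 0)) +
        (\<Sum>s\<in>-(\<Union>d\<in>insert d A. servers E d).
            mu s * (if serves E s c x then f (d # serve E s x) else 0))"
      unfolding R_def by (simp only:) (subst sum.union_disjoint, auto intro!: sum.cong)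
    then show ?thesis
      by (auto simp: R_def kappa_def capacity_insert[of c A] sum_distrib_right)
  qed
  have unfold: "(\<Sum>x\<in>lists_of_length (Suc n). weight A x * R A f x) =
      lam c / capacity (insert c A) * kappa A * (\<Sum>x\<in>lists_of_length n. weight (insert c A) x * f x) +
      (\<Sum>d\<in>UNIV. lam d / capacity (insert d A) *
         (\<Sum>x\<in>lists_of_length n. weight (insert d A) x * R (insert d A) (\<lambda>y. f (d # y)) x))" for A f n
  proof -
    have "(\<Sum>x\<in>lists_of_length (Suc n). weight A x * R A f x) =
       (\<Sum>d\<in>UNIV. (if d = c then \<Sum>x\<in>lists_of_length n. lam c / capacity (insert c A) * weight (insert c A) x * (kappa A * f x) else 0) +
        (\<Sum>x\<in>lists_of_length n. lam d / capacity (insert d A) * (weight (insert d A) x * R (insert d A) (\<lambda>y. f (d # y)) x)))"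
      unfolding sum_lists_Cons R_Cons
      by (intro sum.cong refl) (auto simp: distrib_left sum.distrib mult.assoc)
    then show ?thesis by (simp add: sum.distrib sum_distrib_left mult_ac)
  qed
  have "(\<Sum>x\<in>lists_of_length (Suc n). weight A x * R A f x) =
      lam c * (\<Sum>y\<in>lists_of_length n. f y *
        (weight A y - capacity A / capacity (insert c A) * weight (insert c A) y))"
  proof (induction n arbitrary: A f)
    case 0
    have "capacity (insert c A) > 0" by (intro capacity_pos) auto
    then show ?case unfolding unfold by (simp add: R_def kappa_def field_simps)
  next
    case (Suc n A f)
    have pos: "capacity (insert d A) > 0" for d A by (intro capacity_pos) auto
    \<comment> \<open>Multiplied by the factor of the head \<open>d\<close>, both terms of the
      induction hypothesis become weights of \<open>d # y\<close>; in the second one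
      \<open>capacity (insert d A)\<close> cancels.\<close>
    have eq: "lam d / capacity (insert d A) * (lam c * (\<Sum>y\<in>lists_of_length n. f (d # y) *
        (weight (insert d A) y - capacity (insert d A) / capacity (insert c (insert d A)) * weight (insert c (insert d A)) y)))
       = (\<Sum>y\<in>lists_of_length n. lam c * (f (d # y) * (weight A (d # y) - weight (insert c A) (d # y))))" for d
      unfolding sum_distrib_left
      using pos[of d A] pos[of c "insert d A"] pos[of d "insert c A"]
      by (intro sum.cong refl) (simp add: insert_commute[of d c] field_simps)
    have "(\<Sum>x\<in>lists_of_length (Suc (Suc n)). weight A x * R A f x) =
       lam c / capacity (insert c A) * kappa A * (\<Sum>x\<in>lists_of_length (Suc n). weight (insert c A) x * f x) +
       (\<Sum>y\<in>lists_of_length (Suc n). lam c * (f y * (weight A y - weight (insert c A) y)))"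
      by (subst unfold) (simp only: Suc.IH eq sum_lists_Cons[symmetric,
            of "\<lambda>y. lam c * (f y * (weight A y - weight (insert c A) y))"])
    \<comment> \<open>Insertion at the head has the coefficient
      \<open>kappa A / capacity (insert c A)\<close>, that is
      \<open>1 - capacity A / capacity (insert c A)\<close>; its 1 cancels the subtracted
      \<open>weight (insert c A) y\<close>.\<close>
    also have "\<dots> = lam c * (\<Sum>y\<in>lists_of_length (Suc n). f y *
        (weight A y - capacity A / capacity (insert c A) * weight (insert c A) y))"
      unfolding sum_distrib_left sum.distrib[symmetric]
      using pos[of c A] by (intro sum.cong refl) (simp add: kappa_def field_simps)
    finally show ?case .
  qed
  then show ?thesis by (simp add: R_def)
qed

lemma service_balance:
  "(\<Sum>x\<in>lists_of_length (Suc n). weight {} x *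
      (\<Sum>s\<in>UNIV. mu s * (if serves E s c x then f (serve E s x) else 0))) =
   lam c * (\<Sum>y\<in>lists_of_length n. weight {} y * f y)"
  using weight_service_balance[where A="{}" and f=f and c=c and n=n] by (simp add: mult.commute)

text \<open>The last factor of the weight of a nonempty \<open>y\<close> has the denominator
  \<open>capacity (set y)\<close>, which is also the total rate of the servers that find a customer
  in \<open>y\<close>: the flow into \<open>y\<close> by arrivals equals the flow out of
  \<open>y\<close> by services.\<close>

lemma arrival_balance:
  "(\<Sum>x\<in>lists_of_length n. weight {} x * (\<Sum>c\<in>UNIV. lam c * f (x @ [c]))) =
   (\<Sum>y\<in>lists_of_length (Suc n). weight {} y * capacity (set y) * f y)"
proof -
  have "weight {} (x @ [c]) * capacity (set (x @ [c])) = weight {} x * lam c" for x c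
    using capacity_pos[of "insert c (set x)"] by (simp add: weight_snoc)
  then show ?thesis
    unfolding sum_lists_snoc by (simp add: sum_distrib_left mult.assoc[symmetric])
qed

section \<open>Normalisation of the weights, and means in equilibrium\<close>

definition total_weight :: real where
  "total_weight = (\<Sum>n. \<Sum>x\<in>lists_of_length n. weight {} x)"

definition equilibrium :: "'c list pmf" where
  "equilibrium = embed_pmf (\<lambda>x. weight {} x / total_weight)"

abbreviation equilibrium_mean :: "('c list \<Rightarrow> real) \<Rightarrow> real" where
  "equilibrium_mean \<equiv> measure_pmf.expectation equilibrium"

lemma weight_sums: "(\<lambda>n. \<Sum>x\<in>lists_of_length n. weight {} x) sums total_weight"
proof -
  obtain B where "\<And>n. (\<Sum>k\<le>n. \<Sum>x\<in>lists_of_length k. weight {} x) \<le> B"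
    using weight_bounded by blast
  then have "summable (\<lambda>n. \<Sum>x\<in>lists_of_length n. weight {} x)"
    by (intro bounded_imp_summable weight_sum_nonneg)
  then show ?thesis unfolding total_weight_def by (rule summable_sums)
qed

lemma total_weight_pos: "0 < total_weight"
proof -
  have "(\<Sum>n<1. \<Sum>x\<in>lists_of_length n. weight {} x) \<le> total_weight"
    unfolding total_weight_def
    using weight_sums by (intro sum_le_suminf) (auto simp: sums_iff intro!: weight_sum_nonneg)
  then show ?thesis by simp
qed

lemma pmf_equilibrium: "pmf equilibrium x = weight {} x / total_weight"
  unfolding equilibrium_def
proof (rule pmf_embed_pmf)
  show "0 \<le> weight {} x / total_weight" for x
    using total_weight_pos weight_pos[of "{}" x] by simp
  \<comment> \<open>The known convergence is that of the sums graded by length, so the total mass is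
    obtained by monotone truncation at length \<open>N\<close>.\<close>
  let ?f = "\<lambda>N x. ennreal (weight {} x / total_weight) * indicator {x. length x \<le> N} x"
  have "(\<integral>\<^sup>+x. ?f N x \<partial>count_space UNIV) = ennreal ((\<Sum>k\<le>N. \<Sum>x\<in>lists_of_length k. weight {} x) / total_weight)" for N
  proof -
    have "(\<integral>\<^sup>+x. ?f N x \<partial>count_space UNIV) = (\<Sum>x\<in>{x. length x \<le> N}. ennreal (weight {} x / total_weight))"
      by (subst nn_integral_count_space_indicator[symmetric]) (auto intro!: nn_integral_count_space_finite)
    also have "\<dots> = ennreal (\<Sum>x\<in>{x. length x \<le> N}. weight {} x / total_weight)"
      using total_weight_pos by (intro sum_ennreal) (auto intro!: divide_nonneg_pos less_imp_le[OF weight_pos])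
    finally show ?thesis by (simp add: sum_lists_up_to sum_divide_distrib)
  qed
  moreover have "(\<lambda>N. \<integral>\<^sup>+x. ?f N x \<partial>count_space UNIV) \<longlonglongrightarrow> (\<integral>\<^sup>+x. ennreal (weight {} x / total_weight) \<partial>count_space UNIV)"
  proof (rule nn_integral_LIMSEQ)
    show "incseq ?f" by (auto simp: incseq_def le_fun_def split: split_indicator)
    show "(\<lambda>N. ?f N x) \<longlonglongrightarrow> ennreal (weight {} x / total_weight)" for x
      by (rule tendsto_eventually) (auto simp: eventually_sequentially split: split_indicator)
  qed auto
  moreover have "(\<lambda>N. ennreal ((\<Sum>k\<le>N. \<Sum>x\<in>lists_of_length k. weight {} x) / total_weight)) \<longlonglongrightarrow> ennreal (total_weight / total_weight)"
    using weight_sums total_weight_pos unfolding sums_def_le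
    by (intro tendsto_ennrealI tendsto_divide) auto
  ultimately have "(\<integral>\<^sup>+x. ennreal (weight {} x / total_weight) \<partial>count_space UNIV) = ennreal (total_weight / total_weight)"
    by (auto intro: LIMSEQ_unique)
  then show "(\<integral>\<^sup>+x. ennreal (weight {} x / total_weight) \<partial>count_space UNIV) = 1"
    using total_weight_pos by simp
qed

text \<open>One side looks at states with one customer more, hence the two truncation levels; in the
  limit the offset disappears.\<close>

lemma equilibrium_eqI:
  assumes eq: "\<And>n. (\<Sum>x\<in>{x. length x \<le> Suc n}. weight {} x * f x) = (\<Sum>x\<in>{x. length x \<le> n}. weight {} x * g x)"
    and bounds: "\<And>x. \<bar>f x\<bar> \<le> B" "\<And>x. \<bar>g x\<bar> \<le> C"
  shows "equilibrium_mean f = equilibrium_mean g"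
proof -
  have "(\<lambda>n. \<Sum>x\<in>{x. length x \<le> Suc n}. pmf equilibrium x * f x) \<longlonglongrightarrow> equilibrium_mean f"
    by (rule LIMSEQ_Suc, rule expectation_lists_limit, rule bounds)
  moreover have "(\<lambda>n. \<Sum>x\<in>{x. length x \<le> n}. pmf equilibrium x * g x) \<longlonglongrightarrow> equilibrium_mean g"
    by (rule expectation_lists_limit, rule bounds)
  moreover have "(\<Sum>x\<in>{x. length x \<le> Suc n}. pmf equilibrium x * f x) = (\<Sum>x\<in>{x. length x \<le> n}. pmf equilibrium x * g x)" for n
    using eq[of n] by (simp add: pmf_equilibrium sum_divide_distrib[symmetric])
  ultimately show ?thesis by (auto intro: LIMSEQ_unique)
qed

lemma abs_sum_weighted_le:
  assumes "\<And>i. 0 \<le> w i" "\<And>i. \<bar>h i\<bar> \<le> (B::real)"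
  shows "\<bar>\<Sum>i\<in>I. w i * h i\<bar> \<le> (\<Sum>i\<in>I. w i) * B"
proof -
  have "\<bar>\<Sum>i\<in>I. w i * h i\<bar> \<le> (\<Sum>i\<in>I. \<bar>w i * h i\<bar>)" by (rule sum_abs)
  also have "\<dots> \<le> (\<Sum>i\<in>I. w i * B)"
    using assms by (intro sum_mono) (auto simp: abs_mult intro!: mult_left_mono)
  finally show ?thesis by (simp add: sum_distrib_right)
qed

lemma equilibrium_service:
  assumes f: "\<And>x. \<bar>f x\<bar> \<le> B"
  shows "equilibrium_mean
           (\<lambda>x. \<Sum>s\<in>UNIV. mu s * (if serves E s c x then f (serve E s x) else 0)) =
         lam c * equilibrium_mean f"
proof -
  have "0 \<le> B" using f[of "[]"] by linarith
  have "equilibrium_mean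
           (\<lambda>x. \<Sum>s\<in>UNIV. mu s * (if serves E s c x then f (serve E s x) else 0)) =
         equilibrium_mean (\<lambda>x. lam c * f x)"
  proof (rule equilibrium_eqI)
    show "\<bar>\<Sum>s\<in>UNIV. mu s * (if serves E s c x then f (serve E s x) else 0)\<bar> \<le> sum mu UNIV * B" for x
      using f \<open>0 \<le> B\<close> by (intro abs_sum_weighted_le less_imp_le[OF mu_pos]) auto
    show "\<bar>lam c * f x\<bar> \<le> lam c * B" for x
      using f[of x] lam_pos[of c] by (simp add: abs_mult)
    \<comment> \<open>Length 0 contributes nothing, as nobody is served in \<open>[]\<close>; the
      remaining lengths are matched after a shift by one.\<close>
    show "(\<Sum>x\<in>{x. length x \<le> Suc n}. weight {} x * (\<Sum>s\<in>UNIV. mu s * (if serves E s c x then f (serve E s x) else 0))) =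
          (\<Sum>x\<in>{x. length x \<le> n}. weight {} x * (lam c * f x))" for n
      unfolding sum_lists_up_to sum.atMost_Suc_shift service_balance
      by (simp add: sum_distrib_left mult_ac)
  qed
  then show ?thesis by simp
qed

lemma equilibrium_arrival:
  assumes f: "\<And>x. \<bar>f x\<bar> \<le> B"
  shows "equilibrium_mean (\<lambda>x. \<Sum>c\<in>UNIV. lam c * f (x @ [c])) =
         equilibrium_mean (\<lambda>x. capacity (set x) * f x)"
proof -
  have "0 \<le> B" using f[of "[]"] by linarith
  have capacity_le: "capacity A \<le> sum mu UNIV" for A
    unfolding capacity_def by (intro sum_mono2) (auto intro: less_imp_le[OF mu_pos])
  show ?thesis
  proof (rule sym, rule equilibrium_eqI)
    show "\<bar>\<Sum>c\<in>UNIV. lam c * f (x @ [c])\<bar> \<le> sum lam UNIV * B" for x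
      using f by (intro abs_sum_weighted_le less_imp_le[OF lam_pos]) auto
    show "\<bar>capacity (set x) * f x\<bar> \<le> sum mu UNIV * B" for x
      using f[of x] capacity_le[of "set x"] capacity_nonneg[of "set x"] \<open>0 \<le> B\<close>
      by (auto simp: abs_mult intro!: mult_mono)
    \<comment> \<open>Here length 0 drops out because \<open>capacity {} = 0\<close>.\<close>
    show "(\<Sum>x\<in>{x. length x \<le> Suc n}. weight {} x * (capacity (set x) * f x)) =
          (\<Sum>x\<in>{x. length x \<le> n}. weight {} x * (\<Sum>c\<in>UNIV. lam c * f (x @ [c])))" for n
      unfolding sum_lists_up_to sum.atMost_Suc_shift arrival_balance
      by (simp add: mult_ac)
  qed
qed

section \<open>The generator in equilibrium, and uniqueness of the equilibrium\<close>

definition rate :: "'c + 's \<Rightarrow> real" where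
  "rate e = (case e of Inl c \<Rightarrow> lam c | Inr s \<Rightarrow> mu s)"

definition total_rate :: real where
  "total_rate = (\<Sum>e\<in>UNIV. rate e)"

text \<open>To first order in the duration \<open>h\<close>, the transition probability from \<open>x\<close> to \<open>y\<close>.\<close>

abbreviation step_bound :: "real \<Rightarrow> 'c list \<Rightarrow> real \<Rightarrow> 'c list \<Rightarrow> real" where
  "step_bound K x h y \<equiv> (if y = x then 1 - h * total_rate else 0) +
     (\<Sum>e\<in>UNIV. if nxt E x e = y then h * rate e - K * h\<^sup>2 else 0)"

lemma rate_pos: "0 < rate e"
  by (simp add: rate_def lam_pos mu_pos split: sum.split)

lemma sum_events: "(\<Sum>e\<in>(UNIV :: ('c + 's) set). h e) = (\<Sum>c\<in>UNIV. h (Inl c)) + (\<Sum>s\<in>UNIV. h (Inr s))"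
  for h :: "'c + 's \<Rightarrow> real"
  unfolding UNIV_Plus_UNIV[symmetric] by (subst sum.Plus) auto

lemma total_rate_eq: "total_rate = sum lam UNIV + sum mu UNIV"
  by (simp add: total_rate_def sum_events rate_def)

text \<open>Burke's theorem in one step: seen from the new state, a departure of type \<open>c\<close> has
  intensity \<open>lam c\<close> whatever that state is.\<close>

lemma equilibrium_step:
  assumes f: "\<And>x. \<bar>f x\<bar> \<le> B"
  shows "equilibrium_mean
           (\<lambda>x. \<Sum>e\<in>UNIV. rate e * (drop_factor z x (nxt E x e) * f (nxt E x e))) =
         (total_rate - (\<Sum>c\<in>UNIV. lam c * (1 - z c))) * equilibrium_mean f"
proof -
  have "0 \<le> B" using f[of "[]"] by linarith
  let ?g = "\<lambda>c x. \<Sum>s\<in>UNIV. mu s * (if serves E s c x then f (serve E s x) else 0)"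
  let ?a = "\<lambda>x. \<Sum>c\<in>UNIV. lam c * f (x @ [c])"
  have integrable: "integrable (measure_pmf equilibrium) g" if "\<And>x. \<bar>g x\<bar> \<le> C" for g :: "_ \<Rightarrow> real" and C
    using that by (intro measure_pmf.integrable_const_bound[where B=C]) auto
  have capacity_le: "capacity A \<le> sum mu UNIV" for A
    unfolding capacity_def by (intro sum_mono2) (auto intro: less_imp_le[OF mu_pos])
  have [simp]: "integrable (measure_pmf equilibrium) f" using f by (rule integrable)
  have [simp]: "integrable (measure_pmf equilibrium) (?g c)" for c
    using f \<open>0 \<le> B\<close> by (intro integrable[where C="sum mu UNIV * B"] abs_sum_weighted_le less_imp_le[OF mu_pos]) auto
  have [simp]: "integrable (measure_pmf equilibrium) ?a"
    using f by (intro integrable[where C="sum lam UNIV * B"] abs_sum_weighted_le less_imp_le[OF lam_pos]) auto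
  have [simp]: "integrable (measure_pmf equilibrium) (\<lambda>x. capacity (set x) * f x)"
    using f capacity_le capacity_nonneg \<open>0 \<le> B\<close>
    by (intro integrable[where C="sum mu UNIV * B"]) (auto simp: abs_mult intro!: mult_mono sum_nonneg less_imp_le[OF mu_pos])
  \<comment> \<open>Either the service removes a customer of exactly one type \<open>c\<close>, with
    factor \<open>z c\<close>, or it is void and leaves \<open>x\<close> with factor 1.\<close>
  have served: "drop_factor z x (serve E s x) * f (serve E s x) =
      (\<Sum>c\<in>UNIV. z c * (if serves E s c x then f (serve E s x) else 0)) +
      (if s \<in> (\<Union>c\<in>set x. servers E c) then 0 else f x)" for x s
  proof (cases "s \<in> (\<Union>c\<in>set x. servers E c)")
    case True
    then have less: "first_ix E s x < length x" using first_ix_less_iff[of E s x] by simp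
    define c where "c = x ! first_ix E s x"
    have serves: "serves E s d x \<longleftrightarrow> d = c" for d
      using less by (auto simp: serves_def c_def)
    have "drop_factor z x (serve E s x) = z c"
      using serves by (intro drop_factor_serve) auto
    then show ?thesis using True unfolding serves by (simp add: if_distrib cong: if_cong)
  next
    case False
    then have "\<not> serves E s c x" for c
      using first_ix_less_iff[of E s x] by (simp add: serves_def)
    then show ?thesis using False by (simp add: serve_idle)
  qed
  have "(\<Sum>e\<in>UNIV. rate e * (drop_factor z x (nxt E x e) * f (nxt E x e))) =
        ?a x + ((\<Sum>c\<in>UNIV. z c * ?g c x) + (sum mu UNIV * f x - capacity (set x) * f x))" for x
  proof -
    have "(\<Sum>s\<in>UNIV. mu s * (if s \<in> (\<Union>c\<in>set x. servers E c) then 0 else f x)) =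
          (\<Sum>s\<in>UNIV. mu s * f x) - (\<Sum>s\<in>(\<Union>c\<in>set x. servers E c). mu s * f x)"
    proof -
      have "(\<Sum>s\<in>UNIV. mu s * (if s \<in> (\<Union>c\<in>set x. servers E c) then 0 else f x)) =
          (\<Sum>s\<in>UNIV. mu s * f x - (if s \<in> (\<Union>c\<in>set x. servers E c) then mu s * f x else 0))"
        by (intro sum.cong) auto
      then show ?thesis by (simp add: sum_subtractf sum.If_cases UNION_eq)
    qed
    moreover have "(\<Sum>s\<in>UNIV. mu s * (\<Sum>c\<in>UNIV. z c * (if serves E s c x then f (serve E s x) else 0))) =
        (\<Sum>c\<in>UNIV. z c * ?g c x)"
      unfolding sum_distrib_left by (subst sum.swap) (simp add: mult.left_commute)
    ultimately show ?thesis
      unfolding sum_events rate_def nxt_def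
      by (simp add: served distrib_left sum.distrib capacity_def sum_distrib_right del: UN_iff)
  qed
  note split_event = this
  let ?E = "equilibrium_mean"
  have "?E (\<lambda>x. \<Sum>e\<in>UNIV. rate e * (drop_factor z x (nxt E x e) * f (nxt E x e))) =
      ?E ?a + ((\<Sum>c\<in>UNIV. z c * ?E (?g c)) + (sum mu UNIV * ?E f - ?E (\<lambda>x. capacity (set x) * f x)))"
    unfolding split_event by simp
  \<comment> \<open>By \<open>equilibrium_arrival\<close> the arrivals make up for the busy servers
    missing from the void services. So the void services and the arrivals together contribute the
    full rate \<open>sum mu UNIV\<close>.\<close>
  also have "\<dots> = (\<Sum>c\<in>UNIV. lam c * z c) * ?E f + sum mu UNIV * ?E f"
    unfolding equilibrium_service[where f=f, OF f] equilibrium_arrival[where f=f, OF f]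
    by (simp add: sum_distrib_left sum_distrib_right mult_ac)
  finally show ?thesis
    by (simp add: total_rate_eq algebra_simps sum_subtractf)
qed

text \<open>Testing with the indicator of the set \<open>S\<close> where \<open>p\<close> exceeds the equilibrium shows that
  \<open>S\<close> is closed under all events; then \<open>S\<close> is empty or everything, and the latter contradicts the
  total mass.\<close>

lemma equilibrium_unique:
  assumes invariant: "\<And>f. (\<And>x. \<bar>f x\<bar> \<le> 1) \<Longrightarrow>
      measure_pmf.expectation p (\<lambda>x. \<Sum>e\<in>UNIV. rate e * f (nxt E x e)) =
      total_rate * measure_pmf.expectation p f"
  shows "p = equilibrium"
proof -
  define S where "S = {x. pmf equilibrium x < pmf p x}"
  define f where "f x = (if x \<in> S then 1 else 0 :: real)" for x
  \<comment> \<open>The generator applied to the indicator of \<open>S\<close>; its mean vanishes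
    under both laws.\<close>
  define g where "g x = (\<Sum>e\<in>UNIV. rate e * (f (nxt E x e) - f x))" for x
  have f_bound: "\<bar>f x\<bar> \<le> 1" for x by (simp add: f_def)
  have nxt_bound: "\<bar>\<Sum>e\<in>UNIV. rate e * f (nxt E x e)\<bar> \<le> total_rate * 1" for x
    unfolding total_rate_def by (intro abs_sum_weighted_le less_imp_le[OF rate_pos] f_bound)
  have g_eq: "g x = (\<Sum>e\<in>UNIV. rate e * f (nxt E x e)) - total_rate * f x" for x
    by (simp add: g_def right_diff_distrib sum_subtractf total_rate_def sum_distrib_right)
  have total_nonneg: "0 \<le> total_rate" unfolding total_rate_def by (intro sum_nonneg less_imp_le[OF rate_pos])
  have g_bound: "\<bar>g x\<bar> \<le> total_rate + total_rate" for x
  proof -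
    have "\<bar>total_rate * f x\<bar> \<le> total_rate"
      using mult_left_mono[OF f_bound[of x] total_nonneg] by (simp add: abs_mult total_nonneg)
    then show ?thesis using nxt_bound[of x] unfolding g_eq by linarith
  qed
  have E0: "measure_pmf.expectation q g = 0"
    if "measure_pmf.expectation q (\<lambda>x. \<Sum>e\<in>UNIV. rate e * f (nxt E x e)) = total_rate * measure_pmf.expectation q f" for q
  proof -
    have "integrable (measure_pmf q) f" "integrable (measure_pmf q) (\<lambda>x. \<Sum>e\<in>UNIV. rate e * f (nxt E x e))"
      by (rule measure_pmf.integrable_const_bound; use f_bound nxt_bound in auto)+
    then show ?thesis using that by (simp add: g_eq[abs_def])
  qed
  have "measure_pmf.expectation p g = 0" using invariant f_bound by (intro E0) auto
  moreover have "equilibrium_mean g = 0"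
    using equilibrium_step[where f=f and z="\<lambda>_. 1", OF f_bound] by (intro E0) (simp add: drop_factor_def)
  ultimately have lim: "(\<lambda>n. \<Sum>x\<in>{x. length x \<le> n}. (pmf p x - pmf equilibrium x) * g x) \<longlonglongrightarrow> 0"
    using tendsto_diff[OF expectation_lists_limit[where g=g and p=p, OF g_bound]
        expectation_lists_limit[where g=g and p=equilibrium, OF g_bound]]
    by (simp add: sum_subtractf left_diff_distrib)
  \<comment> \<open>From inside \<open>S\<close> an event can only leave it, from outside only enter
    it; so \<open>g\<close> and the difference of the two laws never have the same strict
    sign.\<close>
  have nonpos: "(pmf p x - pmf equilibrium x) * g x \<le> 0" for x
  proof (cases "x \<in> S")
    case True
    then have "g x \<le> 0" unfolding g_def
      by (intro sum_nonpos mult_nonneg_nonpos less_imp_le[OF rate_pos]) (auto simp: f_def)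
    then show ?thesis using True by (auto simp: S_def mult_le_0_iff)
  next
    case False
    then have "g x \<ge> 0" unfolding g_def
      by (intro sum_nonneg mult_nonneg_nonneg less_imp_le[OF rate_pos]) (auto simp: f_def)
    then show ?thesis using False by (auto simp: S_def mult_le_0_iff)
  qed
  \<comment> \<open>The partial sums tend to 0 and have only nonpositive terms. Each single term
    eventually dominates them, hence is at least 0.\<close>
  have zero: "(pmf p x - pmf equilibrium x) * g x = 0" for x
  proof -
    have "0 \<le> (pmf p x - pmf equilibrium x) * g x"
    proof (rule LIMSEQ_le_const2[OF lim], intro exI allI impI)
      fix n assume "length x \<le> n"
      then have "(\<Sum>x\<in>{x. length x \<le> n}. (pmf p x - pmf equilibrium x) * g x) =
          (pmf p x - pmf equilibrium x) * g x + (\<Sum>x\<in>{x. length x \<le> n} - {x}. (pmf p x - pmf equilibrium x) * g x)"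
        by (intro sum.remove) auto
      also have "\<dots> \<le> (pmf p x - pmf equilibrium x) * g x"
        using sum_nonpos[of "{x. length x \<le> n} - {x}" "\<lambda>x. (pmf p x - pmf equilibrium x) * g x"] nonpos by simp
      finally show "(\<Sum>x\<in>{x. length x \<le> n}. (pmf p x - pmf equilibrium x) * g x) \<le>
          (pmf p x - pmf equilibrium x) * g x" .
    qed
    then show ?thesis using nonpos[of x] by simp
  qed
  have closed: "nxt E x e \<in> S" if "x \<in> S" for x e
  proof -
    have "g x = 0" using zero[of x] that by (auto simp: S_def)
    then have "(\<Sum>e\<in>UNIV. rate e * (f x - f (nxt E x e))) = 0"
      by (simp add: g_def right_diff_distrib sum_subtractf)
    then have "rate e * (f x - f (nxt E x e)) = 0"
      using that by (subst (asm) sum_nonneg_eq_0_iff)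
        (auto simp: f_def intro!: mult_nonneg_nonneg less_imp_le[OF rate_pos])
    then show ?thesis using that rate_pos[of e] by (auto simp: f_def split: if_splits)
  qed
  have "S = {}"
  proof (rule ccontr)
    assume "S \<noteq> {}"
    then obtain x where "x \<in> S" by blast
    \<comment> \<open>Services can empty the system and arrivals can then build up any list, so a
      nonempty closed set contains every state.\<close>
    then have "[] \<in> S"
    proof (induction x)
      case (Cons c x)
      have "servers E c \<noteq> {}" using capacity_pos[of "{c}"] by (auto simp: capacity_def)
      then obtain s where "s \<in> servers E c" by blast
      then have "nxt E (c # x) (Inr s) = x" by (simp add: nxt_def)
      then show ?case using closed[OF Cons.prems, of "Inr s"] Cons.IH by simp
    qed simp
    then have all: "y \<in> S" for y
    proof (induction y rule: rev_induct)
      case (snoc c y)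
      then show ?case using closed[of y "Inl c"] by (simp add: nxt_def)
    qed simp
    have one: "(\<lambda>n. \<Sum>x\<in>{x. length x \<le> n}. pmf q x * 1) \<longlonglongrightarrow> 1" for q :: "'c list pmf"
      using expectation_lists_limit[of "\<lambda>_. 1" 1 q] by simp
    have "(\<lambda>n. \<Sum>x\<in>{x. length x \<le> n}. (pmf p x - pmf equilibrium x)) \<longlonglongrightarrow> 0"
      using tendsto_diff[OF one[of p] one[of equilibrium]] by (simp add: sum_subtractf)
    moreover have "pmf p [] - pmf equilibrium [] \<le> (\<Sum>x\<in>{x. length x \<le> n}. (pmf p x - pmf equilibrium x))" for n
      using all by (intro member_le_sum) (auto simp: S_def intro: less_imp_le)
    ultimately have "pmf p [] - pmf equilibrium [] \<le> 0"
      by (intro LIMSEQ_le_const) auto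
    then show False using all[of "[]"] by (auto simp: S_def)
  qed
  \<comment> \<open>Distinct laws of total mass 1 exceed each other somewhere, which
    \<open>S = {}\<close> excludes.\<close>
  then show ?thesis using pmf_neq_exists_less[of equilibrium p] by (auto simp: S_def)
qed

end

section \<open>Stationary chains along a grid\<close>

text \<open>The values of probability 0 form a countable union of null sets, so the law is discrete.
  This puts the law of \<open>X 0\<close> into the form required by
  \<open>equilibrium_unique\<close>.\<close>

lemma pmf_of_countable_distr:
  fixes Y :: "'w \<Rightarrow> 'x::countable"
  assumes "prob_space M" and Y: "Y \<in> measurable M (count_space UNIV)"
  obtains p where "measure_pmf p = distr M (count_space UNIV) Y"
proof -
  interpret prob_space M by fact
  let ?D = "distr M (count_space UNIV) Y"
  interpret D: prob_space ?D by (rule prob_space_distr[OF Y])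
  have "(\<Union>x\<in>{x. measure ?D {x} = 0}. {x}) \<in> null_sets ?D"
    by (rule null_sets_UN') (auto intro!: null_setsI simp: D.emeasure_eq_measure)
  then have "AE x in ?D. x \<notin> (\<Union>x\<in>{x. measure ?D {x} = 0}. {x})" by (rule AE_not_in)
  then have "AE x in ?D. measure ?D {x} \<noteq> 0" by (rule AE_mp) simp
  then have "?D \<in> {M. prob_space M \<and> sets M = UNIV \<and> (AE x in M. measure M {x} \<noteq> 0)}"
    using D.prob_space_axioms by simp
  then have "measure_pmf (Abs_pmf ?D) = ?D" by (rule Abs_pmf_inverse)
  then show ?thesis by (rule that)
qed

text \<open>Stands in for conditioning on \<open>V\<close>: bounds relative to the atoms
  \<open>V w = v\<close> add up, as the atoms have total probability 1. Codes below \<open>n\<close>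
  give finite sums, and dominated convergence removes the truncation.\<close>

lemma (in prob_space) abs_expectation_le_by_atoms:
  fixes V :: "'a \<Rightarrow> 'v::countable" and H :: "'a \<Rightarrow> real"
  assumes V: "V \<in> measurable M (count_space UNIV)" and H: "integrable M H"
    and atoms: "\<And>v. \<bar>expectation (\<lambda>w. H w * indicator {w\<in>space M. V w = v} w)\<bar> \<le> e * prob {w\<in>space M. V w = v}"
    and "0 \<le> e"
  shows "\<bar>expectation H\<bar> \<le> e"
proof -
  have [measurable]: "V \<in> measurable M (count_space UNIV)" by fact
  have [measurable]: "H \<in> borel_measurable M" using H by simp
  let ?A = "\<lambda>k. {w\<in>space M. to_nat (V w) = k}"
  have "\<bar>expectation (\<lambda>w. H w * indicator {w\<in>space M. to_nat (V w) < n} w)\<bar> \<le> e" for n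
  proof -
    have ind: "H w * indicator {w\<in>space M. to_nat (V w) < n} w = (\<Sum>k<n. H w * indicator (?A k) w)" if "w \<in> space M" for w
      using that by (simp add: indicator_def sum.delta if_distrib cong: if_cong)
    have single: "\<bar>expectation (\<lambda>w. H w * indicator (?A k) w)\<bar> \<le> e * prob (?A k)" for k
    proof (cases "k \<in> range (to_nat :: 'v \<Rightarrow> nat)")
      case True
      then obtain v :: 'v where "k = to_nat v" by blast
      then show ?thesis using atoms[of v] by simp
    next
      case False
      then have "?A k = {}" by auto
      then show ?thesis by (simp only:) simp
    qed
    have "expectation (\<lambda>w. H w * indicator {w\<in>space M. to_nat (V w) < n} w) =
        (\<Sum>k<n. expectation (\<lambda>w. H w * indicator (?A k) w))"
    proof -
      have "integrable M (\<lambda>w. H w * indicator (?A k) w)" for k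
        by (rule integrable_real_mult_indicator[OF _ H]) measurable
      then have "(\<Sum>k<n. expectation (\<lambda>w. H w * indicator (?A k) w)) =
          expectation (\<lambda>w. \<Sum>k<n. H w * indicator (?A k) w)"
        by (subst Bochner_Integration.integral_sum) auto
      moreover have "expectation (\<lambda>w. H w * indicator {w\<in>space M. to_nat (V w) < n} w) =
          expectation (\<lambda>w. \<Sum>k<n. H w * indicator (?A k) w)"
        by (rule Bochner_Integration.integral_cong[OF refl ind])
      ultimately show ?thesis by (simp only:)
    qed
    then have "\<bar>expectation (\<lambda>w. H w * indicator {w\<in>space M. to_nat (V w) < n} w)\<bar> \<le>
        (\<Sum>k<n. \<bar>expectation (\<lambda>w. H w * indicator (?A k) w)\<bar>)" by simp
    also have "\<dots> \<le> (\<Sum>k<n. e * prob (?A k))" by (intro sum_mono single)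
    also have "\<dots> = e * prob (\<Union>k<n. ?A k)"
      by (subst finite_measure_finite_Union) (auto simp: sum_distrib_left disjoint_family_on_def)
    also have "\<dots> \<le> e * 1" using \<open>0 \<le> e\<close> by (intro mult_left_mono) auto
    finally show ?thesis by simp
  qed
  moreover have "(\<lambda>n. expectation (\<lambda>w. H w * indicator {w\<in>space M. to_nat (V w) < n} w)) \<longlonglongrightarrow> expectation H"
  proof (rule integral_dominated_convergence[where w="\<lambda>w. \<bar>H w\<bar>"])
    show "AE w in M. (\<lambda>n. H w * indicator {w\<in>space M. to_nat (V w) < n} w) \<longlonglongrightarrow> H w"
    proof (rule AE_I2)
      fix w assume space: "w \<in> space M"
      have "\<forall>\<^sub>F n in sequentially. H w * indicator {w\<in>space M. to_nat (V w) < n} w = H w"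
        using eventually_gt_at_top[of "to_nat (V w)"] by eventually_elim (simp add: space)
      then show "(\<lambda>n. H w * indicator {w\<in>space M. to_nat (V w) < n} w) \<longlonglongrightarrow> H w"
        by (rule tendsto_eventually)
    qed
  qed (use H in \<open>auto split: split_indicator\<close>)
  ultimately show ?thesis
    by (intro LIMSEQ_le_const2[OF tendsto_rabs]) auto
qed

text \<open>The lower bound on \<open>P\<close> is all that is used of the two models; it has total mass
  \<open>1 - O(h\<^sup>2)\<close>, so that it determines \<open>P\<close> up to \<open>O(h\<^sup>2)\<close>.\<close>

locale stationary_fcfs = parallel_fcfs E lam mu + prob_space M
  for E :: "('s::finite \<times> 'c::finite) set" and lam :: "'c \<Rightarrow> real" and mu :: "'s \<Rightarrow> real"
    and M :: "'w measure" +
  fixes X :: "real \<Rightarrow> 'w \<Rightarrow> 'c list" and P :: "'c list \<Rightarrow> real \<Rightarrow> 'c list \<Rightarrow> real" and K :: real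
  assumes chain: "stationary_chain M X P"
    and K_nonneg: "0 \<le> K"
    and trans_ge: "\<And>x y h. 0 < h \<Longrightarrow> step_bound K x h y \<le> P x h y"
begin

lemma X_measurable [measurable]: "X t \<in> measurable M (count_space UNIV)"
  using chain by (simp add: stationary_chain_def)

text \<open>First-order approximation of the mean of \<open>F x Y\<close>, where \<open>Y\<close> is
  the state reached from \<open>x\<close> after time \<open>h\<close>.\<close>

definition step_mean :: "real \<Rightarrow> ('c list \<Rightarrow> 'c list \<Rightarrow> real) \<Rightarrow> 'c list \<Rightarrow> real" where
  "step_mean h F x = (1 - h * total_rate) * F x x + h * (\<Sum>e\<in>UNIV. rate e * F x (nxt E x e))"

text \<open>For each event the lower bound on \<open>P\<close> falls short by
  \<open>K * h\<^sup>2\<close>. The deficit counts twice: as mass of unknown location, and as the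
  distance of the bound from \<open>step_mean\<close>.\<close>

definition step_error :: real where
  "step_error = 2 * K * real CARD('c + 's)"

lemma step_error_nonneg: "0 \<le> step_error"
  using K_nonneg by (simp add: step_error_def)

lemma total_rate_nonneg: "0 \<le> total_rate"
  unfolding total_rate_def by (intro sum_nonneg less_imp_le[OF rate_pos])

lemma abs_step_mean_le:
  assumes F: "\<And>x y. \<bar>F x y\<bar> \<le> 1" and "0 \<le> h"
  shows "\<bar>step_mean h F x\<bar> \<le> \<bar>1 - h * total_rate\<bar> + h * total_rate"
proof -
  have "\<bar>\<Sum>e\<in>UNIV. rate e * F x (nxt E x e)\<bar> \<le> total_rate * 1"
    unfolding total_rate_def by (intro abs_sum_weighted_le less_imp_le[OF rate_pos] F)
  from mult_left_mono[OF this \<open>0 \<le> h\<close>]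
  have "\<bar>h * (\<Sum>e\<in>UNIV. rate e * F x (nxt E x e))\<bar> \<le> h * total_rate"
    using \<open>0 \<le> h\<close> by (simp add: abs_mult)
  moreover have "\<bar>(1 - h * total_rate) * F x x\<bar> \<le> \<bar>1 - h * total_rate\<bar>"
    using F[of x x] by (simp add: abs_mult mult_left_le)
  ultimately show ?thesis
    unfolding step_mean_def by (intro order_trans[OF abs_triangle_ineq add_mono])
qed

text \<open>\<open>A\<close> stands for an event of the past that fixes the present state
  \<open>x\<close>, and \<open>Y\<close> for the next state. All terms carry the factor
  \<open>prob A\<close> instead of being conditional on \<open>A\<close>, so that null events need
  no separate treatment.\<close>

lemma expectation_on_atom:
  fixes F :: "'c list \<Rightarrow> real"
  assumes "0 < h" and A: "A \<in> events" and Y[measurable]: "Y \<in> measurable M (count_space UNIV)"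
    and law: "\<And>y. prob (A \<inter> {w\<in>space M. Y w = y}) = prob A * P x h y"
    and F: "\<And>y. \<bar>F y\<bar> \<le> 1"
  shows "\<bar>expectation (\<lambda>w. indicator A w * F (Y w)) - prob A * step_mean h (\<lambda>_. F) x\<bar> \<le>
         prob A * (step_error * h\<^sup>2)"
proof -
  have [measurable]: "A \<in> events" by fact
  define n where "n = real CARD('c + 's)"
  define S where "S = insert x (range (nxt E x))"
  define L where "L y = step_bound K x h y" for y
  have "finite S" by (simp add: S_def)
  let ?J = "\<lambda>y. prob (A \<inter> {w\<in>space M. Y w = y})"
  let ?R = "A \<inter> {w\<in>space M. Y w \<notin> S}"
  \<comment> \<open>Regroups target states into events, since several events may have the same
    target; all void services lead back to \<open>x\<close>.\<close>
  have L_sum: "(\<Sum>y\<in>S. L y * G y) = (1 - h * total_rate) * G x + (\<Sum>e\<in>UNIV. (h * rate e - K * h\<^sup>2) * G (nxt E x e))"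
    for G :: "_ \<Rightarrow> real"
  proof -
    have "(\<Sum>y\<in>S. (if y = x then 1 - h * total_rate else 0) * G y) = (1 - h * total_rate) * G x"
      using \<open>finite S\<close> by (subst sum.remove[of _ x]) (auto simp: S_def intro!: sum.neutral)
    moreover have "(\<Sum>y\<in>S. (\<Sum>e\<in>UNIV. if nxt E x e = y then h * rate e - K * h\<^sup>2 else 0) * G y) =
       (\<Sum>e\<in>UNIV. \<Sum>y\<in>S. if nxt E x e = y then (h * rate e - K * h\<^sup>2) * G (nxt E x e) else 0)"
      unfolding sum_distrib_right by (subst sum.swap) (intro sum.cong refl, auto)
    moreover have "\<dots> = (\<Sum>e\<in>UNIV. (h * rate e - K * h\<^sup>2) * G (nxt E x e))"
      using \<open>finite S\<close> by (intro sum.cong refl) (simp add: S_def)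
    ultimately show ?thesis by (simp add: L_def distrib_right sum.distrib)
  qed
  have L_total: "(\<Sum>y\<in>S. L y) = 1 - n * (K * h\<^sup>2)"
    using L_sum[of "\<lambda>_. 1"] by (simp add: sum_subtractf sum_distrib_left[symmetric] total_rate_def n_def)
  have L_mean: "(\<Sum>y\<in>S. L y * F y) = step_mean h (\<lambda>_. F) x - (\<Sum>e\<in>UNIV. (K * h\<^sup>2) * F (nxt E x e))"
    unfolding L_sum step_mean_def by (simp add: left_diff_distrib sum_subtractf sum_distrib_left mult.assoc)
  have J_ge: "prob A * L y \<le> ?J y" for y
    unfolding law L_def by (intro mult_left_mono trans_ge \<open>0 < h\<close>) simp
  have split: "indicator A w * F (Y w) =
      (\<Sum>y\<in>S. F y * indicator (A \<inter> {w\<in>space M. Y w = y}) w) + indicator ?R w * F (Y w)" if "w \<in> space M" for w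
  proof (cases "Y w \<in> S")
    case True
    have "(\<Sum>y\<in>S. F y * indicator (A \<inter> {w\<in>space M. Y w = y}) w) = (\<Sum>y\<in>S. if y = Y w then indicator A w * F (Y w) else 0)"
      using that by (intro sum.cong) (auto split: split_indicator)
    then show ?thesis using True \<open>finite S\<close> by simp
  next
    case False
    then have "(\<Sum>y\<in>S. F y * indicator (A \<inter> {w\<in>space M. Y w = y}) w) = 0"
      by (intro sum.neutral) (auto split: split_indicator)
    then show ?thesis using that False by (auto split: split_indicator)
  qed
  have int_R: "integrable M (\<lambda>w. indicator ?R w * F (Y w))"
    using F by (intro integrable_const_bound[where B=1]) (auto split: split_indicator)
  have "expectation (\<lambda>w. indicator A w * F (Y w)) =
      (\<Sum>y\<in>S. F y * ?J y) + expectation (\<lambda>w. indicator ?R w * F (Y w))"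
  proof -
    have "expectation (\<lambda>w. indicator A w * F (Y w)) =
        expectation (\<lambda>w. (\<Sum>y\<in>S. F y * indicator (A \<inter> {w\<in>space M. Y w = y}) w) + indicator ?R w * F (Y w))"
      by (rule Bochner_Integration.integral_cong[OF refl split])
    also have "\<dots> = expectation (\<lambda>w. \<Sum>y\<in>S. F y * indicator (A \<inter> {w\<in>space M. Y w = y}) w) +
        expectation (\<lambda>w. indicator ?R w * F (Y w))"
      by (rule Bochner_Integration.integral_add[OF _ int_R]) (auto simp: less_top[symmetric])
    also have "expectation (\<lambda>w. \<Sum>y\<in>S. F y * indicator (A \<inter> {w\<in>space M. Y w = y}) w) = (\<Sum>y\<in>S. F y * ?J y)"
      by (subst Bochner_Integration.integral_sum) (auto simp: less_top[symmetric] Int_absorb2 le_infI1 sets.sets_into_space[OF A])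
    finally show ?thesis .
  qed
  \<comment> \<open>This estimate and the next one add up: the mass outside \<open>S\<close> and the
    excess over the bound inside \<open>S\<close> amount together to
    \<open>prob A * (n * (K * h\<^sup>2))\<close>.\<close>
  moreover have "\<bar>expectation (\<lambda>w. indicator ?R w * F (Y w))\<bar> \<le> prob A - (\<Sum>y\<in>S. ?J y)"
  proof -
    have "\<bar>expectation (\<lambda>w. indicator ?R w * F (Y w))\<bar> \<le> expectation (\<lambda>w. \<bar>indicator ?R w * F (Y w)\<bar>)"
      by (rule integral_abs_bound)
    also have "\<dots> \<le> expectation (indicator ?R)"
      using F by (intro integral_mono integrable_abs int_R) (auto split: split_indicator simp: less_top[symmetric])
    also have "\<dots> = prob ?R" by (simp add: Int_commute)
    also have "prob A = prob (\<Union>y\<in>S. A \<inter> {w\<in>space M. Y w = y}) + prob ?R"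
      using sets.sets_into_space[OF A] \<open>finite S\<close>
      by (subst finite_measure_Union[symmetric]) (auto intro!: arg_cong[where f=prob])
    then have "prob ?R = prob A - (\<Sum>y\<in>S. ?J y)"
      using \<open>finite S\<close> by (subst (asm) finite_measure_finite_Union) (auto simp: disjoint_family_on_def)
    finally show ?thesis by simp
  qed
  moreover have "\<bar>(\<Sum>y\<in>S. F y * ?J y) - prob A * (\<Sum>y\<in>S. L y * F y)\<bar> \<le> (\<Sum>y\<in>S. ?J y) - prob A * (1 - n * (K * h\<^sup>2))"
  proof -
    have "(\<Sum>y\<in>S. F y * ?J y) - prob A * (\<Sum>y\<in>S. L y * F y) = (\<Sum>y\<in>S. (?J y - prob A * L y) * F y)"
      by (simp add: sum_subtractf sum_distrib_left right_diff_distrib mult_ac)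
    also have "\<bar>\<dots>\<bar> \<le> (\<Sum>y\<in>S. ?J y - prob A * L y) * 1"
      by (intro abs_sum_weighted_le F) (simp add: J_ge)
    finally show ?thesis by (simp add: sum_subtractf sum_distrib_left[symmetric] L_total)
  qed
  moreover have "\<bar>prob A * (\<Sum>e\<in>UNIV. (K * h\<^sup>2) * F (nxt E x e))\<bar> \<le> prob A * (n * (K * h\<^sup>2))"
  proof -
    have "\<bar>\<Sum>e\<in>UNIV. (K * h\<^sup>2) * F (nxt E x e)\<bar> \<le> (\<Sum>e\<in>(UNIV :: ('c + 's) set). K * h\<^sup>2) * 1"
      using K_nonneg by (intro abs_sum_weighted_le F) simp
    then show ?thesis by (simp add: abs_mult mult_left_mono n_def)
  qed
  moreover have "prob A * step_mean h (\<lambda>_. F) x =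
      prob A * (\<Sum>y\<in>S. L y * F y) + prob A * (\<Sum>e\<in>UNIV. (K * h\<^sup>2) * F (nxt E x e))"
    by (simp add: L_mean right_diff_distrib)
  moreover have "prob A * (step_error * h\<^sup>2) = 2 * (prob A * (n * (K * h\<^sup>2)))"
    by (simp add: step_error_def n_def)
  moreover have "prob A * (1 - n * (K * h\<^sup>2)) = prob A - prob A * (n * (K * h\<^sup>2))"
    by (simp add: right_diff_distrib)
  ultimately show ?thesis by linarith
qed

text \<open>\<open>markov_chain\<close> speaks only of events that fix all states on a grid. The
  past therefore enters as the list \<open>V\<close> of all grid values so far, which is countably
  valued; on each of its atoms \<open>phi\<close> and the present state are constant.\<close>

lemma expectation_step:
  assumes t: "\<And>i. i \<le> N \<Longrightarrow> t i < t (Suc i)"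
    and phi: "\<And>v. \<bar>phi v\<bar> \<le> 1" and F: "\<And>x y. \<bar>F x y\<bar> \<le> 1"
  shows "\<bar>expectation (\<lambda>w. phi (map (\<lambda>i. X (t i) w) [0..<Suc N]) * F (X (t N) w) (X (t (Suc N)) w)) -
          expectation (\<lambda>w. phi (map (\<lambda>i. X (t i) w) [0..<Suc N]) * step_mean (t (Suc N) - t N) F (X (t N) w))\<bar>
         \<le> step_error * (t (Suc N) - t N)\<^sup>2"
proof -
  define h where "h = t (Suc N) - t N"
  have "0 < h" using t[of N] by (simp add: h_def)
  define V where "V w = map (\<lambda>i. X (t i) w) [0..<Suc N]" for w
  have V_iff: "V w = v \<longleftrightarrow> length v = Suc N \<and> (\<forall>i\<le>N. X (t i) w = v ! i)" for w v
    by (auto simp: V_def list_eq_iff_nth_eq less_Suc_eq_le simp del: upt_Suc)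
  have V[measurable]: "V \<in> measurable M (count_space UNIV)"
  proof (rule measurable_count_space_eq2_countable[THEN iffD2], safe)
    fix v show "V -` {v} \<inter> space M \<in> events"
    proof -
      have "V -` {v} \<inter> space M = {w\<in>space M. length v = Suc N \<and> (\<forall>i\<in>{..N}. X (t i) w = v ! i)}"
        using V_iff by auto
      also have "\<dots> \<in> events" by measurable
      finally show ?thesis .
    qed
  qed auto
  have int1: "integrable M (\<lambda>w. phi (V w) * F (X (t N) w) (X (t (Suc N)) w))"
    using phi F by (intro integrable_const_bound[where B=1]) (auto simp: abs_mult intro!: mult_le_one)
  have int2: "integrable M (\<lambda>w. phi (V w) * step_mean h F (X (t N) w))"
  proof (rule integrable_const_bound)
    show "AE w in M. norm (phi (V w) * step_mean h F (X (t N) w)) \<le> 1 * (\<bar>1 - h * total_rate\<bar> + h * total_rate)"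
      unfolding real_norm_def abs_mult
      using F \<open>0 < h\<close> by (intro AE_I2 mult_mono phi abs_step_mean_le) auto
  qed measurable
  let ?H = "\<lambda>w. phi (V w) * F (X (t N) w) (X (t (Suc N)) w) - phi (V w) * step_mean h F (X (t N) w)"
  have "\<bar>expectation ?H\<bar> \<le> step_error * h\<^sup>2"
  proof (rule abs_expectation_le_by_atoms[OF V])
    fix v
    let ?A = "{w\<in>space M. V w = v}"
    show "\<bar>expectation (\<lambda>w. ?H w * indicator ?A w)\<bar> \<le> step_error * h\<^sup>2 * prob ?A"
    proof (cases "length v = Suc N")
      case False
      then have "?A = {}" using V_iff by auto
      then show ?thesis by (simp only:) simp
    next
      case True
      define x where "x = v ! N"
      have x: "X (t N) w = x" if "V w = v" for w using that V_iff by (auto simp: x_def)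
      have "expectation (\<lambda>w. ?H w * indicator ?A w) =
          expectation (\<lambda>w. phi v * (indicator ?A w * F x (X (t (Suc N)) w)) - phi v * step_mean h F x * indicator ?A w)"
        by (intro Bochner_Integration.integral_cong) (auto split: split_indicator simp: x)
      also have "\<dots> = phi v * expectation (\<lambda>w. indicator ?A w * F x (X (t (Suc N)) w)) - phi v * step_mean h F x * prob ?A"
      proof -
        have "integrable M (\<lambda>w. indicator ?A w * F x (X (t (Suc N)) w))"
          using F by (intro integrable_const_bound[where B=1]) (auto split: split_indicator)
        then show ?thesis by (subst Bochner_Integration.integral_diff) (auto simp: less_top[symmetric])
      qed
      also have "\<dots> = phi v * (expectation (\<lambda>w. indicator ?A w * F x (X (t (Suc N)) w)) - prob ?A * step_mean h (\<lambda>_. F x) x)"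
        by (simp add: step_mean_def algebra_simps)
      also have "\<bar>\<dots>\<bar> \<le> 1 * (prob ?A * (step_error * h\<^sup>2))"
        unfolding abs_mult
      proof (intro mult_mono phi)
        show "\<bar>expectation (\<lambda>w. indicator ?A w * F x (X (t (Suc N)) w)) - prob ?A * step_mean h (\<lambda>_. F x) x\<bar> \<le>
          prob ?A * (step_error * h\<^sup>2)"
        proof (rule expectation_on_atom[OF \<open>0 < h\<close>])
          fix y
          define path where "path i = (if i \<le> N then v ! i else y)" for i
          have "measure M {w\<in>space M. \<forall>i\<le>Suc N. X (t i) w = path i} =
              measure M {w\<in>space M. \<forall>i\<le>N. X (t i) w = path i} * P (path N) (t (Suc N) - t N) (path (Suc N))"
            using chain t by (simp add: stationary_chain_def markov_chain_def)
          moreover have "{w\<in>space M. \<forall>i\<le>Suc N. X (t i) w = path i} = ?A \<inter> {w\<in>space M. X (t (Suc N)) w = y}"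
            using True by (auto simp: V_iff path_def le_Suc_eq)
          moreover have "{w\<in>space M. \<forall>i\<le>N. X (t i) w = path i} = ?A"
            using True by (auto simp: V_iff path_def)
          ultimately show "prob (?A \<inter> {w\<in>space M. X (t (Suc N)) w = y}) = prob ?A * P x h y"
            by (simp add: x_def path_def h_def)
        qed (use F in auto)
      qed auto
      finally show ?thesis by (simp add: mult_ac)
    qed
  qed (use int1 int2 step_error_nonneg in auto)
  then show ?thesis using int1 int2 by (simp add: V_def h_def)
qed

section \<open>The law at a fixed time\<close>

lemma distr_X: "distr M (count_space UNIV) (X t) = distr M (count_space UNIV) (X 0)"
proof -
  let ?Pi = "PiM UNIV (\<lambda>_ :: real. count_space (UNIV :: 'c list set))"
  have m: "(\<lambda>w s. X (s + h) w) \<in> measurable M ?Pi" for h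
    by (rule measurable_PiM_single') (auto intro: X_measurable)
  have p: "(\<lambda>f. f 0) \<in> measurable ?Pi (count_space UNIV)"
    by (rule measurable_component_singleton) simp
  have eq: "distr M ?Pi (\<lambda>w s. X (s + t) w) = distr M ?Pi (\<lambda>w s. X s w)"
    using chain unfolding stationary_chain_def stationary_def by blast
  have "distr (distr M ?Pi (\<lambda>w s. X (s + h) w)) (count_space UNIV) (\<lambda>f. f 0) = distr M (count_space UNIV) (X h)" for h
    by (subst distr_distr[OF p m]) (simp add: comp_def)
  note project = this
  have "distr M (count_space UNIV) (X t) = distr (distr M ?Pi (\<lambda>w s. X s w)) (count_space UNIV) (\<lambda>f. f 0)"
    unfolding eq[symmetric] by (rule project[symmetric])
  also have "\<dots> = distr M (count_space UNIV) (X 0)"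
    using project[of 0] by simp
  finally show ?thesis .
qed

lemma expectation_stationary: "expectation (\<lambda>w. g (X t w)) = expectation (\<lambda>w. g (X 0 w))"
  for g :: "'c list \<Rightarrow> real"
proof -
  have "expectation (\<lambda>w. g (X u w)) = integral\<^sup>L (distr M (count_space UNIV) (X u)) g" for u
    by (subst integral_distr) auto
  from this[of t] this[of 0] show ?thesis by (simp only: distr_X[of t])
qed

text \<open>By stationarity the mean of \<open>f\<close> does not change over a step, whereas the
  generator would change it by \<open>h\<close> times a fixed number, up to
  \<open>O(h\<^sup>2)\<close>. Hence that number is 0, which is the hypothesis of
  \<open>equilibrium_unique\<close>.\<close>

lemma distr_X_equilibrium: "distr M (count_space UNIV) (X t) = measure_pmf equilibrium"
proof -
  obtain p where p: "measure_pmf p = distr M (count_space UNIV) (X 0)"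
    using pmf_of_countable_distr[OF prob_space_axioms X_measurable] by blast
  have E_p: "measure_pmf.expectation p g = expectation (\<lambda>w. g (X 0 w))" for g :: "_ \<Rightarrow> real"
    unfolding p by (subst integral_distr) auto
  have "p = equilibrium"
  proof (rule equilibrium_unique)
    fix f :: "'c list \<Rightarrow> real" assume f: "\<And>x. \<bar>f x\<bar> \<le> 1"
    define a where "a = expectation (\<lambda>w. f (X 0 w))"
    define b where "b = expectation (\<lambda>w. \<Sum>e\<in>UNIV. rate e * f (nxt E (X 0 w) e))"
    have int: "integrable M (\<lambda>w. f (X 0 w))"
      using f by (intro integrable_const_bound[where B=1]) auto
    have int': "integrable M (\<lambda>w. \<Sum>e\<in>UNIV. rate e * f (nxt E (X 0 w) e))"
    proof (rule integrable_const_bound[where B="total_rate * 1"])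
      show "AE w in M. norm (\<Sum>e\<in>UNIV. rate e * f (nxt E (X 0 w) e)) \<le> total_rate * 1"
        unfolding total_rate_def real_norm_def
        by (intro AE_I2 abs_sum_weighted_le less_imp_le[OF rate_pos] f)
    qed measurable
    have bound: "h * \<bar>total_rate * a - b\<bar> \<le> h * (step_error * h)" if "0 < h" for h
    proof -
      have "\<bar>expectation (\<lambda>w. f (X h w)) - expectation (\<lambda>w. step_mean h (\<lambda>_. f) (X 0 w))\<bar> \<le> step_error * h\<^sup>2"
        using expectation_step[of 0 "\<lambda>i. real i * h" "\<lambda>_. 1" "\<lambda>_. f"] f that by simp
      moreover have "expectation (\<lambda>w. step_mean h (\<lambda>_. f) (X 0 w)) = (1 - h * total_rate) * a + h * b"
        unfolding step_mean_def a_def b_def using int int' by simp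
      ultimately have "\<bar>h * (total_rate * a - b)\<bar> \<le> step_error * h\<^sup>2"
        by (simp add: expectation_stationary[of f h] a_def[symmetric] algebra_simps)
      then show ?thesis using that by (simp add: abs_mult power2_eq_square mult_ac)
    qed
    have "\<bar>total_rate * a - b\<bar> \<le> 0"
    proof (rule tendsto_lowerbound)
      show "((\<lambda>h. step_error * h) \<longlongrightarrow> 0) (at_right 0)"
        by (intro tendsto_mult_right_zero tendsto_ident_at)
      show "\<forall>\<^sub>F h in at_right 0. \<bar>total_rate * a - b\<bar> \<le> step_error * h"
        using bound by (auto simp: eventually_at_right_field intro!: exI[of _ 1] dest: mult_left_le_imp_le)
    qed auto
    then show "measure_pmf.expectation p (\<lambda>x. \<Sum>e\<in>UNIV. rate e * f (nxt E x e)) =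
        total_rate * measure_pmf.expectation p f"
      by (simp add: E_p a_def b_def)
  qed
  then show ?thesis using p by (simp add: distr_X[of t])
qed

lemma expectation_X: "expectation (\<lambda>w. g (X t w)) = equilibrium_mean g"
  for g :: "'c list \<Rightarrow> real"
  unfolding distr_X_equilibrium[of t, symmetric] by (subst integral_distr) auto

text \<open>The exponent of a Poisson generating function: for independent Poisson streams of rates
  \<open>lam c\<close>, with a factor \<open>z c\<close> for each point, the mean product over a
  time \<open>t\<close> is \<open>exp (- t * thinning z)\<close>.\<close>

definition thinning :: "('c \<Rightarrow> real) \<Rightarrow> real" where
  "thinning z = (\<Sum>c\<in>UNIV. lam c * (1 - z c))"

text \<open>Splitting off the last step replaces \<open>f\<close> by \<open>g\<close>, and
  \<open>equilibrium_step\<close> gives the mean of \<open>g\<close> as a multiple of that of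
  \<open>f\<close>; the induction therefore needs all bounded \<open>f\<close>. The condition on the
  mesh keeps \<open>g\<close> bounded by 1, so that the errors of the steps add up without being
  amplified.\<close>

lemma expectation_grid:
  assumes t: "\<And>i. i < N \<Longrightarrow> t i < t (Suc i)" "\<And>i. i < N \<Longrightarrow> (t (Suc i) - t i) * total_rate \<le> 1"
    and z: "\<And>i c. \<bar>z i c\<bar> \<le> 1" and f: "\<And>x. \<bar>f x\<bar> \<le> 1"
  shows "\<bar>expectation (\<lambda>w. (\<Prod>i<N. drop_factor (z i) (X (t i) w) (X (t (Suc i)) w)) * f (X (t N) w)) -
          (\<Prod>i<N. 1 - (t (Suc i) - t i) * thinning (z i)) * equilibrium_mean f\<bar>
         \<le> (\<Sum>i<N. step_error * (t (Suc i) - t i)\<^sup>2)"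
  using t f
proof (induction N arbitrary: f)
  case 0
  then show ?case by (simp add: expectation_X)
next
  case (Suc N f)
  define h where "h = t (Suc N) - t N"
  have h: "0 < h" "h * total_rate \<le> 1" using Suc.prems(1,2)[of N] by (auto simp: h_def)
  define F where "F x y = drop_factor (z N) x y * f y" for x y
  have F: "\<bar>F x y\<bar> \<le> 1" for x y
    unfolding F_def abs_mult using z Suc.prems(3) by (intro mult_le_one abs_drop_factor_le) auto
  define g where "g = step_mean h F"
  have g: "\<bar>g x\<bar> \<le> 1" for x
    using abs_step_mean_le[of F h x] F h by (simp add: g_def)
  define phi where "phi v = (\<Prod>i<N. drop_factor (z i) (v ! i) (v ! Suc i))" for v
  have phi: "\<bar>phi v\<bar> \<le> 1" for v
    unfolding phi_def abs_prod using z by (intro prod_le_1) (auto intro: abs_drop_factor_le)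
  have phi_eq: "phi (map (\<lambda>i. X (t i) w) [0..<Suc N]) = (\<Prod>i<N. drop_factor (z i) (X (t i) w) (X (t (Suc i)) w))" for w
    unfolding phi_def by (intro prod.cong) (auto simp del: upt_Suc)
  have step: "\<bar>expectation (\<lambda>w. (\<Prod>i<N. drop_factor (z i) (X (t i) w) (X (t (Suc i)) w)) * F (X (t N) w) (X (t (Suc N)) w)) -
      expectation (\<lambda>w. (\<Prod>i<N. drop_factor (z i) (X (t i) w) (X (t (Suc i)) w)) * g (X (t N) w))\<bar> \<le> step_error * h\<^sup>2"
    using expectation_step[where N=N and t=t and phi=phi and F=F] Suc.prems(1) phi F
    unfolding phi_eq by (simp add: g_def h_def)
  have "\<bar>expectation (\<lambda>w. (\<Prod>i<N. drop_factor (z i) (X (t i) w) (X (t (Suc i)) w)) * g (X (t N) w)) -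
      (\<Prod>i<N. 1 - (t (Suc i) - t i) * thinning (z i)) * equilibrium_mean g\<bar>
      \<le> (\<Sum>i<N. step_error * (t (Suc i) - t i)\<^sup>2)"
    using Suc.prems g by (intro Suc.IH) auto
  moreover have "equilibrium_mean g = (1 - h * thinning (z N)) * equilibrium_mean f"
  proof -
    let ?s = "\<lambda>x. \<Sum>e\<in>UNIV. rate e * (drop_factor (z N) x (nxt E x e) * f (nxt E x e))"
    have s: "\<bar>?s x\<bar> \<le> total_rate * 1" for x
      unfolding total_rate_def using F by (intro abs_sum_weighted_le less_imp_le[OF rate_pos]) (auto simp: F_def)
    have "integrable (measure_pmf equilibrium) ?s" "integrable (measure_pmf equilibrium) f"
      by (rule measure_pmf.integrable_const_bound; use s Suc.prems(3) in auto)+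
    then have "equilibrium_mean g =
        (1 - h * total_rate) * equilibrium_mean f + h * equilibrium_mean ?s"
      unfolding g_def step_mean_def[abs_def] F_def by simp
    also have "equilibrium_mean ?s = (total_rate - thinning (z N)) * equilibrium_mean f"
      unfolding thinning_def using Suc.prems(3) by (rule equilibrium_step)
    finally show ?thesis by (simp add: algebra_simps)
  qed
  ultimately show ?case
    using step by (simp add: F_def h_def[symmetric] mult_ac)
qed

end

section \<open>Departures as limits of grid counts\<close>

definition jump_path :: "(real \<Rightarrow> 'x) \<Rightarrow> bool" where
  "jump_path x \<longleftrightarrow>
     (\<forall>t. (\<forall>\<^sub>F v in at_right t. x v = x t) \<and> (\<exists>y. \<forall>\<^sub>F v in at_left t. x v = y))"

definition drops :: "(real \<Rightarrow> 'x) \<Rightarrow> ('x \<Rightarrow> nat) \<Rightarrow> real set" where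
  "drops x f = {u. \<exists>y. (\<forall>\<^sub>F v in at_left u. x v = y) \<and> f (x u) < f y}"

text \<open>Near any point the path has one value on the left and one from that point on; Bolzano's
  compactness argument glues these local descriptions. The intervals \<open>{u<..v}\<close> omit
  \<open>u\<close>, as by right continuity a jump at \<open>u\<close> already shows in
  \<open>x u\<close>.\<close>

lemma jump_path_finite:
  fixes x :: "real \<Rightarrow> 'x"
  assumes x: "jump_path x" and "a \<le> b"
  shows "\<exists>T. finite T \<and> (\<forall>u v. a \<le> u \<and> u \<le> v \<and> v \<le> b \<and> T \<inter> {u<..v} = {} \<longrightarrow> x u = x v)"
  using \<open>a \<le> b\<close>
proof (induction a b rule: Bolzano)
  case (trans a b c)
  then obtain T1 T2 where T: "finite T1" "finite T2"
    and T1: "\<And>u v. a \<le> u \<Longrightarrow> u \<le> v \<Longrightarrow> v \<le> b \<Longrightarrow> T1 \<inter> {u<..v} = {} \<Longrightarrow> x u = x v"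
    and T2: "\<And>u v. b \<le> u \<Longrightarrow> u \<le> v \<Longrightarrow> v \<le> c \<Longrightarrow> T2 \<inter> {u<..v} = {} \<Longrightarrow> x u = x v"
    by metis
  have "x u = x v" if uv: "a \<le> u" "u \<le> v" "v \<le> c" "(T1 \<union> T2) \<inter> {u<..v} = {}" for u v
  proof -
    consider "v \<le> b" | "b \<le> u" | "u \<le> b" "b \<le> v" by linarith
    then show ?thesis
    proof cases
      case 1
      then show ?thesis using uv by (intro T1) auto
    next
      case 2
      then show ?thesis using uv by (intro T2) auto
    next
      case 3
      have "x u = x b" using uv 3 by (intro T1) auto
      also have "x b = x v" using uv 3 by (intro T2) auto
      finally show ?thesis .
    qed
  qed
  then show ?case using T by (intro exI[of _ "T1 \<union> T2"]) auto
next
  case (local t)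
  obtain y where "\<forall>\<^sub>F v in at_left t. x v = y" "\<forall>\<^sub>F v in at_right t. x v = x t"
    using x unfolding jump_path_def by blast
  then obtain l r where l: "l < t" "\<And>v. l < v \<Longrightarrow> v < t \<Longrightarrow> x v = y"
    and r: "t < r" "\<And>v. t < v \<Longrightarrow> v < r \<Longrightarrow> x v = x t"
    unfolding eventually_at_left_field eventually_at_right_field by auto
  define d where "d = min (t - l) (r - t)"
  have "x u = x v" if "a' \<le> t" "t \<le> b'" "b' - a' < d"
    "a' \<le> u" "u \<le> v" "v \<le> b'" "{t} \<inter> {u<..v} = {}" for a' b' u v
  proof (cases "v < t")
    case True
    have "x u = y" "x v = y" using that True by (auto intro!: l(2) simp: d_def)
    then show ?thesis by simp
  next
    case False
    have near: "x w = x t" if "t \<le> w" "w < r" for w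
      using that r(2)[of w] by (cases "w = t") auto
    have "t \<le> u" using that False by auto
    then have "x u = x t" "x v = x t" using that by (auto intro!: near simp: d_def)
    then show ?thesis by simp
  qed
  note near_t = this
  have "\<exists>T. finite T \<and> (\<forall>u v. a' \<le> u \<and> u \<le> v \<and> v \<le> b' \<and> T \<inter> {u<..v} = {} \<longrightarrow> x u = x v)"
    if "a' \<le> t \<and> t \<le> b' \<and> b' - a' < d" for a' b'
    using near_t[of a' b'] that by (intro exI[of _ "{t}"]) simp
  moreover have "0 < d" using l(1) r(1) by (simp add: d_def)
  ultimately show ?case by (intro exI[of _ d] conjI allI impI)
qed

lemma drops_iff:
  assumes "u < t" and "\<And>v. u \<le> v \<Longrightarrow> v < t \<Longrightarrow> x v = x u"
  shows "t \<in> drops x f \<longleftrightarrow> f (x t) < f (x u)"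
proof -
  have ev: "\<forall>\<^sub>F v in at_left t. x v = x u"
    unfolding eventually_at_left_field using assms(1) by (intro exI[of _ u]) (auto intro: assms(2))
  have "y = x u" if "\<forall>\<^sub>F v in at_left t. x v = y" for y
  proof -
    have "\<forall>\<^sub>F v in at_left t. y = x u" using that ev by eventually_elim simp
    then show ?thesis by simp
  qed
  note unique = this
  show ?thesis
  proof
    assume "t \<in> drops x f"
    then obtain y where "\<forall>\<^sub>F v in at_left t. x v = y" "f (x t) < f y"
      unfolding drops_def by auto
    then show "f (x t) < f (x u)" using unique[of y] by simp
  next
    assume "f (x t) < f (x u)"
    then show "t \<in> drops x f" unfolding drops_def mem_Collect_eq using ev by (intro exI[of _ "x u"] conjI)
  qed
qed

lemma drops_subset_jumps:
  assumes T: "finite T" "\<And>u v. a \<le> u \<Longrightarrow> u \<le> v \<Longrightarrow> v \<le> b \<Longrightarrow> T \<inter> {u<..v} = {} \<Longrightarrow> x u = x v"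
  shows "drops x f \<inter> {a<..b} \<subseteq> T"
proof
  fix t assume t: "t \<in> drops x f \<inter> {a<..b}"
  show "t \<in> T"
  proof (rule ccontr)
    assume "t \<notin> T"
    \<comment> \<open>The last possible jump before \<open>t\<close>, or \<open>a\<close>. If
      \<open>t\<close> is not in \<open>T\<close>, the path is constant from \<open>u\<close>
      through \<open>t\<close> and nothing drops at \<open>t\<close>.\<close>
    define u where "u = Max (insert a (T \<inter> {..<t}))"
    have u: "a \<le> u" "u < t" "\<And>p. p \<in> T \<Longrightarrow> p < t \<Longrightarrow> p \<le> u"
      using T(1) t unfolding u_def by auto
    have empty: "T \<inter> {u<..t} = {}"
    proof (rule equals0I)
      fix p assume "p \<in> T \<inter> {u<..t}"
      moreover from this have "p \<noteq> t" using \<open>t \<notin> T\<close> by blast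
      ultimately show False using u(3)[of p] by simp
    qed
    have "x v = x u" if "u \<le> v" "v \<le> t" for v
    proof -
      have "{u<..v} \<subseteq> {u<..t}" using that by auto
      then have "T \<inter> {u<..v} = {}" using empty by blast
      then show ?thesis using T(2)[of u v] that u t by auto
    qed
    note const = this
    have "t \<in> drops x f \<longleftrightarrow> f (x t) < f (x u)"
    proof (rule drops_iff)
      show "x v = x u" if "u \<le> v" "v < t" for v using const[of v] that by simp
    qed (rule u(2))
    then show False using const[of t] u(2) t by simp
  qed
qed

lemma finite_drops:
  assumes "jump_path x"
  shows "finite (drops x f \<inter> {a<..b})"
proof (cases "a \<le> b")
  case True
  obtain T where "finite T" "\<And>u v. a \<le> u \<Longrightarrow> u \<le> v \<Longrightarrow> v \<le> b \<Longrightarrow> T \<inter> {u<..v} = {} \<Longrightarrow> x u = x v"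
    using jump_path_finite[OF assms True] by metis
  note T = this
  have "drops x f \<inter> {a<..b} \<subseteq> T" using T by (rule drops_subset_jumps)
  then show ?thesis using T(1) by (rule finite_subset)
qed auto

text \<open>Once the mesh is below the least distance between points of \<open>T\<close>, a cell
  contains at most one of them, and comparing the end points of the cell decides whether
  \<open>f\<close> drops there.\<close>

lemma card_drops_grid:
  assumes x: "jump_path x" and "a < b"
  shows "\<forall>\<^sub>F m in sequentially. card (drops x f \<inter> {a<..b}) =
     (\<Sum>i<m. if f (x (a + (b - a) * real (Suc i) / real m)) < f (x (a + (b - a) * real i / real m)) then 1 else 0)"
proof -
  obtain T where T: "finite T" "\<And>u v. a \<le> u \<Longrightarrow> u \<le> v \<Longrightarrow> v \<le> b \<Longrightarrow> T \<inter> {u<..v} = {} \<Longrightarrow> x u = x v"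
    using jump_path_finite[OF x, of a b] \<open>a < b\<close> by auto
  \<comment> \<open>The 1 keeps the minimum defined and positive when \<open>T\<close> has fewer
    than two points.\<close>
  define d where "d = Min (insert 1 ((\<lambda>(p, q). \<bar>p - q\<bar>) ` {(p, q). p \<in> T \<and> q \<in> T \<and> p \<noteq> q}))"
  have fin: "finite ((\<lambda>(p, q). \<bar>p - q\<bar>) ` {(p, q). p \<in> T \<and> q \<in> T \<and> p \<noteq> q})"
    by (rule finite_imageI, rule finite_subset[of _ "T \<times> T"]) (use T in auto)
  have d: "0 < d" "\<And>p q. p \<in> T \<Longrightarrow> q \<in> T \<Longrightarrow> p \<noteq> q \<Longrightarrow> d \<le> \<bar>p - q\<bar>"
    unfolding d_def using fin by (auto intro!: Min_le simp: image_iff)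
  have "(\<lambda>m. (b - a) / real m) \<longlonglongrightarrow> 0" by (rule lim_const_over_n)
  then have "\<forall>\<^sub>F m in sequentially. (b - a) / real m < d"
    using d(1) by (auto dest: order_tendstoD)
  then show ?thesis using eventually_gt_at_top[of 0]
  proof eventually_elim
    case (elim m)
    define g where "g i = a + (b - a) * real i / real m" for i
    have g0: "g 0 = a" and gm: "g m = b" using elim by (auto simp: g_def)
    have g_step: "g (Suc i) = g i + (b - a) / real m" for i
      by (simp add: g_def ring_distribs add_divide_distrib diff_divide_distrib)
    have g_less: "g i < g (Suc i)" for i using \<open>a < b\<close> elim by (simp add: g_step)
    have g_mono: "i \<le> j \<Longrightarrow> g i \<le> g j" for i j by (rule lift_Suc_mono_le[of g, OF less_imp_le[OF g_less]])
    have sub: "card (drops x f \<inter> {g 0<..g k}) = (\<Sum>i<k. card (drops x f \<inter> {g i<..g (Suc i)}))" if "k \<le> m" for k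
      using that
    proof (induction k)
      case (Suc k)
      have "drops x f \<inter> {g 0<..g (Suc k)} = (drops x f \<inter> {g 0<..g k}) \<union> (drops x f \<inter> {g k<..g (Suc k)})"
        using g_less[of k] g_mono[of 0 k] by auto
      then show ?case using Suc by (simp add: card_Un_disjoint finite_drops[OF x] disjoint_iff)
    qed simp
    have step: "card (drops x f \<inter> {g i<..g (Suc i)}) = (if f (x (g (Suc i))) < f (x (g i)) then 1 else 0)" if "i < m" for i
    proof -
      have gi: "a \<le> g i" "g (Suc i) \<le> b" using g_mono[of 0 i] g_mono[of "Suc i" m] that g0 gm by auto
      have sub': "drops x f \<inter> {g i<..g (Suc i)} \<subseteq> T"
      proof -
        have "{g i<..g (Suc i)} \<subseteq> {a<..b}" using gi by auto
        moreover have "drops x f \<inter> {a<..b} \<subseteq> T" using T by (rule drops_subset_jumps)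
        ultimately show ?thesis by blast
      qed
      show ?thesis
      proof (cases "T \<inter> {g i<..g (Suc i)} = {}")
        case True
        then have "x (g i) = x (g (Suc i))" using T(2)[of "g i" "g (Suc i)"] gi g_less[of i] by auto
        moreover have "drops x f \<inter> {g i<..g (Suc i)} = {}" using True sub' by blast
        ultimately show ?thesis by simp
      next
        case False
        then obtain t where t: "t \<in> T" "g i < t" "t \<le> g (Suc i)" by auto
        have only: "p = t" if "p \<in> T" "g i < p" "p \<le> g (Suc i)" for p
        proof (rule ccontr)
          assume "p \<noteq> t"
          then have "d \<le> \<bar>p - t\<bar>" using d(2)[of p t] that t by blast
          then show False using that t elim(1) g_step[of i] by linarith
        qed
        have left: "x v = x (g i)" if "g i \<le> v" "v < t" for v
        proof -
          have "T \<inter> {g i<..v} = {}" using only that t(3) by force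
          then show ?thesis using T(2)[of "g i" v] that gi t by simp
        qed
        have right: "x t = x (g (Suc i))"
        proof -
          have "T \<inter> {t<..g (Suc i)} = {}" using only t(2) by force
          then show ?thesis using T(2)[of t "g (Suc i)"] gi t by simp
        qed
        have "t \<in> drops x f \<longleftrightarrow> f (x (g (Suc i))) < f (x (g i))"
          unfolding right[symmetric] using t(2) left by (intro drops_iff)
        moreover have "drops x f \<inter> {g i<..g (Suc i)} = drops x f \<inter> {t}"
        proof (intro equalityI subsetI)
          fix p assume p: "p \<in> drops x f \<inter> {g i<..g (Suc i)}"
          then show "p \<in> drops x f \<inter> {t}" using subsetD[OF sub' p] only[of p] by simp
        qed (use t in simp)
        ultimately have "drops x f \<inter> {g i<..g (Suc i)} = (if f (x (g (Suc i))) < f (x (g i)) then {t} else {})"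
          by (auto split: if_splits)
        then show ?thesis by simp
      qed
    qed
    have "card (drops x f \<inter> {a<..b}) = (\<Sum>i<m. if f (x (g (Suc i))) < f (x (g i)) then 1 else 0)"
      using sub[of m] step g0 gm by simp
    then show ?case by (simp add: g_def)
  qed
qed

text \<open>Cell \<open>k\<close> of interval \<open>j\<close> gets the number
  \<open>j * m + k\<close>: \<open>n\<close> adjacent intervals with \<open>m\<close> cells each are
  read as one grid, to which \<open>expectation_grid\<close> applies.\<close>

lemma prod_mult_lessThan:
  fixes g :: "nat \<Rightarrow> 'a::comm_monoid_mult"
  shows "(\<Prod>i<n * m. g i) = (\<Prod>j<n. \<Prod>k<m. g (j * m + k))"
proof -
  have "(\<Prod>k<m. g (j * m + k)) = prod g {j * m..<j * m + m}" for j
    by (simp add: prod.atLeastLessThan_shift_0[of g "j * m"] atLeast0LessThan)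
  then show ?thesis by (simp add: prod.nat_group)
qed

lemma sum_mult_lessThan:
  fixes g :: "nat \<Rightarrow> 'a::comm_monoid_add"
  shows "(\<Sum>i<n * m. g i) = (\<Sum>j<n. \<Sum>k<m. g (j * m + k))"
proof -
  have "(\<Sum>k<m. g (j * m + k)) = sum g {j * m..<j * m + m}" for j
    by (simp add: sum.atLeastLessThan_shift_0[of g "j * m"] atLeast0LessThan)
  then show ?thesis by (simp add: sum.nat_group)
qed

section \<open>Departure counts and their generating function\<close>

context stationary_fcfs
begin

lemma jump_path_X: "w \<in> space M \<Longrightarrow> jump_path (\<lambda>t. X t w)"
  using chain unfolding stationary_chain_def jump_paths_def jump_path_def by blast

lemma departures_eq: "departures X c w = drops (\<lambda>t. X t w) (\<lambda>x. count_list x c)"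
  by (simp add: departures_def drops_def)

abbreviation departed :: "'c \<Rightarrow> real \<Rightarrow> real \<Rightarrow> 'w \<Rightarrow> nat" where
  "departed c \<equiv> points_in (departures X c)"

lemma finite_departures: "w \<in> space M \<Longrightarrow> finite (departures X c w \<inter> {s<..t})"
  unfolding departures_eq by (intro finite_drops jump_path_X)

definition grid_step :: "real \<Rightarrow> real \<Rightarrow> nat \<Rightarrow> nat \<Rightarrow> real" where
  "grid_step s t m i = s + (t - s) * real i / real m"

lemma departed_grid:
  assumes "w \<in> space M" "s < t"
  shows "\<forall>\<^sub>F m in sequentially. departed c s t w =
    (\<Sum>i<m. if count_list (X (grid_step s t m (Suc i)) w) c < count_list (X (grid_step s t m i) w) c then 1 else 0)"
  using card_drops_grid[OF jump_path_X[OF assms(1)] assms(2), of "\<lambda>x. count_list x c"]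
  unfolding points_in_def departures_eq grid_step_def .

lemma departed_empty: "t \<le> s \<Longrightarrow> departed c s t w = 0"
  by (simp add: points_in_def)

text \<open>Departures are defined by left limits over a continuum of times. The grid counts depend
  on finitely many states, and path by path they are eventually equal to the number of
  departures.\<close>

lemma departed_measurable [measurable]: "departed c s t \<in> measurable M (count_space UNIV)"
proof (cases "s < t")
  case False
  then have "departed c s t = (\<lambda>_. 0)" by (intro ext departed_empty) simp
  then show ?thesis by simp
next
  case True
  define h where "h m w = (\<Sum>i<m. if count_list (X (grid_step s t m (Suc i)) w) c < count_list (X (grid_step s t m i) w) c then 1 else 0 :: real)" for m w
  have [measurable]: "Measurable.pred M (\<lambda>w. count_list (X u w) c < count_list (X v w) c)" for u v
  proof -
    have "(\<lambda>w. count_list (X u w) c) \<in> measurable M (count_space UNIV)" for u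
      using measurable_compose[OF X_measurable[of u], of "\<lambda>x. count_list x c" "count_space UNIV"] by simp
    note [measurable] = this[of u] this[of v]
    show ?thesis by measurable
  qed
  have [measurable]: "h m \<in> borel_measurable M" for m
    unfolding h_def by measurable
  have ev: "\<forall>\<^sub>F m in sequentially. real (departed c s t w) = h m w" if "w \<in> space M" for w
    using departed_grid[OF that True, of c] unfolding h_def
    by eventually_elim (simp add: of_nat_sum if_distrib[of real] cong: if_cong)
  have "(\<lambda>w. real (departed c s t w)) \<in> borel_measurable M"
  proof (rule borel_measurable_LIMSEQ_real)
    show "h m \<in> borel_measurable M" for m by measurable
    show "(\<lambda>m. h m w) \<longlonglongrightarrow> real (departed c s t w)" if "w \<in> space M" for w
      using ev[OF that] by (intro tendsto_eventually) (auto elim: eventually_mono)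
  qed
  then have [measurable]: "(\<lambda>w. real (departed c s t w)) \<in> borel_measurable M" .
  show ?thesis
  proof (subst measurable_count_space_eq2_countable, safe)
    fix k
    have "departed c s t -` {k} \<inter> space M = {w\<in>space M. real (departed c s t w) = real k}" by auto
    also have "\<dots> \<in> events" by measurable
    finally show "departed c s t -` {k} \<inter> space M \<in> events" .
  qed auto
qed

lemma departed_pgf:
  fixes t :: "nat \<Rightarrow> real"
  assumes t: "\<And>j. j < n \<Longrightarrow> t j < t (Suc j)"
    and z: "\<And>j c. \<bar>z j c\<bar> \<le> 1" and f: "\<And>x. \<bar>f x\<bar> \<le> 1"
  shows "expectation (\<lambda>w. (\<Prod>j<n. \<Prod>c\<in>UNIV. z j c ^ departed c (t j) (t (Suc j)) w) * f (X (t n) w)) =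
    (\<Prod>j<n. exp (- (t (Suc j) - t j) * thinning (z j))) * equilibrium_mean f"
proof -
  define g where "g j = grid_step (t j) (t (Suc j))" for j
  define D where "D j = t (Suc j) - t j" for j
  define Z where "Z m w = (\<Prod>j<n. \<Prod>k<m. drop_factor (z j) (X (g j m k) w) (X (g j m (Suc k)) w))" for m w
  define tau where "tau m i = g (i div m) m (i mod m)" for m i
  have g_m: "g j m m = t (Suc j)" if "0 < m" for j m using that by (simp add: g_def grid_step_def)
  have tau: "tau m (j * m + k) = g j m k" "tau m (Suc (j * m + k)) = g j m (Suc k)" if "k < m" for j k m
  proof -
    show "tau m (j * m + k) = g j m k" using that by (simp add: tau_def)
    \<comment> \<open>The right end of the last cell of an interval is computed by
      \<open>tau\<close> as the left end of the next interval, where the two grids agree.\<close>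
    show "tau m (Suc (j * m + k)) = g j m (Suc k)"
    proof (cases "Suc k = m")
      case True
      then have "Suc (j * m + k) = Suc j * m" by simp
      then have "tau m (Suc (j * m + k)) = g (Suc j) m 0"
        using that unfolding tau_def by (simp only:) simp
      also have "\<dots> = g j m (Suc k)" using that True g_m[of m j] by (simp add: g_def grid_step_def)
      finally show ?thesis .
    next
      case False
      then have "Suc k < m" using that by simp
      then have "tau m (j * m + Suc k) = g j m (Suc k)" by (simp add: tau_def del: add_Suc_right)
      then show ?thesis by simp
    qed
  qed
  have step: "g j m (Suc k) - g j m k = D j / real m" for j m k
    by (simp add: g_def grid_step_def D_def ring_distribs add_divide_distrib diff_divide_distrib)
  have index: "\<exists>j k. i = j * m + k \<and> j < n \<and> k < m" if "i < n * m" for i m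
    using that by (intro exI[of _ "i div m"] exI[of _ "i mod m"]) (auto simp: less_mult_imp_div_less intro!: mod_less_divisor gr0I)
  have drop_le: "\<bar>drop_factor (z j) x y\<bar> \<le> 1" for j x y using z by (rule abs_drop_factor_le)
  have Z_le: "\<bar>Z m w\<bar> \<le> 1" for m w
    unfolding Z_def abs_prod by (intro prod_le_1 conjI prod_nonneg) (auto intro: drop_le)
  have close: "\<forall>\<^sub>F m in sequentially. \<bar>expectation (\<lambda>w. Z m w * f (X (t n) w)) -
      (\<Prod>j<n. (1 + (- D j * thinning (z j)) / real m) ^ m) * equilibrium_mean f\<bar>
      \<le> (\<Sum>j<n. step_error * (D j)\<^sup>2) / real m"
  proof -
    \<comment> \<open>Provides the mesh condition of \<open>expectation_grid\<close> on all
      intervals at once.\<close>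
    have "\<forall>\<^sub>F m in sequentially. \<forall>j\<in>{..<n}. (D j * total_rate) / real m < 1"
      by (intro eventually_ball_finite ballI order_tendstoD(2)[OF lim_const_over_n]) auto
    then show ?thesis using eventually_gt_at_top[of 0]
    proof eventually_elim
      case (elim m)
      have tau_step: "tau m (Suc i) - tau m i = D j / real m" if "i = j * m + k" "k < m" for i j k
        using tau[OF that(2), of j] step[of j m k] that(1) by simp
      have "\<bar>expectation (\<lambda>w. (\<Prod>i<n * m. drop_factor (z (i div m)) (X (tau m i) w) (X (tau m (Suc i)) w)) * f (X (tau m (n * m)) w)) -
          (\<Prod>i<n * m. 1 - (tau m (Suc i) - tau m i) * thinning (z (i div m))) * equilibrium_mean f\<bar>
         \<le> (\<Sum>i<n * m. step_error * (tau m (Suc i) - tau m i)\<^sup>2)"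
      proof (rule expectation_grid)
        fix i assume "i < n * m"
        then obtain j k where i: "i = j * m + k" "j < n" "k < m" using index by blast
        show "tau m i < tau m (Suc i)"
        proof -
          have "0 < D j / real m" using t[OF i(2)] elim(2) by (simp add: D_def)
          then show ?thesis using tau_step[OF i(1,3)] by linarith
        qed
        show "(tau m (Suc i) - tau m i) * total_rate \<le> 1"
          using tau_step[OF i(1,3)] elim(1) i(2) by (auto intro: less_imp_le)
      qed (use z f in auto)
      moreover have "tau m (n * m) = t n" using elim(2) by (simp add: tau_def g_def grid_step_def)
      moreover have "(\<Prod>i<n * m. drop_factor (z (i div m)) (X (tau m i) w) (X (tau m (Suc i)) w)) = Z m w" for w
        unfolding Z_def prod_mult_lessThan by (intro prod.cong refl) (simp add: tau)
      moreover have "(\<Prod>i<n * m. 1 - (tau m (Suc i) - tau m i) * thinning (z (i div m))) =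
          (\<Prod>j<n. (1 + (- D j * thinning (z j)) / real m) ^ m)"
        unfolding prod_mult_lessThan by (intro prod.cong refl) (simp add: tau step)
      moreover have "(\<Sum>i<n * m. step_error * (tau m (Suc i) - tau m i)\<^sup>2) = (\<Sum>j<n. step_error * (D j)\<^sup>2) / real m"
        unfolding sum_mult_lessThan sum_divide_distrib using elim(2)
        by (intro sum.cong refl) (simp add: tau step power2_eq_square)
      ultimately show ?case by simp
    qed
  qed
  have Z_limit: "\<forall>\<^sub>F m in sequentially. Z m w = (\<Prod>j<n. \<Prod>c\<in>UNIV. z j c ^ departed c (t j) (t (Suc j)) w)"
    if "w \<in> space M" for w
  proof -
    have "\<forall>\<^sub>F m in sequentially. \<forall>j\<in>{..<n}. \<forall>c\<in>UNIV. departed c (t j) (t (Suc j)) w =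
        (\<Sum>i<m. if count_list (X (g j m (Suc i)) w) c < count_list (X (g j m i) w) c then 1 else 0)"
      unfolding g_def using that t by (intro eventually_ball_finite ballI departed_grid) auto
    then show ?thesis
    proof eventually_elim
      case (elim m)
      have "(\<Prod>k<m. drop_factor (z j) (X (g j m k) w) (X (g j m (Suc k)) w)) =
          (\<Prod>c\<in>UNIV. z j c ^ departed c (t j) (t (Suc j)) w)" if "j < n" for j
      proof -
        have dep: "departed c (t j) (t (Suc j)) w =
            (\<Sum>i<m. if count_list (X (g j m (Suc i)) w) c < count_list (X (g j m i) w) c then 1 else 0)" for c
          using elim that by blast
        show ?thesis
          unfolding dep drop_factor_def power_sum
          by (subst prod.swap) (intro prod.cong refl, auto)
      qed
      then show ?case unfolding Z_def by (intro prod.cong) auto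
    qed
  qed
  have "(\<lambda>m. expectation (\<lambda>w. Z m w * f (X (t n) w))) \<longlonglongrightarrow>
      expectation (\<lambda>w. (\<Prod>j<n. \<Prod>c\<in>UNIV. z j c ^ departed c (t j) (t (Suc j)) w) * f (X (t n) w))"
  proof (rule integral_dominated_convergence[where w="\<lambda>_. 1"])
    have Xm: "(\<lambda>w. drop_factor y (X u w) (X v w)) \<in> borel_measurable M" for y u v
      by measurable
    show "(\<lambda>w. Z m w * f (X (t n) w)) \<in> borel_measurable M" for m
      unfolding Z_def by (intro borel_measurable_times borel_measurable_prod Xm) measurable
    show "(\<lambda>w. (\<Prod>j<n. \<Prod>c\<in>UNIV. z j c ^ departed c (t j) (t (Suc j)) w) * f (X (t n) w)) \<in> borel_measurable M"
      by measurable
    show "AE w in M. (\<lambda>m. Z m w * f (X (t n) w)) \<longlonglongrightarrow>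
        (\<Prod>j<n. \<Prod>c\<in>UNIV. z j c ^ departed c (t j) (t (Suc j)) w) * f (X (t n) w)"
      by (intro AE_I2 tendsto_mult tendsto_const tendsto_eventually Z_limit)
    show "AE w in M. norm (Z m w * f (X (t n) w)) \<le> 1" for m
      using Z_le f by (auto simp: abs_mult intro!: AE_I2 mult_le_one)
  qed simp
  moreover have "(\<lambda>m. (\<Prod>j<n. (1 + (- D j * thinning (z j)) / real m) ^ m) * equilibrium_mean f) \<longlonglongrightarrow>
      (\<Prod>j<n. exp (- D j * thinning (z j))) * equilibrium_mean f"
    by (intro tendsto_mult tendsto_prod tendsto_const tendsto_exp_limit_sequentially)
  ultimately have "(\<lambda>m. expectation (\<lambda>w. Z m w * f (X (t n) w)) -
      (\<Prod>j<n. (1 + (- D j * thinning (z j)) / real m) ^ m) * equilibrium_mean f) \<longlonglongrightarrow>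
      expectation (\<lambda>w. (\<Prod>j<n. \<Prod>c\<in>UNIV. z j c ^ departed c (t j) (t (Suc j)) w) * f (X (t n) w)) -
      (\<Prod>j<n. exp (- D j * thinning (z j))) * equilibrium_mean f"
    by (rule tendsto_diff)
  moreover have "(\<lambda>m. expectation (\<lambda>w. Z m w * f (X (t n) w)) -
      (\<Prod>j<n. (1 + (- D j * thinning (z j)) / real m) ^ m) * equilibrium_mean f) \<longlonglongrightarrow> 0"
  proof (rule tendsto_0_le[OF lim_const_over_n[of "\<Sum>j<n. step_error * (D j)\<^sup>2"], where K=1])
    show "\<forall>\<^sub>F m in sequentially. norm (expectation (\<lambda>w. Z m w * f (X (t n) w)) -
        (\<Prod>j<n. (1 + (- D j * thinning (z j)) / real m) ^ m) * equilibrium_mean f) \<le>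
        norm ((\<Sum>j<n. step_error * (D j)\<^sup>2) / real m) * 1"
      using close unfolding real_norm_def mult_1_right by eventually_elim (erule order_trans[OF _ abs_ge_self])
  qed
  ultimately show ?thesis
    using LIMSEQ_unique unfolding D_def by fastforce
qed

end

section \<open>The joint law of departures and state\<close>

text \<open>The first coefficient not yet known to vanish is the limit, at 0 from the right, of the
  series divided by \<open>x ^ n\<close>. The hypothesis at \<open>x = 1\<close> supplies the
  summability.\<close>

lemma powser_coeff_zero:
  fixes a :: "nat \<Rightarrow> real"
  assumes "\<And>x. 0 < x \<Longrightarrow> x \<le> 1 \<Longrightarrow> (\<lambda>n. a n * x ^ n) sums 0"
  shows "a n = 0"
proof (induction n rule: less_induct)
  case (less n)
  have summ: "summable (\<lambda>k. a (k + n))"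
    using assms[of 1] by (auto simp: sums_iff intro: summable_ignore_initial_segment)
  define f where "f x = (\<Sum>k. a (k + n) * x ^ k)" for x
  have f0: "f x = 0" if "0 < x" "x \<le> 1" for x
  proof -
    have "(\<lambda>k. a (k + n) * x ^ (k + n)) sums (0 - (\<Sum>i<n. a i * x ^ i))"
      using assms[OF that] by (rule sums_split_initial_segment)
    then have "(\<lambda>k. x ^ n * (a (k + n) * x ^ k)) sums 0"
      using less by (simp add: power_add mult_ac)
    moreover have "x ^ n \<noteq> 0" using that by simp
    ultimately have "(\<lambda>k. a (k + n) * x ^ k) sums 0"
      using sums_mult_iff[of "x ^ n" "\<lambda>k. a (k + n) * x ^ k" 0] by simp
    then show ?thesis by (simp add: f_def sums_iff)
  qed
  have "(f \<longlongrightarrow> a (0 + n)) (at 0)"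
  proof (rule powser_limit_0)
    show "(\<lambda>k. a (k + n) * x ^ k) sums f x" if "norm x < 1" for x
      unfolding f_def using powser_inside[of "\<lambda>k. a (k + n)" 1 x] summ that by (intro summable_sums) simp
  qed simp
  then have "(f \<longlongrightarrow> a n) (at_right 0)"
    by (simp add: filterlim_at_split)
  moreover have "(f \<longlongrightarrow> 0) (at_right 0)"
    using f0 by (intro tendsto_eventually) (auto simp: eventually_at_right_field intro!: exI[of _ 1])
  ultimately show ?case by (intro tendsto_unique[OF trivial_limit_at_right_real])
qed

context prob_space
begin

lemma expectation_power_sums:
  fixes N :: "'a \<Rightarrow> nat" and G :: "'a \<Rightarrow> real"
  assumes N[measurable]: "N \<in> measurable M (count_space UNIV)" and G: "integrable M G" and "\<bar>x\<bar> \<le> 1"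
  shows "(\<lambda>n. expectation (\<lambda>w. G w * indicator {n} (N w)) * x ^ n) sums expectation (\<lambda>w. G w * x ^ N w)"
proof -
  have [measurable]: "G \<in> borel_measurable M" using G by simp
  have x_le: "\<bar>x ^ n\<bar> \<le> 1" for n using assms(3) by (simp add: power_abs power_le_one)
  have int: "integrable M (\<lambda>w. G w * indicator {n} (N w))" for n
  proof (rule Bochner_Integration.integrable_bound[OF G])
    have [measurable]: "(\<lambda>w. indicator {n} (N w) :: real) \<in> borel_measurable M"
      by (rule measurable_compose[OF N]) simp
    show "(\<lambda>w. G w * indicator {n} (N w)) \<in> borel_measurable M" by measurable
  qed (auto split: split_indicator)
  have part: "(\<Sum>n<k. expectation (\<lambda>w. G w * indicator {n} (N w)) * x ^ n) =
      expectation (\<lambda>w. if N w < k then G w * x ^ N w else 0)" for k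
  proof -
    have "(\<Sum>n<k. expectation (\<lambda>w. G w * indicator {n} (N w)) * x ^ n) =
        expectation (\<lambda>w. \<Sum>n<k. G w * indicator {n} (N w) * x ^ n)"
      using int by (subst Bochner_Integration.integral_sum) auto
    also have "(\<lambda>w. \<Sum>n<k. G w * indicator {n} (N w) * x ^ n) = (\<lambda>w. if N w < k then G w * x ^ N w else 0)"
    proof
      fix w
      have "(\<Sum>n<k. G w * indicator {n} (N w) * x ^ n) = (\<Sum>n<k. if n = N w then G w * x ^ N w else 0)"
        by (intro sum.cong) auto
      then show "(\<Sum>n<k. G w * indicator {n} (N w) * x ^ n) = (if N w < k then G w * x ^ N w else 0)" by simp
    qed
    finally show ?thesis .
  qed
  have "(\<lambda>k. expectation (\<lambda>w. if N w < k then G w * x ^ N w else 0)) \<longlonglongrightarrow> expectation (\<lambda>w. G w * x ^ N w)"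
  proof (rule integral_dominated_convergence[where w="\<lambda>w. \<bar>G w\<bar>"])
    show "AE w in M. (\<lambda>k. if N w < k then G w * x ^ N w else 0) \<longlonglongrightarrow> G w * x ^ N w"
    proof (rule AE_I2)
      fix w
      have "\<forall>\<^sub>F k in sequentially. (if N w < k then G w * x ^ N w else 0) = G w * x ^ N w"
        using eventually_gt_at_top[of "N w"] by eventually_elim simp
      then show "(\<lambda>k. if N w < k then G w * x ^ N w else 0) \<longlonglongrightarrow> G w * x ^ N w"
        by (rule tendsto_eventually)
    qed
    show "AE w in M. norm (if N w < k then G w * x ^ N w else 0) \<le> \<bar>G w\<bar>" for k
      using x_le by (auto simp: abs_mult mult_left_le)
  qed (use G in auto)
  then show ?thesis unfolding sums_def part .
qed

text \<open>Coefficients are extracted one variable at a time: an indicator already obtained is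
  absorbed into \<open>W\<close> and its coefficient into \<open>kappa\<close>, hence the general
  \<open>W\<close> and \<open>kappa\<close>.\<close>

lemma expectation_prod_by_pgf:
  fixes N :: "'j \<Rightarrow> 'a \<Rightarrow> nat" and W :: "'a \<Rightarrow> real" and q :: "'j \<Rightarrow> nat \<Rightarrow> real"
  assumes "finite J"
    and N: "\<And>j. j \<in> J \<Longrightarrow> N j \<in> measurable M (count_space UNIV)"
    and W: "integrable M W"
    and q: "\<And>j x. j \<in> J \<Longrightarrow> \<bar>x\<bar> \<le> 1 \<Longrightarrow> (\<lambda>n. q j n * x ^ n) sums Q j x"
    and pgf: "\<And>z. (\<And>j. \<bar>z j\<bar> \<le> 1) \<Longrightarrow>
      expectation (\<lambda>w. W w * (\<Prod>j\<in>J. z j ^ N j w)) = kappa * (\<Prod>j\<in>J. Q j (z j))"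
  shows "expectation (\<lambda>w. W w * (\<Prod>j\<in>J. indicator {a j} (N j w))) = kappa * (\<Prod>j\<in>J. q j (a j))"
  using assms
proof (induction J arbitrary: W kappa rule: finite_induct)
  case empty
  then show ?case using empty(4)[of "\<lambda>_. 0"] by simp
next
  case (insert i J)
  note N_meas = insert.prems(1)
  have Ni[measurable]: "N i \<in> measurable M (count_space UNIV)" using N_meas by simp
  have Wm[measurable]: "W \<in> borel_measurable M" using insert.prems(2) by simp
  have "expectation (\<lambda>w. (W w * indicator {a i} (N i w)) * (\<Prod>j\<in>J. indicator {a j} (N j w))) =
      (kappa * q i (a i)) * (\<Prod>j\<in>J. q j (a j))"
  proof (rule insert.IH)
    show "integrable M (\<lambda>w. W w * indicator {a i} (N i w))"
    proof (rule Bochner_Integration.integrable_bound[OF insert.prems(2)])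
      have [measurable]: "(\<lambda>w. indicator {a i} (N i w) :: real) \<in> borel_measurable M"
        by (rule measurable_compose[OF Ni]) simp
      show "(\<lambda>w. W w * indicator {a i} (N i w)) \<in> borel_measurable M" by measurable
    qed (auto split: split_indicator)
  next
    fix z :: "'j \<Rightarrow> real" assume z: "\<And>j. \<bar>z j\<bar> \<le> 1"
    define G where "G w = W w * (\<Prod>j\<in>J. z j ^ N j w)" for w
    have prod_le: "\<bar>\<Prod>j\<in>J. z j ^ N j w\<bar> \<le> 1" for w
      unfolding abs_prod using z by (intro prod_le_1) (auto simp: power_abs power_le_one)
    have [measurable]: "(\<lambda>w. \<Prod>j\<in>J. z j ^ N j w) \<in> borel_measurable M"
    proof (rule borel_measurable_prod)
      fix j assume "j \<in> J"
      then have [measurable]: "N j \<in> measurable M (count_space UNIV)" using N_meas by simp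
      show "(\<lambda>w. z j ^ N j w) \<in> borel_measurable M" by measurable
    qed
    have G: "integrable M G"
      unfolding G_def using prod_le
      by (intro Bochner_Integration.integrable_bound[OF insert.prems(2)]) (auto simp: abs_mult mult_left_le)
    let ?e = "\<lambda>n. expectation (\<lambda>w. G w * indicator {n} (N i w))"
    let ?R = "kappa * (\<Prod>j\<in>J. Q j (z j))"
    \<comment> \<open>With the variables in \<open>J\<close> fixed, both sides of the hypothesis are
      power series in the variable of \<open>i\<close> alone.\<close>
    have "?e n - ?R * q i n = 0" for n
    proof (rule powser_coeff_zero)
      fix x :: real assume x: "0 < x" "x \<le> 1"
      then have "\<bar>x\<bar> \<le> 1" by simp
      have "(\<lambda>n. ?e n * x ^ n) sums expectation (\<lambda>w. G w * x ^ N i w)"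
        by (rule expectation_power_sums[OF Ni G \<open>\<bar>x\<bar> \<le> 1\<close>])
      moreover have "(\<lambda>n. ?R * (q i n * x ^ n)) sums (?R * Q i x)"
        using insert.prems(3) \<open>\<bar>x\<bar> \<le> 1\<close> by (intro sums_mult) auto
      moreover have "expectation (\<lambda>w. G w * x ^ N i w) = ?R * Q i x"
      proof -
        have "expectation (\<lambda>w. W w * (\<Prod>j\<in>insert i J. (z(i := x)) j ^ N j w)) =
            kappa * (\<Prod>j\<in>insert i J. Q j ((z(i := x)) j))"
          using z \<open>\<bar>x\<bar> \<le> 1\<close> by (intro insert.prems(4)) auto
        moreover have "(\<Prod>j\<in>J. (z(i := x)) j ^ N j w) = (\<Prod>j\<in>J. z j ^ N j w)" for w
          using insert.hyps by (intro prod.cong) auto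
        moreover have "(\<Prod>j\<in>J. Q j ((z(i := x)) j)) = (\<Prod>j\<in>J. Q j (z j))"
          using insert.hyps by (intro prod.cong) auto
        ultimately show ?thesis using insert.hyps by (simp add: G_def mult_ac)
      qed
      ultimately show "(\<lambda>n. (?e n - ?R * q i n) * x ^ n) sums 0"
        using sums_diff by (fastforce simp: left_diff_distrib mult.assoc)
    qed
    then have "?e (a i) = ?R * q i (a i)" by simp
    then show "expectation (\<lambda>w. W w * indicator {a i} (N i w) * (\<Prod>j\<in>J. z j ^ N j w)) =
        kappa * q i (a i) * (\<Prod>j\<in>J. Q j (z j))"
      by (simp add: G_def mult_ac)
  qed (use insert.prems in auto)
  then show ?case using insert.hyps by (simp add: mult.assoc)
qed

end

lemma poisson_pgf: "0 < r \<Longrightarrow> (\<lambda>n. pmf (poisson_pmf r) n * x ^ n) sums exp (- r * (1 - x))"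
proof -
  assume "0 < r"
  have "(\<lambda>n. exp (- r) * ((r * x) ^ n /\<^sub>R fact n)) sums (exp (- r) * exp (r * x))"
    by (intro sums_mult exp_converges)
  moreover have "exp (- r) * exp (r * x) = exp (- r * (1 - x))"
    by (simp add: exp_add[symmetric] algebra_simps)
  ultimately show ?thesis
    using \<open>0 < r\<close> by (simp add: power_mult_distrib divide_inverse mult_ac)
qed

context stationary_fcfs
begin

text \<open>\<open>J\<close> selects the constrained pairs of an interval and a type. Setting all
  other variables to 1 removes them from the generating function, so joint laws and marginals are
  instances of one formula.\<close>

lemma departed_law:
  fixes t :: "nat \<Rightarrow> real"
  assumes t: "\<And>j. j < n \<Longrightarrow> t j < t (Suc j)" and J: "J \<subseteq> {..<n} \<times> UNIV"
  shows "prob {w\<in>space M. X (t n) w \<in> B \<and> (\<forall>p\<in>J. departed (snd p) (t (fst p)) (t (Suc (fst p))) w = a p)} =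
    measure_pmf.prob equilibrium B * (\<Prod>p\<in>J. pmf (poisson_pmf (lam (snd p) * (t (Suc (fst p)) - t (fst p)))) (a p))"
proof -
  have "finite J" using J by (rule finite_subset) simp
  define N where "N p = departed (snd p) (t (fst p)) (t (Suc (fst p)))" for p :: "nat \<times> 'c"
  define r where "r p = lam (snd p) * (t (Suc (fst p)) - t (fst p))" for p :: "nat \<times> 'c"
  have r: "0 < r p" if "p \<in> J" for p
    using that J t[of "fst p"] lam_pos[of "snd p"] by (auto simp: r_def)
  have [measurable]: "N p \<in> measurable M (count_space UNIV)" for p unfolding N_def by measurable
  let ?W = "\<lambda>w. indicator B (X (t n) w) :: real"
  have "expectation (\<lambda>w. ?W w * (\<Prod>p\<in>J. indicator {a p} (N p w))) =
      measure_pmf.prob equilibrium B * (\<Prod>p\<in>J. pmf (poisson_pmf (r p)) (a p))"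
  proof (rule expectation_prod_by_pgf[where Q="\<lambda>p x. exp (- r p * (1 - x))", OF \<open>finite J\<close>])
    show "(\<lambda>k. pmf (poisson_pmf (r p)) k * x ^ k) sums exp (- r p * (1 - x))" if "p \<in> J" for p x
      by (rule poisson_pgf[OF r[OF that]])
    show "integrable M ?W"
      by (rule integrable_const_bound[where B=1]) auto
  next
    fix z :: "nat \<times> 'c \<Rightarrow> real" assume z: "\<And>p. \<bar>z p\<bar> \<le> 1"
    define zJ where "zJ j c = (if (j, c) \<in> J then z (j, c) else 1)" for j c
    have double: "(\<Prod>j<n. \<Prod>c\<in>UNIV. h (j, c)) = (\<Prod>p\<in>J. h p)"
      if "\<And>p. p \<in> {..<n} \<times> UNIV \<Longrightarrow> p \<notin> J \<Longrightarrow> h p = 1" for h :: "nat \<times> 'c \<Rightarrow> real"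
    proof -
      have "(\<Prod>j<n. \<Prod>c\<in>UNIV. h (j, c)) = (\<Prod>p\<in>{..<n} \<times> UNIV. h p)"
        by (simp add: prod.cartesian_product)
      also have "\<dots> = (\<Prod>p\<in>J. h p)"
        using J that by (intro prod.mono_neutral_right) auto
      finally show ?thesis .
    qed
    have "expectation (\<lambda>w. (\<Prod>j<n. \<Prod>c\<in>UNIV. zJ j c ^ departed c (t j) (t (Suc j)) w) * indicator B (X (t n) w)) =
        (\<Prod>j<n. exp (- (t (Suc j) - t j) * thinning (zJ j))) * equilibrium_mean (indicator B)"
      using t z by (intro departed_pgf) (auto simp: zJ_def split: split_indicator)
    moreover have "(\<Prod>j<n. \<Prod>c\<in>UNIV. zJ j c ^ departed c (t j) (t (Suc j)) w) = (\<Prod>p\<in>J. z p ^ N p w)" for w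
    proof -
      have "(\<Prod>j<n. \<Prod>c\<in>UNIV. (\<lambda>p. zJ (fst p) (snd p) ^ N p w) (j, c)) = (\<Prod>p\<in>J. zJ (fst p) (snd p) ^ N p w)"
        by (rule double) (auto simp: zJ_def)
      also have "\<dots> = (\<Prod>p\<in>J. z p ^ N p w)" by (intro prod.cong) (auto simp: zJ_def)
      finally show ?thesis by (simp add: N_def)
    qed
    moreover have "(\<Prod>j<n. exp (- (t (Suc j) - t j) * thinning (zJ j))) = (\<Prod>p\<in>J. exp (- r p * (1 - z p)))"
    proof -
      have "exp (- (t (Suc j) - t j) * thinning (zJ j)) = (\<Prod>c\<in>UNIV. exp (- r (j, c) * (1 - zJ j c)))" for j
      proof -
        have "- (t (Suc j) - t j) * thinning (zJ j) = (\<Sum>c\<in>UNIV. - r (j, c) * (1 - zJ j c))"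
          unfolding thinning_def sum_distrib_left r_def by (intro sum.cong refl) (simp add: algebra_simps)
        then show ?thesis by (simp add: exp_sum)
      qed
      moreover have "(\<Prod>j<n. \<Prod>c\<in>UNIV. (\<lambda>p. exp (- r p * (1 - zJ (fst p) (snd p)))) (j, c)) =
          (\<Prod>p\<in>J. exp (- r p * (1 - zJ (fst p) (snd p))))"
        by (rule double) (auto simp: zJ_def)
      moreover have "\<dots> = (\<Prod>p\<in>J. exp (- r p * (1 - z p)))" by (intro prod.cong) (auto simp: zJ_def)
      ultimately show ?thesis by simp
    qed
    ultimately show "expectation (\<lambda>w. ?W w * (\<Prod>p\<in>J. z p ^ N p w)) =
        measure_pmf.prob equilibrium B * (\<Prod>p\<in>J. exp (- r p * (1 - z p)))"
      by (simp add: mult.commute)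
  qed measurable
  moreover have "expectation (\<lambda>w. ?W w * (\<Prod>p\<in>J. indicator {a p} (N p w))) =
      expectation (indicator {w\<in>space M. X (t n) w \<in> B \<and> (\<forall>p\<in>J. N p w = a p)})"
  proof (rule Bochner_Integration.integral_cong[OF refl])
    fix w assume "w \<in> space M"
    moreover have "(\<Prod>p\<in>J. indicator {a p} (N p w)) = (if \<forall>p\<in>J. N p w = a p then 1 else 0 :: real)"
    proof (cases "\<forall>p\<in>J. N p w = a p")
      case False
      then obtain p where "p \<in> J" "indicator {a p} (N p w) = (0 :: real)" by auto
      then show ?thesis using prod_zero[of J] \<open>finite J\<close> False by auto
    qed simp
    ultimately show "?W w * (\<Prod>p\<in>J. indicator {a p} (N p w)) =
        indicator {w\<in>space M. X (t n) w \<in> B \<and> (\<forall>p\<in>J. N p w = a p)} w"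
      by (auto split: split_indicator)
  qed
  moreover have "{w\<in>space M. X (t n) w \<in> B \<and> (\<forall>p\<in>J. N p w = a p)} \<in> events"
    using \<open>finite J\<close> by measurable
  ultimately show ?thesis by (simp add: N_def r_def)
qed

end

section \<open>Independence\<close>

context prob_space
begin

text \<open>Finitely many such variables take only countably many joint values, so the joint law and
  the product law agree as soon as they agree on points.\<close>

lemma indep_vars_by_atoms:
  fixes Y :: "'i \<Rightarrow> 'a \<Rightarrow> nat"
  assumes "finite I"
    and Y: "\<And>i. i \<in> I \<Longrightarrow> Y i \<in> measurable M (count_space UNIV)"
    and atoms: "\<And>a. prob {w\<in>space M. \<forall>i\<in>I. Y i w = a i} = (\<Prod>i\<in>I. prob {w\<in>space M. Y i w = a i})"
  shows "indep_vars (\<lambda>_. count_space UNIV) Y I"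
proof (cases "I = {}")
  case True
  then show ?thesis by (simp add: indep_vars_def indep_sets_def)
next
  case False
  have PiM_eq: "PiM I (\<lambda>_. count_space (UNIV :: nat set)) = count_space (PiE I (\<lambda>_. UNIV))"
    using count_space_PiM_finite[OF \<open>finite I\<close>, of "\<lambda>_. UNIV :: nat set"] by simp
  have sets_D: "sets (\<Pi>\<^sub>M i\<in>I. distr M (count_space UNIV) (Y i)) = Pow (PiE I (\<lambda>_. UNIV))"
    using arg_cong[OF PiM_eq, of sets] by (subst sets_PiM_cong[OF refl, of I _ "\<lambda>_. count_space UNIV"]) auto
  have Y': "(\<lambda>w. \<lambda>i\<in>I. Y i w) \<in> measurable M (PiM I (\<lambda>_. count_space UNIV))"
    using Y by (intro measurable_restrict)
  show ?thesis
  proof (subst indep_vars_iff_distr_eq_PiM'[OF False Y], assumption, rule measure_eqI_countable)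
    show "sets (distr M (PiM I (\<lambda>_. count_space UNIV)) (\<lambda>w. \<lambda>i\<in>I. Y i w)) = Pow (PiE I (\<lambda>_. UNIV))"
      by (simp add: PiM_eq)
    show "sets (\<Pi>\<^sub>M i\<in>I. distr M (count_space UNIV) (Y i)) = Pow (PiE I (\<lambda>_. UNIV))" by (rule sets_D)
    show "countable (PiE I (\<lambda>_. UNIV :: nat set))" using \<open>finite I\<close> by (intro countable_PiE) auto
    fix a :: "'i \<Rightarrow> nat" assume a: "a \<in> PiE I (\<lambda>_. UNIV)"
    \<comment> \<open>Outside \<open>I\<close> a one-point space is inserted, as
      \<open>product_prob_space\<close> asks for a probability space at every index.\<close>
    define D where "D i = (if i \<in> I then distr M (count_space UNIV) (Y i) else count_space {undefined})" for i
    have "prob_space (D i)" for i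
    proof (cases "i \<in> I")
      case True
      then show ?thesis using prob_space_distr[OF Y[OF True]] by (simp add: D_def)
    next
      case False
      then show ?thesis by (intro prob_spaceI) (simp add: D_def)
    qed
    then interpret D: product_prob_space D I by (intro product_prob_spaceI)
    have "PiM I D = (\<Pi>\<^sub>M i\<in>I. distr M (count_space UNIV) (Y i))"
      by (rule PiM_cong) (auto simp: D_def)
    moreover have "emeasure (PiM I D) (PiE I (\<lambda>i. {a i})) = (\<Prod>i\<in>I. emeasure (D i) {a i})"
      using \<open>finite I\<close> by (intro D.emeasure_PiM) (auto simp: D_def)
    moreover have "(\<Prod>i\<in>I. emeasure (D i) {a i}) = ennreal (\<Prod>i\<in>I. prob {w\<in>space M. Y i w = a i})"
    proof -
      have "emeasure (D i) {a i} = ennreal (prob {w\<in>space M. Y i w = a i})" if "i \<in> I" for i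
        using that Y by (simp add: D_def emeasure_distr emeasure_eq_measure vimage_def Int_def conj_commute)
      then show ?thesis by (simp add: prod_ennreal)
    qed
    moreover have "emeasure (distr M (PiM I (\<lambda>_. count_space UNIV)) (\<lambda>w. \<lambda>i\<in>I. Y i w)) {a} =
        ennreal (prob {w\<in>space M. \<forall>i\<in>I. Y i w = a i})"
    proof -
      have "(\<lambda>w. \<lambda>i\<in>I. Y i w) -` {a} \<inter> space M = {w\<in>space M. \<forall>i\<in>I. Y i w = a i}"
        using a by (auto simp: fun_eq_iff PiE_def extensional_def)
      then show ?thesis
        using a by (subst emeasure_distr[OF Y']) (auto simp: PiM_eq emeasure_eq_measure)
    qed
    moreover have "PiE I (\<lambda>i. {a i}) = {a}" using a by (intro PiE_singleton) (auto simp: PiE_def)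
    ultimately show "emeasure (distr M (PiM I (\<lambda>_. count_space UNIV)) (\<lambda>w. \<lambda>i\<in>I. Y i w)) {a} =
        emeasure (\<Pi>\<^sub>M i\<in>I. distr M (count_space UNIV) (Y i)) {a}"
      using atoms[of a] by simp
  qed
qed

text \<open>Meant for counts over the cells of a grid: conditions on disjoint finite blocks are
  independent, and every condition on finitely many counts is measurable.\<close>

lemma indep_vars_blocks:
  fixes Y :: "'i \<Rightarrow> 'a \<Rightarrow> nat" and R :: "'l \<Rightarrow> ('i \<Rightarrow> nat) \<Rightarrow> bool"
  assumes Y: "indep_vars (\<lambda>_. count_space UNIV) Y I"
    and L: "finite L" "L \<noteq> {}"
    and K: "\<And>l. l \<in> L \<Longrightarrow> K l \<subseteq> I" "\<And>l. l \<in> L \<Longrightarrow> finite (K l)" "disjoint_family_on K L"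
  shows "prob (\<Inter>l\<in>L. {w\<in>space M. R l (\<lambda>i\<in>K l. Y i w)}) = (\<Prod>l\<in>L. prob {w\<in>space M. R l (\<lambda>i\<in>K l. Y i w)})"
proof -
  have "indep_vars (\<lambda>l. PiM (K l) (\<lambda>_. count_space UNIV)) (\<lambda>l w. \<lambda>i\<in>K l. Y i w) L"
    using Y K(1,3) by (rule indep_vars_restrict)
  moreover have "{f \<in> PiE (K l) (\<lambda>_. UNIV). R l f} \<in> sets (PiM (K l) (\<lambda>_. count_space (UNIV :: nat set)))" if "l \<in> L" for l
    using count_space_PiM_finite[OF K(2)[OF that], of "\<lambda>_. UNIV :: nat set"] by auto
  ultimately have "prob (\<Inter>l\<in>L. (\<lambda>w. \<lambda>i\<in>K l. Y i w) -` {f \<in> PiE (K l) (\<lambda>_. UNIV). R l f} \<inter> space M) =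
      (\<Prod>l\<in>L. prob ((\<lambda>w. \<lambda>i\<in>K l. Y i w) -` {f \<in> PiE (K l) (\<lambda>_. UNIV). R l f} \<inter> space M))"
    using L by (intro indep_varsD[where I=L]) auto
  moreover have "(\<lambda>w. \<lambda>i\<in>K l. Y i w) -` {f \<in> PiE (K l) (\<lambda>_. UNIV). R l f} \<inter> space M = {w\<in>space M. R l (\<lambda>i\<in>K l. Y i w)}" for l
    by auto
  ultimately show ?thesis by (simp only:)
qed

end

lemma sigma_sets_vimage_PiM:
  assumes "Z \<in> space M \<rightarrow> (\<Pi>\<^sub>E i\<in>I. space (N i))"
  shows "{Z -` A \<inter> space M | A. A \<in> sets (PiM I N)} = sigma_sets (space M) {Z -` A \<inter> space M | A. A \<in> prod_algebra I N}"
  unfolding sets_PiM using assms by (rule sigma_sets_vimage_commute)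

text \<open>A generator of the product sigma-algebra constrains finitely many coordinates, hence
  involves only finitely many time points of a process.\<close>

lemma vimage_prod_algebraE:
  assumes A: "A \<in> prod_algebra I N" and Z: "Z \<in> S \<rightarrow> (\<Pi>\<^sub>E i\<in>I. space (N i))"
  obtains J B where "finite J" "J \<subseteq> I" "Z -` A \<inter> S = {w\<in>S. \<forall>i\<in>J. Z w i \<in> B i}"
proof -
  obtain J B where J: "A = prod_emb I N J (\<Pi>\<^sub>E j\<in>J. B j)" "finite J" "J \<subseteq> I"
    using A by (rule prod_algebraE)
  have "Z -` A \<inter> S = {w\<in>S. \<forall>i\<in>J. Z w i \<in> B i}"
    using Z unfolding J(1) prod_emb_def by (auto simp: restrict_PiE_iff Pi_iff)
  then show ?thesis using that J(2,3) by blast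
qed

lemma Int_stable_vimage:
  assumes "Int_stable G"
  shows "Int_stable {Z -` A \<inter> S | A. A \<in> G}"
proof (rule Int_stableI)
  fix a b assume "a \<in> {Z -` A \<inter> S | A. A \<in> G}" "b \<in> {Z -` A \<inter> S | A. A \<in> G}"
  then obtain A B where "a = Z -` A \<inter> S" "b = Z -` B \<inter> S" "A \<in> G" "B \<in> G" by blast
  moreover from this have "A \<inter> B \<in> G" using assms by (simp add: Int_stable_def)
  ultimately show "a \<inter> b \<in> {Z -` A \<inter> S | A. A \<in> G}" by (auto intro!: exI[of _ "A \<inter> B"])
qed

section \<open>Poisson law, independence of the types, independence of the state\<close>

context stationary_fcfs
begin

lemma departed_marginal:
  assumes t: "\<And>j. j < n \<Longrightarrow> t j < t (Suc j)" and "j < n"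
  shows "prob {w\<in>space M. departed c (t j) (t (Suc j)) w = k} = pmf (poisson_pmf (lam c * (t (Suc j) - t j))) k"
  using departed_law[of n t "{(j, c)}" UNIV "\<lambda>_. k"] assms by simp

lemma departures_poisson: "poisson_process M (departures X c) (lam c)"
  unfolding poisson_process_def
proof (intro conjI ballI allI impI)
  show "finite (departures X c w \<inter> {s<..t})" if "w \<in> space M" for w s t
    using that by (rule finite_departures)
  show "departed c s t \<in> measurable M (count_space UNIV)" for s t by measurable
next
  fix s t :: real assume "s < t"
  show "distr M (count_space UNIV) (departed c s t) = measure_pmf (poisson_pmf (lam c * (t - s)))"
  proof (rule measure_eqI_countable[where A=UNIV])
    fix k
    have "prob {w\<in>space M. departed c s t w = k} = pmf (poisson_pmf (lam c * (t - s))) k"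
      using departed_marginal[of 1 "\<lambda>i. if i = 0 then s else t" 0 c k] \<open>s < t\<close> by simp
    then show "emeasure (distr M (count_space UNIV) (departed c s t)) {k} = emeasure (measure_pmf (poisson_pmf (lam c * (t - s)))) {k}"
      by (simp add: emeasure_distr emeasure_pmf_single emeasure_eq_measure vimage_def Int_def conj_commute)
  qed auto
next
  fix n and t :: "nat \<Rightarrow> real" assume "\<forall>i<n. t i < t (Suc i)"
  then have t: "\<And>i. i < n \<Longrightarrow> t i < t (Suc i)" by blast
  show "indep_vars (\<lambda>_. count_space UNIV) (\<lambda>i. departed c (t i) (t (Suc i))) {..<n}"
  proof (rule indep_vars_by_atoms)
    fix a :: "nat \<Rightarrow> nat"
    have "{w\<in>space M. \<forall>i\<in>{..<n}. departed c (t i) (t (Suc i)) w = a i} =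
        {w\<in>space M. X (t n) w \<in> UNIV \<and> (\<forall>p\<in>(\<lambda>i. (i, c)) ` {..<n}. departed (snd p) (t (fst p)) (t (Suc (fst p))) w = a (fst p))}"
      by auto
    also have "prob \<dots> = (\<Prod>i<n. pmf (poisson_pmf (lam c * (t (Suc i) - t i))) (a i))"
      using t by (subst departed_law) (auto simp: prod.reindex inj_on_def)
    also have "\<dots> = (\<Prod>i<n. prob {w\<in>space M. departed c (t i) (t (Suc i)) w = a i})"
      by (intro prod.cong refl departed_marginal[symmetric] t) auto
    finally show "prob {w\<in>space M. \<forall>i\<in>{..<n}. departed c (t i) (t (Suc i)) w = a i} =
        (\<Prod>i<n. prob {w\<in>space M. departed c (t i) (t (Suc i)) w = a i})" .
  qed auto
qed

lemma departed_sum: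
  assumes "w \<in> space M" and "\<And>j. i \<le> j \<Longrightarrow> j < k \<Longrightarrow> t j \<le> t (Suc j)" and "i \<le> k"
  shows "departed c (t i) (t k) w = (\<Sum>j\<in>{i..<k}. departed c (t j) (t (Suc j)) w)"
  using assms(3,2)
proof (induction k rule: dec_induct)
  case base
  then show ?case by (simp add: departed_empty)
next
  case (step k)
  have "t i \<le> t k"
    using step.hyps(1) step.prems by (induction k rule: dec_induct) (auto intro: order_trans)
  then have split: "{t i<..t (Suc k)} = {t i<..t k} \<union> {t k<..t (Suc k)}"
    using step.prems[of k] step.hyps by auto
  have "departed c (t i) (t (Suc k)) w = departed c (t i) (t k) w + departed c (t k) (t (Suc k)) w"
    unfolding points_in_def split Int_Un_distrib
    by (rule card_Un_disjoint) (auto intro: finite_departures assms(1))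
  then show ?case using step by simp
qed

text \<open>The sorted elements of \<open>F\<close> cut the line into cells, and an increment
  between two of them is the sum over the cells in between. For \<open>s \<le> r\<close> no cell
  fits, in accordance with the empty interval.\<close>

lemma common_grid:
  fixes F :: "real set"
  assumes "finite F" "F \<noteq> {}"
  obtains n t where "\<And>j. j < n \<Longrightarrow> t j < t (Suc j)" "t n = Max F"
    "\<And>c r s w. r \<in> F \<Longrightarrow> s \<in> F \<Longrightarrow> w \<in> space M \<Longrightarrow>
      departed c r s w = (\<Sum>j | j < n \<and> r \<le> t j \<and> t (Suc j) \<le> s. departed c (t j) (t (Suc j)) w)"
proof -
  define l where "l = sorted_list_of_set F"
  define n where "n = length l - 1"
  define t where "t j = l ! j" for j
  have l: "set l = F" "sorted_wrt (<) l" "l \<noteq> []"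
    using assms by (auto simp: l_def)
  have len: "length l = Suc n" using l(3) by (simp add: n_def)
  have less: "t j < t (Suc j)" if "j < n" for j
    unfolding t_def using sorted_wrt_nth_less[OF l(2), of j "Suc j"] that len by simp
  have mono: "t i \<le> t j" if "i \<le> j" "j \<le> n" for i j
    using sorted_wrt_nth_less[OF l(2), of i j] that len by (cases "i = j") (auto simp: t_def)
  have index: "\<exists>j\<le>n. r = t j" if "r \<in> F" for r
    using that len unfolding l(1)[symmetric] in_set_conv_nth t_def by (auto simp: less_Suc_eq_le)
  have "t n \<in> F" using len l(1) unfolding t_def by (metis lessI nth_mem)
  then have "t n = Max F"
  proof (intro Max_eqI[symmetric])
    fix y assume "y \<in> F"
    then obtain j where "j \<le> n" "y = t j" using index by blast
    then show "y \<le> t n" using mono[of j n] by simp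
  qed (use assms(1) in simp_all)
  moreover have "departed c r s w = (\<Sum>j | j < n \<and> r \<le> t j \<and> t (Suc j) \<le> s. departed c (t j) (t (Suc j)) w)"
    if rs: "r \<in> F" "s \<in> F" and w: "w \<in> space M" for c r s w
  proof -
    obtain i k where ik: "i \<le> n" "r = t i" "k \<le> n" "s = t k" using index rs by blast
    have le_iff: "t i \<le> t j \<longleftrightarrow> i \<le> j" if "i \<le> n" "j \<le> n" for i j
      using mono[of i j] sorted_wrt_nth_less[OF l(2), of j i] that len by (cases "i \<le> j") (auto simp: t_def)
    have set: "{j. j < n \<and> r \<le> t j \<and> t (Suc j) \<le> s} = {i..<k}"
      unfolding ik using ik(1,3) le_iff by auto
    show ?thesis
    proof (cases "i \<le> k")
      case True
      then show ?thesis
        unfolding set unfolding ik using ik(3) less by (intro departed_sum[OF w]) (auto intro: less_imp_le)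
    next
      case False
      then have "s \<le> r" unfolding ik using mono[of k i] ik(1) by simp
      then show ?thesis unfolding set using False by (simp add: departed_empty)
    qed
  qed
  ultimately show ?thesis using that less by blast
qed

text \<open>Index \<open>None\<close> stands for the final state, encoded as a number because all variables must
  have the same type.\<close>

lemma grid_indep:
  fixes t :: "nat \<Rightarrow> real"
  assumes t: "\<And>j. j < n \<Longrightarrow> t j < t (Suc j)"
  shows "indep_vars (\<lambda>_. count_space UNIV)
    (\<lambda>i w. case i of None \<Rightarrow> to_nat (X (t n) w) | Some p \<Rightarrow> departed (snd p) (t (fst p)) (t (Suc (fst p))) w)
    (insert None (Some ` ({..<n} \<times> (UNIV :: 'c set))))"
    (is "indep_vars _ ?W ?I")
proof (rule indep_vars_by_atoms)
  fix i :: "(nat \<times> 'c) option"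
  show "?W i \<in> measurable M (count_space UNIV)"
    by (cases i) (simp_all add: measurable_compose[OF X_measurable])
next
  fix a :: "(nat \<times> 'c) option \<Rightarrow> nat"
  define B where "B = {x :: 'c list. to_nat x = a None}"
  have "{w\<in>space M. \<forall>i\<in>?I. ?W i w = a i} =
      {w\<in>space M. X (t n) w \<in> B \<and> (\<forall>p\<in>{..<n} \<times> UNIV. departed (snd p) (t (fst p)) (t (Suc (fst p))) w = a (Some p))}"
    by (auto simp: B_def)
  also have "prob \<dots> = measure_pmf.prob equilibrium B *
      (\<Prod>p\<in>{..<n} \<times> UNIV. pmf (poisson_pmf (lam (snd p) * (t (Suc (fst p)) - t (fst p)))) (a (Some p)))"
    using t by (intro departed_law) auto
  also have "measure_pmf.prob equilibrium B = prob {w\<in>space M. ?W None w = a None}"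
    using departed_law[of n t "{}" B] t by (simp add: B_def)
  also have "(\<Prod>p\<in>{..<n} \<times> UNIV. pmf (poisson_pmf (lam (snd p) * (t (Suc (fst p)) - t (fst p)))) (a (Some p))) =
      (\<Prod>p\<in>{..<n} \<times> UNIV. prob {w\<in>space M. ?W (Some p) w = a (Some p)})"
  proof (intro prod.cong refl)
    fix p :: "nat \<times> 'c" assume "p \<in> {..<n} \<times> UNIV"
    then have "fst p < n" by auto
    then show "pmf (poisson_pmf (lam (snd p) * (t (Suc (fst p)) - t (fst p)))) (a (Some p)) =
        prob {w\<in>space M. ?W (Some p) w = a (Some p)}"
      using departed_marginal[of n t "fst p" "snd p" "a (Some p)"] t by simp
  qed
  finally show "prob {w\<in>space M. \<forall>i\<in>?I. ?W i w = a i} = (\<Prod>i\<in>?I. prob {w\<in>space M. ?W i w = a i})"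
    by (subst prod.insert) (auto simp: prod.reindex)
qed auto

text \<open>Cylinder events generate the sigma-algebra of each process and are stable under
  intersection. Finitely many of them live on one grid, whose cells form disjoint blocks of
  independent counts for the different types.\<close>

lemma departures_independent: "independent_processes M (departures X)"
proof -
  let ?N = "\<lambda>_ :: real \<times> real. count_space (UNIV :: nat set)"
  let ?Z = "\<lambda>c w. \<lambda>(s, t). departed c s t w"
  have Z: "?Z c \<in> measurable M (PiM UNIV ?N)" for c
    by (rule measurable_PiM_single') (auto simp: case_prod_unfold)
  have Z_fun: "?Z c \<in> space M \<rightarrow> (\<Pi>\<^sub>E i\<in>UNIV. space (?N i))" for c by auto
  let ?G = "\<lambda>c. {?Z c -` A \<inter> space M | A. A \<in> prod_algebra UNIV ?N}"
  have "indep_sets ?G UNIV"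
  proof (rule indep_setsI)
    have "A \<in> sets (PiM UNIV ?N)" if "A \<in> prod_algebra UNIV ?N" for A
      unfolding sets_PiM using that by (rule sigma_sets.Basic)
    then show "?G c \<subseteq> events" for c
      using measurable_sets[OF Z[of c]] by blast
  next
    fix A :: "'c \<Rightarrow> 'w set" and L :: "'c set"
    assume L: "L \<noteq> {}" "finite L" and A: "\<forall>c\<in>L. A c \<in> ?G c"
    have "\<exists>JS. c \<in> L \<longrightarrow> finite (fst JS) \<and> A c = {w\<in>space M. \<forall>p\<in>fst JS. departed c (fst p) (snd p) w \<in> snd JS p}" for c
    proof (cases "c \<in> L")
      case True
      then obtain B where B: "A c = ?Z c -` B \<inter> space M" "B \<in> prod_algebra UNIV ?N" using A by blast
      obtain J S where "finite J" "?Z c -` B \<inter> space M = {w\<in>space M. \<forall>p\<in>J. ?Z c w p \<in> S p}"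
        using B(2) Z_fun by (rule vimage_prod_algebraE)
      then show ?thesis unfolding B(1) by (intro exI[of _ "(J, S)"]) (simp add: case_prod_unfold)
    qed simp
    then have "\<forall>c. \<exists>JS. c \<in> L \<longrightarrow> finite (fst JS) \<and>
        A c = {w\<in>space M. \<forall>p\<in>fst JS. departed c (fst p) (snd p) w \<in> snd JS p}"
      by (rule allI)
    from choice[OF this] obtain JS where JS: "\<forall>c. c \<in> L \<longrightarrow> finite (fst (JS c)) \<and>
        A c = {w\<in>space M. \<forall>p\<in>fst (JS c). departed c (fst p) (snd p) w \<in> snd (JS c) p}" ..
    define J where "J c = fst (JS c)" for c
    define S where "S c = snd (JS c)" for c
    have J: "finite (J c)" if "c \<in> L" for c using JS that by (simp add: J_def)
    have A_eq: "A c = {w\<in>space M. \<forall>p\<in>J c. departed c (fst p) (snd p) w \<in> S c p}" if "c \<in> L" for c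
      using JS that by (simp add: J_def S_def)
    \<comment> \<open>The 0 makes \<open>F\<close> nonempty also when the cylinders constrain
      nothing.\<close>
    define F where "F = insert 0 (\<Union>c\<in>L. fst ` J c \<union> snd ` J c)"
    have "finite F" "F \<noteq> {}" using L(2) J by (auto simp: F_def)
    then obtain n t where t: "\<And>j. j < n \<Longrightarrow> t j < t (Suc j)"
      and dec: "\<And>c r s w. r \<in> F \<Longrightarrow> s \<in> F \<Longrightarrow> w \<in> space M \<Longrightarrow>
        departed c r s w = (\<Sum>j | j < n \<and> r \<le> t j \<and> t (Suc j) \<le> s. departed c (t j) (t (Suc j)) w)"
      by (rule common_grid) blast
    define T where "T r s = {j. j < n \<and> r \<le> t j \<and> t (Suc j) \<le> s}" for r s
    let ?W = "\<lambda>i w. case i of None \<Rightarrow> to_nat (X (t n) w) | Some p \<Rightarrow> departed (snd p) (t (fst p)) (t (Suc (fst p))) w"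
    define K where "K c = Some ` ({..<n} \<times> {c})" for c :: 'c
    define R where "R c f \<longleftrightarrow> (\<forall>p\<in>J c. (\<Sum>j\<in>T (fst p) (snd p). f (Some (j, c))) \<in> S c p)" for c and f :: "(nat \<times> 'c) option \<Rightarrow> nat"
    have A_R: "A c = {w\<in>space M. R c (\<lambda>i\<in>K c. ?W i w)}" if "c \<in> L" for c
    proof -
      have "departed c (fst p) (snd p) w = (\<Sum>j\<in>T (fst p) (snd p). (\<lambda>i\<in>K c. ?W i w) (Some (j, c)))"
        if "p \<in> J c" "w \<in> space M" for p w
      proof -
        have F: "fst p \<in> F" "snd p \<in> F" using that \<open>c \<in> L\<close> by (auto simp: F_def)
        show ?thesis unfolding dec[OF F that(2)] T_def
          by (intro sum.cong refl) (simp add: K_def)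
      qed
      then show ?thesis unfolding A_eq[OF that] R_def by auto
    qed
    have "prob (\<Inter>c\<in>L. {w\<in>space M. R c (\<lambda>i\<in>K c. ?W i w)}) = (\<Prod>c\<in>L. prob {w\<in>space M. R c (\<lambda>i\<in>K c. ?W i w)})"
      by (rule indep_vars_blocks[OF grid_indep[where t=t and n=n, OF t] L(2,1)]) (auto simp: K_def disjoint_family_on_def)
    then show "prob (\<Inter>c\<in>L. A c) = (\<Prod>c\<in>L. prob (A c))" using A_R by simp
  qed
  then have "indep_sets (\<lambda>c. sigma_sets (space M) (?G c)) UNIV"
    by (rule indep_sets_sigma) (intro Int_stable_vimage Int_stable_prod_algebra)
  then have "indep_vars (\<lambda>_. PiM UNIV ?N) ?Z UNIV"
    unfolding indep_vars_def2 using Z by (simp add: sigma_sets_vimage_PiM[OF Z_fun])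
  then show ?thesis unfolding independent_processes_def .
qed

lemma state_independent_of_past: "independent_of_past M (X u) (departures X) u"
proof -
  define I where "I = {(c :: 'c, r :: real, s). s < u}"
  let ?N = "\<lambda>_ :: 'c \<times> real \<times> real. count_space (UNIV :: nat set)"
  let ?Z = "\<lambda>w. \<lambda>(c, r, s)\<in>I. departed c r s w"
  have Z: "?Z \<in> measurable M (PiM I ?N)"
    by (rule measurable_restrict) (auto simp: case_prod_unfold)
  have Z_fun: "?Z \<in> space M \<rightarrow> (\<Pi>\<^sub>E i\<in>I. space (?N i))" by auto
  let ?A = "{X u -` B \<inter> space M | B. B \<in> UNIV}"
  let ?G = "{?Z -` A \<inter> space M | A. A \<in> prod_algebra I ?N}"
  have "indep_set ?A ?G"
  proof (rule indep_setI)
    show "?A \<subseteq> events" by (auto intro: measurable_sets[OF X_measurable])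
    have "A \<in> sets (PiM I ?N)" if "A \<in> prod_algebra I ?N" for A
      unfolding sets_PiM using that by (rule sigma_sets.Basic)
    then show "?G \<subseteq> events"
      using measurable_sets[OF Z] by blast
  next
    fix a g assume "a \<in> ?A" "g \<in> ?G"
    then obtain B H where a: "a = X u -` B \<inter> space M" and g: "g = ?Z -` H \<inter> space M" and H: "H \<in> prod_algebra I ?N"
      by blast
    obtain J S where J: "finite J" "J \<subseteq> I" "g = {w\<in>space M. \<forall>p\<in>J. ?Z w p \<in> S p}"
      unfolding g using H Z_fun by (rule vimage_prod_algebraE)
    \<comment> \<open>A past increment has \<open>s < u\<close>, but \<open>r\<close> may exceed
      \<open>u\<close>. Its interval is then empty, and remains so when \<open>r\<close> is replaced
      by \<open>u\<close>; after that no time point lies beyond \<open>u\<close>, and the grid ends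
      at \<open>u\<close>.\<close>
    let ?r = "\<lambda>p. min u (fst (snd p))" and ?s = "\<lambda>p :: 'c \<times> real \<times> real. snd (snd p)"
    have "?Z w p = departed (fst p) (?r p) (?s p) w" if "p \<in> J" for p w
    proof -
      have "?Z w p = departed (fst p) (fst (snd p)) (?s p) w" and "?s p < u"
        using that J(2) by (auto simp: case_prod_unfold I_def)
      then show ?thesis by (cases "fst (snd p) \<le> u") (auto simp: departed_empty)
    qed
    then have g_eq: "g = {w\<in>space M. \<forall>p\<in>J. departed (fst p) (?r p) (?s p) w \<in> S p}"
      unfolding J(3) by auto
    define F where "F = insert u (?r ` J \<union> ?s ` J)"
    have F: "finite F" "F \<noteq> {}" using J(1) by (auto simp: F_def)
    have "Max F = u" using F(1) J(2) by (intro Max_eqI) (auto simp: F_def I_def)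
    obtain n t where t: "\<And>j. j < n \<Longrightarrow> t j < t (Suc j)" "t n = Max F"
      and dec: "\<And>c r s w. r \<in> F \<Longrightarrow> s \<in> F \<Longrightarrow> w \<in> space M \<Longrightarrow>
        departed c r s w = (\<Sum>j | j < n \<and> r \<le> t j \<and> t (Suc j) \<le> s. departed c (t j) (t (Suc j)) w)"
      using F by (rule common_grid) blast
    define T where "T r s = {j. j < n \<and> r \<le> t j \<and> t (Suc j) \<le> s}" for r s
    have tn: "t n = u" using t(2) \<open>Max F = u\<close> by simp
    let ?W = "\<lambda>i w. case i of None \<Rightarrow> to_nat (X (t n) w) | Some p \<Rightarrow> departed (snd p) (t (fst p)) (t (Suc (fst p))) w"
    \<comment> \<open>Two blocks: the state at \<open>u\<close>, and all counts before
      \<open>u\<close>.\<close>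
    define K where "K b = (if b then {None} else Some ` ({..<n} \<times> (UNIV :: 'c set)))" for b
    define R where "R b f \<longleftrightarrow> (if b then f None \<in> to_nat ` B
        else \<forall>p\<in>J. (\<Sum>j\<in>T (?r p) (?s p). f (Some (j, fst p))) \<in> S p)" for b and f :: "(nat \<times> 'c) option \<Rightarrow> nat"
    have "a = {w\<in>space M. R True (\<lambda>i\<in>K True. ?W i w)}"
      unfolding a R_def K_def tn by (auto simp: inj_image_mem_iff)
    moreover have "g = {w\<in>space M. R False (\<lambda>i\<in>K False. ?W i w)}"
    proof -
      have "departed (fst p) (?r p) (?s p) w = (\<Sum>j\<in>T (?r p) (?s p). (\<lambda>i\<in>K False. ?W i w) (Some (j, fst p)))"
        if "p \<in> J" "w \<in> space M" for p w
      proof -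
        have pF: "?r p \<in> F" "?s p \<in> F" using that by (auto simp: F_def)
        show ?thesis unfolding dec[OF pF that(2)] T_def
          by (intro sum.cong refl) (auto simp: K_def)
      qed
      then show ?thesis unfolding g_eq R_def by auto
    qed
    moreover have "prob (\<Inter>b\<in>UNIV. {w\<in>space M. R b (\<lambda>i\<in>K b. ?W i w)}) = (\<Prod>b\<in>UNIV. prob {w\<in>space M. R b (\<lambda>i\<in>K b. ?W i w)})"
      by (rule indep_vars_blocks[OF grid_indep[where t=t and n=n, OF t(1)]]) (auto simp: K_def disjoint_family_on_def)
    ultimately show "prob (a \<inter> g) = prob a * prob g"
      by (simp add: UNIV_bool Int_commute mult.commute)
  qed
  then have "indep_set (sigma_sets (space M) ?A) (sigma_sets (space M) ?G)"
    by (rule indep_set_sigma_sets)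
      (rule Int_stable_vimage, simp add: Int_stable_def, rule Int_stable_vimage, rule Int_stable_prod_algebra)
  moreover have idem: "sigma_sets (space M) (sigma_sets (space M) ?G) = sigma_sets (space M) ?G"
    by (rule sigma_sets_sigma_sets_eq) auto
  ultimately show ?thesis
    unfolding independent_of_past_def independent_elements_def I_def[symmetric]
    using Z by (simp add: sets_vimage_algebra sigma_sets_vimage_PiM[OF Z_fun] idem)
qed

end

section \<open>Measurability of the queues\<close>

text \<open>The junk value of \<open>Inf\<close> is the same in both degenerate cases; it has to be accounted for, as
  \<open>measure\<close> is 0 on nonmeasurable sets.\<close>

lemma Inf_real_not_bdd_below:
  fixes S :: "real set"
  assumes "\<not> bdd_below S" shows "Inf S = Inf {}"
proof -
  have "\<not> bdd_above (uminus ` S)" using assms by simp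
  then have "\<not> (\<forall>x\<in>uminus ` S. x \<le> z)" for z
    unfolding bdd_above_def by blast
  then have S: "(\<lambda>z. (\<forall>x\<in>uminus ` S. x \<le> z) \<and> (\<forall>y. (\<forall>x\<in>uminus ` S. x \<le> y) \<longrightarrow> z \<le> y)) = (\<lambda>z. False)"
    by (intro ext) blast
  have "\<not> (\<forall>y. z \<le> y)" for z :: real
    by (metis lt_ex not_le)
  then have empty: "(\<lambda>z :: real. (\<forall>x\<in>uminus ` {}. x \<le> z) \<and> (\<forall>y. (\<forall>x\<in>uminus ` {}. x \<le> y) \<longrightarrow> z \<le> y)) = (\<lambda>z. False)"
    by (intro ext) blast
  show ?thesis
    unfolding Inf_real_def Sup_real_def Least_def S empty ..
qed

text \<open>Countable infima of extended reals are measurable, and the value infinity discards the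
  indices that violate \<open>P\<close>. The result is infinite exactly when the set is empty or
  unbounded below, where the real infimum takes its default value.\<close>

lemma borel_measurable_Inf_Collect:
  fixes f :: "'i::countable \<Rightarrow> 'a \<Rightarrow> real"
  assumes [measurable]: "\<And>i. f i \<in> borel_measurable M" "\<And>i. Measurable.pred M (P i)"
  shows "(\<lambda>x. Inf {f i x | i. P i x}) \<in> borel_measurable M"
proof -
  define g where "g x = (INF i. if P i x then ereal (f i x) else \<infinity>)" for x
  have [measurable]: "g \<in> borel_measurable M"
    unfolding g_def by measurable
  have "Inf {f i x | i. P i x} = (if \<bar>g x\<bar> = \<infinity> then Inf {} else real_of_ereal (g x))" for x
  proof -
    let ?S = "{f i x | i. P i x}"
    have g: "g x = (INF y\<in>?S. ereal y)"
    proof (rule antisym)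
      show "g x \<le> (INF y\<in>?S. ereal y)"
      proof (rule INF_greatest)
        fix y assume "y \<in> ?S"
        then obtain i where "y = f i x" "P i x" by blast
        then show "g x \<le> ereal y" unfolding g_def by (intro INF_lower2[of i]) auto
      qed
      show "(INF y\<in>?S. ereal y) \<le> g x"
        unfolding g_def by (rule INF_greatest) (auto intro: INF_lower)
    qed
    consider "?S = {}" | "\<not> bdd_below ?S" | "?S \<noteq> {}" "bdd_below ?S" by blast
    then show ?thesis
    proof cases
      case 1
      then show ?thesis unfolding g by (simp add: top_ereal_def)
    next
      case 2
      have "g x = -\<infinity>"
      proof (rule ereal_bot)
        fix B :: real
        from 2 obtain y where "y \<in> ?S" "y < B" unfolding bdd_below_def by (meson not_le)
        then show "g x \<le> ereal B" unfolding g by (intro INF_lower2[of y]) auto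
      qed
      then show ?thesis using Inf_real_not_bdd_below[OF 2] by simp
    next
      case 3
      then have "g x = ereal (Inf ?S)" unfolding g by (intro ereal_Inf'[symmetric])
      then show ?thesis by simp
    qed
  qed
  then show ?thesis by (simp only:) measurable
qed

lemma measurable_count_space_atoms:
  fixes f :: "'a \<Rightarrow> 'b::countable"
  assumes "\<And>y. Measurable.pred M (\<lambda>x. f x = y)"
  shows "f \<in> measurable M (count_space UNIV)"
proof (subst measurable_count_space_eq2_countable, safe)
  fix y show "f -` {y} \<inter> space M \<in> sets M"
    using assms[of y] by (simp add: pred_def vimage_def Int_def conj_commute)
qed auto

lemma measurable_epoch [measurable]:
  assumes [measurable]: "\<And>p. (\<lambda>x. g x p) \<in> borel_measurable M"
  shows "(\<lambda>x. epoch (g x) i k) \<in> borel_measurable M"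
  unfolding epoch_def by measurable

lemma measurable_arrival_time:
  fixes a :: "'x \<Rightarrow> 'c::finite \<times> nat \<Rightarrow> real"
  assumes [measurable]: "\<And>p. (\<lambda>x. a x p) \<in> borel_measurable M"
  shows "(\<lambda>x. arrival_time (a x) n) \<in> borel_measurable M"
proof (induction n)
  case 0
  have "(\<lambda>x. Inf {(\<lambda>p x. epoch (a x) (fst p) (snd p)) p x | p. True}) \<in> borel_measurable M"
    by (rule borel_measurable_Inf_Collect) measurable
  then show ?case by simp
next
  case (Suc n)
  note [measurable] = Suc
  have "(\<lambda>x. Inf {(\<lambda>p x. epoch (a x) (fst p) (snd p)) p x | p. arrival_time (a x) n < epoch (a x) (fst p) (snd p)}) \<in> borel_measurable M"
    by (rule borel_measurable_Inf_Collect) measurable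
  then show ?case by simp
qed

lemma measurable_arrival_type:
  fixes a :: "'x \<Rightarrow> 'c::finite \<times> nat \<Rightarrow> real"
  assumes [measurable]: "\<And>p. (\<lambda>x. a x p) \<in> borel_measurable M"
  shows "(\<lambda>x. arrival_type (a x) n) \<in> measurable M (count_space UNIV)"
proof (rule measurable_count_space_atoms)
  fix d
  note [measurable] = measurable_arrival_time[of a, OF assms]
  let ?Q = "\<lambda>c x. \<exists>k. epoch (a x) c k = arrival_time (a x) n"
  \<comment> \<open>The choice depends on \<open>x\<close> only through the set of admissible types,
    and a finite type has finitely many subsets.\<close>
  have "(SOME c. ?Q c x) = d \<longleftrightarrow> (\<exists>S\<in>{S. (SOME c. c \<in> S) = d}. \<forall>c. ?Q c x \<longleftrightarrow> c \<in> S)" for x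
  proof
    assume "(SOME c. ?Q c x) = d"
    then show "\<exists>S\<in>{S. (SOME c. c \<in> S) = d}. \<forall>c. ?Q c x \<longleftrightarrow> c \<in> S"
      by (intro bexI[of _ "{c. ?Q c x}"]) auto
  next
    assume "\<exists>S\<in>{S. (SOME c. c \<in> S) = d}. \<forall>c. ?Q c x \<longleftrightarrow> c \<in> S"
    then obtain S where "(SOME c. c \<in> S) = d" "\<And>c. ?Q c x \<longleftrightarrow> c \<in> S" by blast
    then show "(SOME c. ?Q c x) = d" by simp
  qed
  then show "Measurable.pred M (\<lambda>x. arrival_type (a x) n = d)"
    unfolding arrival_type_def by (simp only:) measurable
qed

lemma measurable_content:
  fixes ty :: "nat \<Rightarrow> 'x \<Rightarrow> 'c::countable"
  assumes [measurable]: "\<And>n. ar n \<in> borel_measurable M" "\<And>n. dep n \<in> borel_measurable M"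
    "\<And>n. ty n \<in> measurable M (count_space UNIV)"
  shows "(\<lambda>x. content (\<lambda>n. ar n x) (\<lambda>n. ty n x) (\<lambda>n. dep n x) u) \<in> measurable M (count_space UNIV)"
proof (rule measurable_count_space_atoms)
  fix y :: "'c list"
  let ?Q = "\<lambda>n x. ar n x \<le> u \<and> u < dep n x"
  let ?l = "\<lambda>xs :: nat list. sorted_list_of_set (set xs)"
  \<comment> \<open>A finite index set is \<open>set xs\<close> for one of countably many lists
    \<open>xs\<close>; an infinite one gives the default value \<open>[]\<close> of
    \<open>sorted_list_of_set\<close>, which is the second disjunct.\<close>
  have "content (\<lambda>n. ar n x) (\<lambda>n. ty n x) (\<lambda>n. dep n x) u = y \<longleftrightarrow>
      (\<exists>xs. (\<forall>n. ?Q n x \<longleftrightarrow> n \<in> set xs) \<and> length (?l xs) = length y \<and> (\<forall>i\<in>{..<length y}. ty (?l xs ! i) x = y ! i)) \<or>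
      \<not> (\<exists>xs. \<forall>n. ?Q n x \<longleftrightarrow> n \<in> set xs) \<and> y = []" for x
  proof -
    define D where "D = {n. ?Q n x}"
    define R where "R S \<longleftrightarrow> length (sorted_list_of_set S) = length y \<and>
        (\<forall>i\<in>{..<length y}. ty (sorted_list_of_set S ! i) x = y ! i)" for S
    have iff: "(\<forall>n. ?Q n x \<longleftrightarrow> n \<in> set xs) \<longleftrightarrow> D = set xs" for xs by (auto simp: D_def)
    have content: "content (\<lambda>n. ar n x) (\<lambda>n. ty n x) (\<lambda>n. dep n x) u = map (\<lambda>n. ty n x) (sorted_list_of_set D)"
      by (simp add: content_def D_def)
    have "map (\<lambda>n. ty n x) (sorted_list_of_set D) = y \<longleftrightarrow>
        (\<exists>xs. D = set xs \<and> R (set xs)) \<or> \<not> (\<exists>xs. D = set xs) \<and> y = []"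
    proof (cases "finite D")
      case True
      then obtain xs where "D = set xs" using finite_list by metis
      then have "(\<exists>xs. D = set xs \<and> R (set xs)) \<longleftrightarrow> R D" "\<exists>xs. D = set xs" by auto
      moreover have "map (\<lambda>n. ty n x) (sorted_list_of_set D) = y \<longleftrightarrow> R D"
        unfolding R_def list_eq_iff_nth_eq by (simp add: Ball_def) metis
      ultimately show ?thesis by blast
    next
      case False
      then have "\<not> (\<exists>xs. D = set xs)" by (metis List.finite_set)
      then show ?thesis using False by auto
    qed
    then show ?thesis unfolding iff content R_def .
  qed
  then show "Measurable.pred M (\<lambda>x. content (\<lambda>n. ar n x) (\<lambda>n. ty n x) (\<lambda>n. dep n x) u = y)"
    by (simp only:) measurable
qed

lemma pred_servers [measurable]:
  assumes "ty \<in> measurable M (count_space UNIV)"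
  shows "Measurable.pred M (\<lambda>x. s \<in> servers E (ty x))"
  using measurable_compose[OF assms, of "\<lambda>c. s \<in> servers E c"] by simp

lemma measurable_redundancy_dep:
  fixes ty :: "nat \<Rightarrow> 'x \<Rightarrow> 'c::countable" and E :: "('s::finite \<times> 'c) set"
  assumes [measurable]: "\<And>n. ar n \<in> borel_measurable M"
    "\<And>n. ty n \<in> measurable M (count_space UNIV)" "\<And>p. b p \<in> borel_measurable M"
  shows "(\<lambda>x. redundancy_dep E (\<lambda>n. ar n x) (\<lambda>n. ty n x) (\<lambda>p. b p x) n) \<in> borel_measurable M"
proof (induction n rule: less_induct)
  case (less n)
  let ?dep = "\<lambda>m x. redundancy_dep E (\<lambda>n. ar n x) (\<lambda>n. ty n x) (\<lambda>p. b p x) m"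
  \<comment> \<open>The random index set is padded to \<open>{..n}\<close> with \<open>ar n\<close>,
    which takes part in the maximum anyway.\<close>
  let ?start = "\<lambda>s x. Max ((\<lambda>m. if m < n \<and> s \<in> servers E (ty m x) then ?dep m x else ar n x) ` {..n})"
  have start: "Max (insert (ar n x) ((\<lambda>m. ?dep m x) ` {m. m < n \<and> s \<in> servers E (ty m x)})) = ?start s x" for s x
    by (rule arg_cong[where f=Max]) (auto simp: image_iff)
  have [measurable]: "?start s \<in> borel_measurable M" for s
  proof (rule borel_measurable_Max)
    fix m
    show "(\<lambda>x. if m < n \<and> s \<in> servers E (ty m x) then ?dep m x else ar n x) \<in> borel_measurable M"
    proof (cases "m < n")
      case True
      note [measurable] = less[OF True]
      show ?thesis by measurable
    qed simp
  qed auto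
  have "(\<lambda>x. Min ((\<lambda>s. ?start s x + b (s, n) x) ` servers E (ty n x))) \<in> borel_measurable M"
  proof (rule measurable_compose_countable[where g="ty n" and f="\<lambda>c x. Min ((\<lambda>s. ?start s x + b (s, n) x) ` servers E c)"])
    fix c
    show "(\<lambda>x. Min ((\<lambda>s. ?start s x + b (s, n) x) ` servers E c)) \<in> borel_measurable M"
      by (rule borel_measurable_Min) measurable
  qed measurable
  then show ?case by (subst redundancy_dep.simps) (simp only: start)
qed

lemma measurable_matching_dep:
  fixes ty :: "nat \<Rightarrow> 'x \<Rightarrow> 'c::countable" and E :: "('s::finite \<times> 'c) set"
  assumes [measurable]: "\<And>n. ar n \<in> borel_measurable M"
    "\<And>n. ty n \<in> measurable M (count_space UNIV)" "\<And>p. (\<lambda>x. v x p) \<in> borel_measurable M"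
  shows "(\<lambda>x. matching_dep E (\<lambda>n. ar n x) (\<lambda>n. ty n x) (v x) n) \<in> borel_measurable M"
proof (induction n rule: less_induct)
  case (less n)
  let ?dep = "\<lambda>m x. matching_dep E (\<lambda>n. ar n x) (\<lambda>n. ty n x) (v x) m"
  let ?e = "\<lambda>p x. epoch (v x) (fst p) (snd p)"
  have "(\<lambda>x. Inf {?e p x | p. fst p \<in> servers E (ty n x) \<and> ar n x < ?e p x \<and>
      (\<forall>m\<in>{..<n}. fst p \<in> servers E (ty m x) \<longrightarrow> ?dep m x < ?e p x)}) \<in> borel_measurable M"
  proof (rule borel_measurable_Inf_Collect)
    fix p :: "'s \<times> nat"
    have [measurable]: "Measurable.pred M (\<lambda>x. \<forall>m\<in>{..<n}. fst p \<in> servers E (ty m x) \<longrightarrow> ?dep m x < ?e p x)"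
    proof (rule pred_intros_finite)
      fix m assume "m \<in> {..<n}"
      then have [measurable]: "?dep m \<in> borel_measurable M" by (intro less) auto
      show "Measurable.pred M (\<lambda>x. fst p \<in> servers E (ty m x) \<longrightarrow> ?dep m x < ?e p x)" by measurable
    qed auto
    show "Measurable.pred M (\<lambda>x. fst p \<in> servers E (ty n x) \<and> ar n x < ?e p x \<and>
      (\<forall>m\<in>{..<n}. fst p \<in> servers E (ty m x) \<longrightarrow> ?dep m x < ?e p x))" by measurable
  qed measurable
  then show ?case by (subst matching_dep.simps) simp
qed

lemma measurable_cust_time:
  fixes a :: "'x \<Rightarrow> 'c::finite \<times> nat \<Rightarrow> real"
  assumes "\<And>p. (\<lambda>x. a x p) \<in> borel_measurable M"
  shows "(\<lambda>x. cust_time y (a x) n) \<in> borel_measurable M"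
  unfolding cust_time_def using measurable_arrival_time[of a, OF assms] by auto

lemma measurable_cust_type:
  fixes a :: "'x \<Rightarrow> 'c::finite \<times> nat \<Rightarrow> real"
  assumes "\<And>p. (\<lambda>x. a x p) \<in> borel_measurable M"
  shows "(\<lambda>x. cust_type y (a x) n) \<in> measurable M (count_space UNIV)"
  unfolding cust_type_def using measurable_arrival_type[of a, OF assms] by auto

lemma measurable_exponentials_component [measurable]:
  "(\<lambda>g. g p) \<in> borel_measurable (exponentials r)"
proof -
  obtain i k where p: "p = (i, k)" by fastforce
  have "(\<lambda>g. g p) \<in> measurable (exponentials r) (case p of (i, k) \<Rightarrow> density lborel (exponential_density (r i)))"
    unfolding exponentials_def by (rule measurable_component_singleton) simp
  then show ?thesis by (simp add: p)
qed

lemma measurable_redundancy_state: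
  fixes E :: "('s::finite \<times> 'c::finite) set"
  shows "(\<lambda>(a, b). redundancy_state E x a b u) \<in>
    measurable (exponentials lam \<Otimes>\<^sub>M exponentials mu) (count_space UNIV)"
  unfolding redundancy_state_def case_prod_unfold
  by (intro measurable_content measurable_redundancy_dep[where b="\<lambda>p x. snd x p"] measurable_cust_time measurable_cust_type) measurable

lemma measurable_matching_state:
  fixes E :: "('s::finite \<times> 'c::finite) set"
  shows "(\<lambda>(a, v). matching_state E x a v u) \<in>
    measurable (exponentials lam \<Otimes>\<^sub>M exponentials mu) (count_space UNIV)"
  unfolding matching_state_def case_prod_unfold
  by (intro measurable_content measurable_matching_dep measurable_cust_time measurable_cust_type) measurable

section \<open>Transition probabilities to first order\<close>

text \<open>Properties that hold almost surely: positive gaps make the epochs increase, and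
  unbounded epochs make the sets in the infima of the construction nonempty.\<close>

definition regular :: "('i \<times> nat \<Rightarrow> real) \<Rightarrow> bool" where
  "regular g \<longleftrightarrow> (\<forall>p. 0 < g p) \<and> (\<forall>i t. \<exists>k. t < epoch g i k)"

context
  fixes r :: "'i::finite \<Rightarrow> real"
  assumes r_pos: "\<And>i. 0 < r i"
begin

lemma prob_space_exponential: "prob_space (density lborel (exponential_density (r i)))"
  by (rule prob_space_exponential_density[OF r_pos])

lemma prob_exponential:
  assumes "0 \<le> u"
  shows "measure (density lborel (exponential_density (r i))) {..u} = 1 - exp (- u * r i)"
    and "measure (density lborel (exponential_density (r i))) {u<..} = exp (- u * r i)"
proof -
  let ?D = "density lborel (exponential_density (r i))"
  interpret D: prob_space ?D by (rule prob_space_exponential)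
  have d: "distributed ?D lborel (\<lambda>x. x) (exponential_density (r i))"
    unfolding distributed_def by (auto simp: distr_id2 exponential_density_def)
  show "measure ?D {..u} = 1 - exp (- u * r i)"
    using D.exponential_distributedD_le[OF d assms r_pos] by (simp add: atMost_def mult.commute)
  show "measure ?D {u<..} = exp (- u * r i)"
    using D.exponential_distributedD_gt[OF d assms r_pos] by (simp add: greaterThan_def mult.commute)
qed

lemma prod_prob_exponentials: "product_prob_space (\<lambda>(i, k :: nat). density lborel (exponential_density (r i)))"
  by (rule product_prob_spaceI) (auto split: prod.split intro: prob_space_exponential)

lemma prob_space_exponentials: "prob_space (exponentials r)"
  unfolding exponentials_def
  by (intro prob_space_PiM) (auto split: prod.split intro: prob_space_exponential)

lemma space_exponentials: "space (exponentials r) = UNIV"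
  unfolding exponentials_def by (auto simp: space_PiM)

lemma measure_exponentials:
  assumes "finite J" and "\<And>p. p \<in> J \<Longrightarrow> B p \<in> sets borel"
  shows "measure (exponentials r) {g. \<forall>p\<in>J. g p \<in> B p} =
    (\<Prod>p\<in>J. measure (density lborel (exponential_density (r (fst p)))) (B p))"
proof -
  interpret product_prob_space "\<lambda>(i, k :: nat). density lborel (exponential_density (r i))" UNIV
    by (rule prod_prob_exponentials)
  have "emeasure (exponentials r) {g \<in> space (exponentials r). \<forall>p\<in>J. g p \<in> B p} =
      (\<Prod>p\<in>J. emeasure (case p of (i, k) \<Rightarrow> density lborel (exponential_density (r i))) (B p))"
    unfolding exponentials_def using assms by (intro emeasure_PiM_Collect) (auto split: prod.split)
  also have "\<dots> = (\<Prod>p\<in>J. ennreal (measure (density lborel (exponential_density (r (fst p)))) (B p)))"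
  proof (intro prod.cong refl)
    fix p :: "'i \<times> nat"
    interpret prob_space "density lborel (exponential_density (r (fst p)))" by (rule prob_space_exponential)
    show "emeasure (case p of (i, k) \<Rightarrow> density lborel (exponential_density (r i))) (B p) =
        ennreal (measure (density lborel (exponential_density (r (fst p)))) (B p))"
      by (simp add: case_prod_unfold emeasure_eq_measure)
  qed
  finally show ?thesis
    by (simp add: measure_def[of "exponentials r"] space_exponentials prod_ennreal measure_nonneg prod_nonneg)
qed

lemma prob_clocks_late:
  assumes "finite J" and "0 \<le> u"
  shows "measure (exponentials r) {g. \<forall>p\<in>J. u < g p} = exp (- u * (\<Sum>p\<in>J. r (fst p)))"
proof -
  have "measure (exponentials r) {g. \<forall>p\<in>J. u < g p} = (\<Prod>p\<in>J. exp (- u * r (fst p)))"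
    using measure_exponentials[of J "\<lambda>_. {u<..}"] assms by (simp add: prob_exponential)
  then show ?thesis using assms by (simp add: exp_sum[symmetric] sum_distrib_left sum_negf)
qed

lemma prob_one_clock:
  assumes "finite J" "q \<notin> J" and "0 \<le> u"
  shows "measure (exponentials r) {g. g q \<le> u \<and> (\<forall>p\<in>J. u < g p)} =
    (1 - exp (- u * r (fst q))) * exp (- u * (\<Sum>p\<in>J. r (fst p)))"
proof -
  have "{g. g q \<le> u \<and> (\<forall>p\<in>J. u < g p)} = {g. \<forall>p\<in>insert q J. g p \<in> (if p = q then {..u} else {u<..})}"
    using assms by auto
  then have "measure (exponentials r) {g. g q \<le> u \<and> (\<forall>p\<in>J. u < g p)} =
      (1 - exp (- u * r (fst q))) * (\<Prod>p\<in>J. measure (density lborel (exponential_density (r (fst p)))) (if p = q then {..u} else {u<..}))"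
    using assms by (simp only:) (subst measure_exponentials, auto simp: prob_exponential)
  also have "(\<Prod>p\<in>J. measure (density lborel (exponential_density (r (fst p)))) (if p = q then {..u} else {u<..})) =
      (\<Prod>p\<in>J. exp (- u * r (fst p)))"
    using assms by (intro prod.cong) (auto simp: prob_exponential)
  finally show ?thesis using assms by (simp add: exp_sum[symmetric] sum_distrib_left sum_negf)
qed

lemma AE_regular: "AE g in exponentials r. regular g"
proof -
  interpret prob_space "exponentials r" by (rule prob_space_exponentials)
  have "AE g in exponentials r. 0 < g p" for p
  proof -
    have "measure (exponentials r) {g. \<forall>q\<in>{p}. g q \<in> {..0}} = 0"
      by (subst measure_exponentials) (auto simp: prob_exponential)
    moreover have "{g \<in> space (exponentials r). \<forall>q\<in>{p}. g q \<in> {..0}} \<in> events" by measurable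
    then have "{g. \<forall>q\<in>{p}. g q \<in> {..0}} \<in> events" by (simp only: space_exponentials) simp
    ultimately have "AE g in exponentials r. g \<notin> {g. \<forall>q\<in>{p}. g q \<in> {..0}}"
      by (intro prob_eq_0[THEN iffD1])
    then show ?thesis by (rule AE_mp) (auto intro!: AE_I2)
  qed
  then have pos: "AE g in exponentials r. \<forall>p. 0 < g p"
    unfolding AE_all_countable by blast
  \<comment> \<open>One gap above \<open>N\<close> yields an epoch above \<open>N\<close>; that none
    of the first \<open>k\<close> independent gaps exceeds \<open>N\<close> has a probability
    tending to 0.\<close>
  have "AE g in exponentials r. \<exists>j. real N < g (i, j)" for i N
  proof -
    define A where "A = {g :: 'i \<times> nat \<Rightarrow> real. \<forall>j. g (i, j) \<le> real N}"
    have A: "A \<in> events"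
    proof -
      have "{g \<in> space (exponentials r). \<forall>j. g (i, j) \<le> real N} \<in> events" by measurable
      then show ?thesis by (simp add: A_def space_exponentials)
    qed
    have "prob A \<le> (1 - exp (- real N * r i)) ^ k" for k
    proof -
      have sets: "{g. \<forall>p\<in>Pair i ` {..<k}. g p \<in> {..real N}} \<in> events"
      proof -
        have "{g \<in> space (exponentials r). \<forall>p\<in>Pair i ` {..<k}. g p \<in> {..real N}} \<in> events" by measurable
        then show ?thesis by (simp add: space_exponentials)
      qed
      have "prob A \<le> prob {g. \<forall>p\<in>Pair i ` {..<k}. g p \<in> {..real N}}"
        by (rule finite_measure_mono[OF _ sets]) (auto simp: A_def)
      also have "\<dots> = (1 - exp (- real N * r i)) ^ k"
        by (subst measure_exponentials) (auto simp: prob_exponential prod.reindex inj_on_def)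
      finally show ?thesis .
    qed
    moreover have "(\<lambda>k. (1 - exp (- real N * r i)) ^ k) \<longlonglongrightarrow> 0"
      using r_pos[of i] by (intro LIMSEQ_realpow_zero) auto
    ultimately have "prob A \<le> 0" by (intro LIMSEQ_le_const) auto
    then have "prob A = 0" using measure_nonneg[of "exponentials r" A] by linarith
    then have "AE g in exponentials r. g \<notin> A"
      using prob_eq_0[OF A] by blast
    then show ?thesis by (rule AE_mp) (auto simp: A_def not_le intro!: AE_I2)
  qed
  then have unbounded: "AE g in exponentials r. \<forall>i N. \<exists>j. real N < g (i, j)"
    unfolding AE_all_countable by blast
  show ?thesis using pos unbounded
  proof eventually_elim
    case (elim g)
    have "\<exists>k. t < epoch g i k" for i t
    proof -
      obtain N where "t < real N" using reals_Archimedean2 by blast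
      moreover obtain j where "real N < g (i, j)" using elim by blast
      moreover have "g (i, j) \<le> epoch g i j"
        unfolding epoch_def using elim by (intro member_le_sum) (auto intro: less_imp_le)
      ultimately show ?thesis by (intro exI[of _ j]) linarith
    qed
    then show ?case using elim by (simp add: regular_def)
  qed
qed

end

lemma AE_regular_pair:
  fixes lam :: "'c::finite \<Rightarrow> real" and mu :: "'s::finite \<Rightarrow> real"
  assumes "\<And>c. 0 < lam c" "\<And>s. 0 < mu s"
  shows "AE p in exponentials lam \<Otimes>\<^sub>M exponentials mu. regular (fst p) \<and> regular (snd p)"
proof -
  interpret A: prob_space "exponentials lam" by (rule prob_space_exponentials[OF assms(1)])
  interpret B: prob_space "exponentials mu" by (rule prob_space_exponentials[OF assms(2)])
  have fst: "distr (exponentials lam \<Otimes>\<^sub>M exponentials mu) (exponentials lam) fst = exponentials lam"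
    by (rule B.distr_pair_fst)
  have snd: "distr (exponentials lam \<Otimes>\<^sub>M exponentials mu) (exponentials mu) snd = exponentials mu"
  proof (rule measure_eqI)
    fix S assume "S \<in> sets (distr (exponentials lam \<Otimes>\<^sub>M exponentials mu) (exponentials mu) snd)"
    then have S: "S \<in> sets (exponentials mu)" by simp
    then have "snd -` S \<inter> space (exponentials lam \<Otimes>\<^sub>M exponentials mu) = space (exponentials lam) \<times> S"
      using sets.sets_into_space[OF S] by (auto simp: space_pair_measure)
    then show "emeasure (distr (exponentials lam \<Otimes>\<^sub>M exponentials mu) (exponentials mu) snd) S = emeasure (exponentials mu) S"
      using S by (simp add: emeasure_distr B.emeasure_pair_measure_Times A.emeasure_space_1)
  qed simp
  have "AE p in exponentials lam \<Otimes>\<^sub>M exponentials mu. regular (fst p)"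
    by (rule AE_distrD[OF measurable_fst]) (subst fst, rule AE_regular[OF assms(1)])
  moreover have "AE p in exponentials lam \<Otimes>\<^sub>M exponentials mu. regular (snd p)"
    by (rule AE_distrD[OF measurable_snd]) (subst snd, rule AE_regular[OF assms(2)])
  ultimately show ?thesis by eventually_elim simp
qed

section \<open>First-order estimates for scenarios of the clocks\<close>

lemma one_minus_exp_ge: "x * exp (- x) \<le> 1 - exp (- x)" for x :: real
proof -
  have "(1 + x) * exp (- x) \<le> exp x * exp (- x)"
    by (intro mult_right_mono exp_ge_add_one_self) simp
  then show ?thesis by (simp add: exp_minus algebra_simps)
qed

text \<open>\<open>r\<close> is the rate of the clock that rings, \<open>R\<close> the joint rate of
  the clocks kept silent, \<open>L\<close> the total rate. The lower bound
  \<open>u * r * (1 - u * (r + R))\<close> loses at most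
  \<open>u\<^sup>2 * L * (5 * L)\<close>.\<close>

lemma clock_prob_ge:
  fixes r R L u :: real
  assumes "0 \<le> r" "r \<le> L" "r + R \<le> 5 * L" "0 < u"
  shows "u * r - 5 * L\<^sup>2 * u\<^sup>2 \<le> (1 - exp (- u * r)) * exp (- u * R)"
proof -
  have "u * r * (1 - u * (5 * L)) \<le> u * r * (1 - u * (r + R))"
    using assms by (intro mult_left_mono) auto
  also have "\<dots> \<le> u * r * exp (- (u * (r + R)))"
    using assms exp_ge_add_one_self[of "- (u * (r + R))"] by (intro mult_left_mono) auto
  also have "\<dots> = u * r * exp (- (u * r)) * exp (- u * R)"
    by (simp add: exp_add[symmetric] algebra_simps)
  also have "\<dots> \<le> (1 - exp (- u * r)) * exp (- u * R)"
    using one_minus_exp_ge[of "u * r"] by (intro mult_right_mono) auto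
  finally have "u * r - 5 * (u\<^sup>2 * (r * L)) \<le> (1 - exp (- u * r)) * exp (- u * R)"
    by (simp add: algebra_simps power2_eq_square)
  moreover have "u\<^sup>2 * (r * L) \<le> u\<^sup>2 * (L * L)"
    using assms by (intro mult_left_mono mult_right_mono) auto
  ultimately show ?thesis by (simp add: power2_eq_square mult_ac)
qed

context parallel_fcfs
begin

text \<open>In state \<open>x\<close> the clock \<open>(s, first s)\<close> is
  the one which triggers the next service by \<open>s\<close>; \<open>guard e\<close> collects clocks which must not ring
  by time \<open>u\<close> so that \<open>e\<close> is the only event.\<close>

lemma transition_lower_bound:
  fixes x y :: "'c list" and u :: real and state :: "('c \<times> nat \<Rightarrow> real) \<Rightarrow> ('s \<times> nat \<Rightarrow> real) \<Rightarrow> 'c list"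
    and first :: "'s \<Rightarrow> nat" and guard :: "'c + 's \<Rightarrow> ('s \<times> nat) set"
  defines "busy \<equiv> \<Union>c\<in>set x. servers E c"
  assumes "0 < u"
    and state: "(\<lambda>(a, b). state a b) \<in> measurable (exponentials lam \<Otimes>\<^sub>M exponentials mu) (count_space UNIV)"
    and idle: "\<And>a b. \<lbrakk>regular a; regular b; \<And>c. u < a (c, 0); \<And>s. s \<in> busy \<Longrightarrow> u < b (s, first s)\<rbrakk>
        \<Longrightarrow> state a b = x"
    and arrival: "\<And>a b c. \<lbrakk>regular a; regular b; a (c, 0) \<le> u; u < a (c, 1); \<And>d. d \<noteq> c \<Longrightarrow> u < a (d, 0);
        \<And>q. q \<in> guard (Inl c) \<Longrightarrow> u < b q\<rbrakk> \<Longrightarrow> state a b = x @ [c]"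
    and service: "\<And>a b s. \<lbrakk>regular a; regular b; s \<in> busy; \<And>c. u < a (c, 0); b (s, first s) \<le> u;
        \<And>q. q \<in> guard (Inr s) \<Longrightarrow> u < b q\<rbrakk> \<Longrightarrow> state a b = serve E s x"
    and guard: "\<And>e. finite (guard e)" "\<And>e. (\<Sum>q\<in>guard e. mu (fst q)) \<le> 3 * sum mu UNIV"
      "\<And>s. (s, first s) \<notin> guard (Inr s)" "\<And>s s'. s' \<noteq> s \<Longrightarrow> (s', first s') \<in> guard (Inr s)"
  shows "step_bound (5 * total_rate\<^sup>2) x u y \<le> measure (exponentials lam \<Otimes>\<^sub>M exponentials mu)
        {(a, b) \<in> space (exponentials lam \<Otimes>\<^sub>M exponentials mu). state a b = y}"
proof -
  let ?A = "exponentials lam" and ?B = "exponentials mu"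
  interpret A: prob_space ?A by (rule prob_space_exponentials[OF lam_pos])
  interpret B: prob_space ?B by (rule prob_space_exponentials[OF mu_pos])
  interpret pair_prob_space ?A ?B ..
  have spaces: "space ?A = UNIV" "space ?B = UNIV"
    by (rule space_exponentials[OF lam_pos], rule space_exponentials[OF mu_pos])
  have "0 \<le> u" using \<open>0 < u\<close> by simp
  \<comment> \<open>Makes \<open>c\<close> the only arrival: as gaps are positive, a second gap
    above \<open>u\<close> already puts the second epoch of \<open>c\<close> beyond
    \<open>u\<close>.\<close>
  define others where "others c = insert (c, 1 :: nat) ((\<lambda>d. (d, 0)) ` (- {c}))" for c :: 'c
  define TA where "TA e = (case e of Some (Inl c) \<Rightarrow> {a. a (c, 0) \<le> u \<and> (\<forall>p\<in>others c. u < a p)}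
      | _ \<Rightarrow> {a. \<forall>p\<in>range (\<lambda>c. (c, 0 :: nat)). u < a p})" for e :: "('c + 's) option"
  define TB where "TB e = (case e of None \<Rightarrow> {b. \<forall>q\<in>(\<lambda>s. (s, first s)) ` busy. u < b q}
      | Some (Inl c) \<Rightarrow> {b. \<forall>q\<in>guard (Inl c). u < b q}
      | Some (Inr s) \<Rightarrow> {b. b (s, first s) \<le> u \<and> (\<forall>q\<in>guard (Inr s). u < b q)})" for e :: "('c + 's) option"
  define T where "T e = TA e \<times> TB e" for e
  have guard_fin: "countable (guard e)" for e using guard(1) by (rule countable_finite)
  have TA_sets: "TA e \<in> sets ?A" for e
  proof -
    have "{a \<in> space ?A. a \<in> TA e} \<in> sets ?A"
      unfolding TA_def others_def
      by (cases e rule: option.exhaust; (cases "the e")?) (simp_all, measurable)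
    then show ?thesis by (simp add: spaces)
  qed
  have TB_sets: "TB e \<in> sets ?B" for e
  proof -
    have "{b \<in> space ?B. b \<in> TB e} \<in> sets ?B"
      unfolding TB_def using guard_fin
      by (cases e rule: option.exhaust; (cases "the e")?) (simp_all, measurable)
    then show ?thesis by (simp add: spaces)
  qed
  have T_sets: "T e \<in> sets (?A \<Otimes>\<^sub>M ?B)" for e
    unfolding T_def by (intro pair_measureI TA_sets TB_sets)
  have prob_T: "prob (T e) = A.prob (TA e) * B.prob (TB e)" for e
    unfolding T_def measure_def by (simp add: B.emeasure_pair_measure_Times TA_sets TB_sets enn2real_mult)
  \<comment> \<open>Lets the probabilities of scenarios with the same final state add up. Scenarios
    with an arrival are separated from all others by the customer clocks, two services by their
    guards.\<close>
  have disjoint: "T e \<inter> T e' = {}" if "e \<noteq> e'" "e \<in> insert None (Some ` D)" "e' \<in> insert None (Some ` D)"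
    "D = range Inl \<union> Inr ` busy" for e e' D
  proof -
    have "TA (Some (Inl c)) \<inter> TA e = {}" if "e \<noteq> Some (Inl c)" for c e
      using that unfolding TA_def others_def by (auto split: option.splits sum.splits simp: not_le[symmetric])
    moreover have "TB (Some (Inr s)) \<inter> TB None = {}" if "s \<in> busy" for s
      using that unfolding TB_def by (auto simp: not_le[symmetric])
    moreover have "TB (Some (Inr s)) \<inter> TB (Some (Inr s')) = {}" if "s \<noteq> s'" for s s'
      using guard(4)[OF that] unfolding TB_def by (auto simp: not_le[symmetric])
    ultimately show ?thesis using that unfolding T_def by (auto simp: disjoint_iff) blast+
  qed
  define effective :: "('c + 's) set" where "effective = range Inl \<union> Inr ` busy"
  have mu_nonneg: "0 \<le> sum mu UNIV" and lam_nonneg: "0 \<le> sum lam UNIV"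
    by (auto intro: sum_nonneg less_imp_le[OF mu_pos] less_imp_le[OF lam_pos])
  have rate_le: "rate e \<le> total_rate" for e
    unfolding total_rate_def by (intro member_le_sum) (auto intro: less_imp_le[OF rate_pos])
  \<comment> \<open>Origin of the 5: \<open>rate e\<close> is at most \<open>total_rate\<close>, the
    customer clocks contribute \<open>sum lam UNIV\<close>, and a guard contributes at most three
    times \<open>sum mu UNIV\<close>.\<close>
  have exponent_le: "rate e + (sum lam UNIV + (\<Sum>q\<in>guard e. mu (fst q))) \<le> 5 * total_rate" for e
  proof -
    have "r + (L + G) \<le> 5 * (L + R)" if "G \<le> 3 * R" "r \<le> L + R" "0 \<le> R" "0 \<le> L" for r L G R :: real
      using that by simp
    then show ?thesis
      using guard(2)[of e] rate_le[of e] mu_nonneg lam_nonneg unfolding total_rate_eq by blast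
  qed
  have prob_event: "u * rate e - 5 * total_rate\<^sup>2 * u\<^sup>2 \<le> prob (T (Some e))" for e
  proof (cases e)
    case (Inl c)
    have sum_others: "(\<Sum>p\<in>others c. lam (fst p)) = sum lam UNIV"
      unfolding others_def by (subst sum.insert) (auto simp: sum.reindex inj_on_def sum.remove[of UNIV c] Compl_eq_Diff_UNIV)
    have "A.prob (TA (Some e)) = (1 - exp (- u * lam c)) * exp (- u * sum lam UNIV)"
    proof -
      have "finite (others c)" "(c, 0) \<notin> others c" by (auto simp: others_def)
      from prob_one_clock[where r=lam, OF lam_pos this \<open>0 \<le> u\<close>] show ?thesis
        unfolding sum_others TA_def Inl by simp
    qed
    moreover have "B.prob (TB (Some e)) = exp (- u * (\<Sum>q\<in>guard e. mu (fst q)))"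
      using prob_clocks_late[where r=mu, OF mu_pos guard(1) \<open>0 \<le> u\<close>, of e] by (simp add: TB_def Inl)
    ultimately have "prob (T (Some e)) = (1 - exp (- u * rate e)) *
        exp (- u * (sum lam UNIV + (\<Sum>q\<in>guard e. mu (fst q))))"
      by (simp only: prob_T Inl rate_def sum.case distrib_left exp_add mult_ac)
    moreover have "rate e + (sum lam UNIV + (\<Sum>q\<in>guard e. mu (fst q))) \<le> 5 * total_rate"
      by (rule exponent_le)
    ultimately show ?thesis
      using clock_prob_ge[OF less_imp_le[OF rate_pos] rate_le _ \<open>0 < u\<close>] by simp
  next
    case (Inr s)
    have "A.prob (TA (Some e)) = exp (- u * sum lam UNIV)"
      using prob_clocks_late[where r=lam, OF lam_pos _ \<open>0 \<le> u\<close>, of "range (\<lambda>c. (c, 0))"]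
      by (simp add: TA_def Inr sum.reindex inj_on_def)
    moreover have "B.prob (TB (Some e)) = (1 - exp (- u * mu s)) * exp (- u * (\<Sum>q\<in>guard e. mu (fst q)))"
      using prob_one_clock[where r=mu, OF mu_pos guard(1) guard(3)[of s] \<open>0 \<le> u\<close>] by (simp add: TB_def Inr)
    ultimately have "prob (T (Some e)) = (1 - exp (- u * rate e)) *
        exp (- u * (sum lam UNIV + (\<Sum>q\<in>guard e. mu (fst q))))"
      by (simp only: prob_T Inr rate_def sum.case distrib_left exp_add mult_ac)
    moreover have "rate e + (sum lam UNIV + (\<Sum>q\<in>guard e. mu (fst q))) \<le> 5 * total_rate"
      by (rule exponent_le)
    ultimately show ?thesis
      using clock_prob_ge[OF less_imp_le[OF rate_pos] rate_le _ \<open>0 < u\<close>] by simp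
  qed
  have prob_idle: "1 - u * (sum lam UNIV + (\<Sum>s\<in>busy. mu s)) \<le> prob (T None)"
  proof -
    have "A.prob (TA None) = exp (- u * sum lam UNIV)"
      using prob_clocks_late[where r=lam, OF lam_pos _ \<open>0 \<le> u\<close>, of "range (\<lambda>c. (c, 0))"]
      by (simp add: TA_def sum.reindex inj_on_def)
    moreover have "B.prob (TB None) = exp (- u * (\<Sum>s\<in>busy. mu s))"
      using prob_clocks_late[where r=mu, OF mu_pos _ \<open>0 \<le> u\<close>, of "(\<lambda>s. (s, first s)) ` busy"]
      by (simp add: TB_def sum.reindex inj_on_def)
    ultimately have "prob (T None) = exp (- u * (sum lam UNIV + (\<Sum>s\<in>busy. mu s)))"
      by (simp only: prob_T distrib_left exp_add)
    then show ?thesis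
      using exp_ge_add_one_self[of "- u * (sum lam UNIV + (\<Sum>s\<in>busy. mu s))"] by simp
  qed
  define I where "I = (if y = x then {None} else {}) \<union> Some ` {e \<in> effective. nxt E x e = y}"
  have I_fin: "finite I" by (simp add: I_def)
  have "step_bound (5 * total_rate\<^sup>2) x u y \<le> (\<Sum>i\<in>I. prob (T i))"
  proof -
    let ?g = "\<lambda>e. if nxt E x e = y then u * rate e - 5 * total_rate\<^sup>2 * u\<^sup>2 else 0"
    \<comment> \<open>\<open>T None\<close> silences only the busy servers and so leaves room for
      void services. In the bound these return to \<open>x\<close> and give back their part of the
      loss \<open>u * total_rate\<close>.\<close>
    have "nxt E x e = x" if "e \<in> - effective" for e
      using that by (cases e) (auto simp: effective_def nxt_def busy_def intro!: serve_idle)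
    then have "(\<Sum>e\<in>-effective. ?g e) \<le> (\<Sum>e\<in>-effective. if y = x then u * rate e else 0)"
      by (intro sum_mono) auto
    also have "\<dots> = (if y = x then u * (total_rate - (\<Sum>e\<in>effective. rate e)) else 0)"
    proof -
      have "total_rate = (\<Sum>e\<in>effective. rate e) + (\<Sum>e\<in>-effective. rate e)"
        unfolding total_rate_def by (subst sum.union_disjoint[symmetric]) auto
      then show ?thesis by (simp add: sum_distrib_left)
    qed
    also have "(\<Sum>e\<in>effective. rate e) = sum lam UNIV + (\<Sum>s\<in>busy. mu s)"
      unfolding effective_def by (subst sum.union_disjoint) (auto simp: sum.reindex rate_def)
    finally have ineffective: "(\<Sum>e\<in>-effective. ?g e) \<le>
        (if y = x then u * (total_rate - (sum lam UNIV + (\<Sum>s\<in>busy. mu s))) else 0)" .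
    have "(\<Sum>e\<in>effective. ?g e) = (\<Sum>e\<in>{e \<in> effective. nxt E x e = y}. u * rate e - 5 * total_rate\<^sup>2 * u\<^sup>2)"
      by (simp add: sum.inter_filter)
    also have "\<dots> \<le> (\<Sum>e\<in>{e \<in> effective. nxt E x e = y}. prob (T (Some e)))"
      by (intro sum_mono prob_event)
    finally have effective: "(\<Sum>e\<in>effective. ?g e) \<le> (\<Sum>e\<in>{e \<in> effective. nxt E x e = y}. prob (T (Some e)))" .
    have "(\<Sum>i\<in>I. prob (T i)) = (if y = x then prob (T None) else 0) + (\<Sum>e\<in>{e \<in> effective. nxt E x e = y}. prob (T (Some e)))"
      unfolding I_def by (subst sum.union_disjoint) (auto simp: sum.reindex)
    moreover have "(\<Sum>e\<in>UNIV. ?g e) = (\<Sum>e\<in>effective. ?g e) + (\<Sum>e\<in>-effective. ?g e)"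
      by (subst sum.union_disjoint[symmetric]) auto
    ultimately show ?thesis
      using ineffective effective prob_idle by (auto simp: algebra_simps split: if_splits)
  qed
  also have "\<dots> = prob (\<Union>i\<in>I. T i)"
  proof (rule finite_measure_finite_Union[symmetric])
    show "disjoint_family_on T I"
      unfolding disjoint_family_on_def
      using disjoint[of _ _ effective] by (auto simp: I_def effective_def split: if_splits)
  qed (use I_fin T_sets in auto)
  also have "\<dots> \<le> prob {(a, b) \<in> space (?A \<Otimes>\<^sub>M ?B). state a b = y}"
  proof (rule finite_measure_mono_AE)
    show "{(a, b) \<in> space (?A \<Otimes>\<^sub>M ?B). state a b = y} \<in> events"
      using measurable_sets[OF state, of "{y}"] by (simp add: vimage_def Int_def case_prod_unfold conj_commute)
    have "state a b = y" if reg: "regular a" "regular b" and T: "(a, b) \<in> T i" and "i \<in> I" for a b i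
    proof -
      consider "i = None" "y = x" | c where "i = Some (Inl c)" "y = x @ [c]" | s where "i = Some (Inr s)" "s \<in> busy" "y = serve E s x"
        using \<open>i \<in> I\<close> by (auto simp: I_def effective_def nxt_def split: if_splits)
      then show ?thesis
      proof cases
        case 1
        then show ?thesis using T reg by (auto simp: T_def TA_def TB_def intro!: idle)
      next
        case 2
        then show ?thesis using T reg by (auto simp: T_def TA_def TB_def others_def intro!: arrival)
      next
        case 3
        then show ?thesis using T reg by (auto simp: T_def TA_def TB_def intro!: service)
      qed
    qed
    note state_on_T = this
    show "AE p in ?A \<Otimes>\<^sub>M ?B. p \<in> (\<Union>i\<in>I. T i) \<longrightarrow> p \<in> {(a, b) \<in> space (?A \<Otimes>\<^sub>M ?B). state a b = y}"
      using AE_regular_pair[OF lam_pos mu_pos]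
      by eventually_elim (auto simp: space_pair_measure spaces intro: state_on_T)
  qed
  finally show ?thesis .
qed

end

section \<open>The queues up to their first event\<close>

lemma regular_pos: "regular g \<Longrightarrow> 0 < g p"
  unfolding regular_def by blast

lemma epoch_0 [simp]: "epoch g i 0 = g (i, 0)"
  by (simp add: epoch_def)

lemma epoch_Suc [simp]: "epoch g i (Suc k) = epoch g i k + g (i, Suc k)"
  by (simp add: epoch_def)

lemma epoch_mono: "regular g \<Longrightarrow> j \<le> k \<Longrightarrow> epoch g i j \<le> epoch g i k"
  by (rule lift_Suc_mono_le[of "epoch g i"]) (auto intro: less_imp_le regular_pos)

lemma epoch_unbounded: "regular g \<Longrightarrow> \<exists>k. t < epoch g i k"
  by (simp add: regular_def)

text \<open>With no epoch strictly between \<open>t\<close> and \<open>d\<close>, any epoch strictly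
  later than an arrival at or after \<open>t\<close> is at least \<open>d\<close>. A nonstrict bound
  of this kind passes to the infimum defining the next arrival.\<close>

lemma arrival_time_later:
  fixes a :: "'c::finite \<times> nat \<Rightarrow> real"
  assumes a: "regular a" and gap: "\<And>c k. epoch a c k \<le> t \<or> d \<le> epoch a c k"
    and n: "t \<le> arrival_time a n" "n < m" and "t \<le> d"
  shows "d \<le> arrival_time a m"
  using n(2)
proof (induction m)
  case (Suc m)
  have "t \<le> arrival_time a m"
    using Suc n(1) \<open>t \<le> d\<close> by (cases "m = n") auto
  obtain c :: 'c where True by blast
  obtain k where "arrival_time a m < epoch a c k" using epoch_unbounded[OF a] by blast
  then have "{epoch a c k | c k. arrival_time a m < epoch a c k} \<noteq> {}" by blast
  then show ?case unfolding arrival_time.simps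
  proof (rule cInf_greatest)
    fix e assume "e \<in> {epoch a c k | c k. arrival_time a m < epoch a c k}"
    then obtain c k where e: "e = epoch a c k" "arrival_time a m < epoch a c k" by blast
    then show "d \<le> e" using gap[of c k] \<open>t \<le> arrival_time a m\<close> by linarith
  qed
qed simp

lemma no_arrival:
  fixes a :: "'c::finite \<times> nat \<Rightarrow> real"
  assumes a: "regular a" and late: "\<And>c. u < a (c, 0)"
  shows "u < arrival_time a n"
proof -
  \<comment> \<open>A strict inequality with \<open>u\<close> could be lost in an infimum; the
    margin between \<open>u\<close> and \<open>d\<close> preserves it.\<close>
  define d where "d = Min (range (\<lambda>c. a (c, 0)))"
  have d: "u < d" "\<And>c. d \<le> a (c, 0)" using late by (auto simp: d_def)
  have gap: "d \<le> epoch a c k" for c k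
    using epoch_mono[OF a, of 0 k c] d(2)[of c] by simp
  have "d \<le> arrival_time a 0"
    unfolding arrival_time.simps by (rule cInf_greatest) (auto intro: gap)
  moreover have "d \<le> arrival_time a n" if "0 < n"
    using \<open>d \<le> arrival_time a 0\<close> that gap by (intro arrival_time_later[OF a, of d d 0 n]) auto
  ultimately show ?thesis using d(1) by (cases "n = 0") auto
qed

lemma one_arrival:
  fixes a :: "'c::finite \<times> nat \<Rightarrow> real"
  assumes a: "regular a" and c: "a (c, 0) \<le> u" "u < a (c, 1)" "\<And>d. d \<noteq> c \<Longrightarrow> u < a (d, 0)"
  shows "arrival_time a 0 = a (c, 0)" and "arrival_type a 0 = c" and "0 < n \<Longrightarrow> u < arrival_time a n"
proof -
  \<comment> \<open>The earliest epoch other than the first one of \<open>c\<close>; being a minimum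
    over finitely many candidates, it still exceeds \<open>u\<close>.\<close>
  define d where "d = Min (insert (a (c, 0) + a (c, 1)) ((\<lambda>d. a (d, 0)) ` (- {c})))"
  have d: "u < d" "d \<le> a (c, 0) + a (c, 1)" "\<And>c'. c' \<noteq> c \<Longrightarrow> d \<le> a (c', 0)"
    using c regular_pos[OF a, of "(c, 0)"] by (auto simp: d_def add_pos_pos less_le_trans)
  have gap: "d \<le> epoch a c' k" if "(c', k) \<noteq> (c, 0)" for c' k
  proof (cases "c' = c")
    case True
    then have "epoch a c 1 \<le> epoch a c k" using that by (intro epoch_mono[OF a]) auto
    then show ?thesis using d(2) True by simp
  next
    case False
    then show ?thesis using epoch_mono[OF a, of 0 k c'] d(3)[of c'] by simp
  qed
  have zero: "a (c, 0) \<le> epoch a c' k" for c' k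
    using gap[of c' k] c(1) d(1) by (cases "(c', k) = (c, 0)") auto
  show time: "arrival_time a 0 = a (c, 0)"
  proof -
    have "a (c, 0) = epoch a c 0" by simp
    then have "a (c, 0) \<in> {epoch a c k | c k. True}" by blast
    then show ?thesis
      unfolding arrival_time.simps by (rule cInf_eq_minimum) (auto intro: zero)
  qed
  show "arrival_type a 0 = c"
    unfolding arrival_type_def time
  proof (rule some_equality)
    show "\<exists>k. epoch a c k = a (c, 0)" by (rule exI[of _ 0]) simp
    fix c' assume "\<exists>k. epoch a c' k = a (c, 0)"
    then obtain k where "epoch a c' k = a (c, 0)" by blast
    then show "c' = c" using gap[of c' k] c(1) d(1) by auto
  qed
  show "u < arrival_time a n" if "0 < n"
  proof -
    have "epoch a c' k \<le> a (c, 0) \<or> d \<le> epoch a c' k" for c' k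
      using gap[of c' k] by (cases "(c', k) = (c, 0)") auto
    then have "d \<le> arrival_time a n"
      using that c(1) d(1) time by (intro arrival_time_later[OF a, of "a (c, 0)" d 0 n]) auto
    then show ?thesis using d(1) by simp
  qed
qed

section \<open>The list of customers after at most one event\<close>

lemma map_nth_remove:
  assumes "k < length x" and ty: "\<And>n. n < length x \<Longrightarrow> ty n = x ! n"
  shows "map ty (sorted_list_of_set ({..<length x} - {k})) = take k x @ drop (Suc k) x"
proof -
  have eq: "sorted_list_of_set ({..<length x} - {k}) = [0..<k] @ [Suc k..<length x]"
    by (rule sorted_distinct_set_unique) (use assms in \<open>auto simp: sorted_append\<close>)
  show ?thesis unfolding eq
    by (rule nth_equalityI) (use assms in \<open>auto simp: nth_append\<close>)
qed

lemma content_unchanged: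
  assumes "0 < u" "\<And>n. u < arrival_time a n" "\<And>n. n < length x \<Longrightarrow> u < dep n"
  shows "content (cust_time x a) (cust_type x a) dep u = x"
proof -
  have "\<not> arrival_time a n \<le> u" for n using assms(2)[of n] by simp
  then have "{n. cust_time x a n \<le> u \<and> u < dep n} = {..<length x}"
    using assms(1,3) by (auto simp: cust_time_def split: if_splits)
  moreover have "sorted_list_of_set {..<length x} = [0..<length x]"
    by (simp add: lessThan_atLeast0)
  moreover have "map (cust_type x a) [0..<length x] = x"
    by (rule nth_equalityI) (auto simp: cust_type_def)
  ultimately show ?thesis unfolding content_def by simp
qed

lemma content_served:
  assumes "0 < u" "\<And>n. u < arrival_time a n" "k < length x" "dep k \<le> u"
    "\<And>n. n < length x \<Longrightarrow> n \<noteq> k \<Longrightarrow> u < dep n"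
  shows "content (cust_time x a) (cust_type x a) dep u = take k x @ drop (Suc k) x"
proof -
  have "\<not> arrival_time a n \<le> u" for n using assms(2)[of n] by simp
  then have "{n. cust_time x a n \<le> u \<and> u < dep n} = {..<length x} - {k}"
    using assms(1,3-5) by (auto simp: cust_time_def split: if_splits)
  then show ?thesis
    unfolding content_def using assms(3) by (simp only:) (rule map_nth_remove, auto simp: cust_type_def)
qed

lemma content_arrival:
  assumes "0 < u" "arrival_time a 0 \<le> u" "arrival_type a 0 = c" "\<And>n. 0 < n \<Longrightarrow> u < arrival_time a n"
    "\<And>n. n \<le> length x \<Longrightarrow> u < dep n"
  shows "content (cust_time x a) (cust_type x a) dep u = x @ [c]"
proof -
  have "{n. cust_time x a n \<le> u \<and> u < dep n} = {..<Suc (length x)}"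
  proof (intro set_eqI iffI)
    fix n assume "n \<in> {n. cust_time x a n \<le> u \<and> u < dep n}"
    then have "cust_time x a n \<le> u" by simp
    then show "n \<in> {..<Suc (length x)}"
      using assms(4)[of "n - length x"]
      by (cases "n < length x"; cases "n = length x") (auto simp: cust_time_def)
  next
    fix n assume "n \<in> {..<Suc (length x)}"
    then show "n \<in> {n. cust_time x a n \<le> u \<and> u < dep n}"
      using assms by (auto simp: cust_time_def less_Suc_eq_le)
  qed
  moreover have "sorted_list_of_set {..<Suc (length x)} = [0..<Suc (length x)]"
    by (simp only: lessThan_atLeast0 sorted_list_of_set_range)
  moreover have "map (cust_type x a) [0..<Suc (length x)] = x @ [c]"
    by (rule nth_equalityI) (auto simp: cust_type_def nth_append assms(3) simp del: upt_Suc)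
  ultimately show ?thesis unfolding content_def by simp
qed

text \<open>With customer \<open>k\<close> gone, the first one whom \<open>s\<close> can serve, in
  the numbering of \<open>x\<close>; for \<open>k < length x\<close> the default is
  \<open>length x\<close>. Service times are numbered by customers in the redundancy queue, so this
  locates the next clock of \<open>s\<close>.\<close>

definition first_ix_without :: "('s \<times> 'c) set \<Rightarrow> nat \<Rightarrow> 's \<Rightarrow> 'c list \<Rightarrow> nat" where
  "first_ix_without E k s x = (LEAST n. n \<noteq> k \<and> (n < length x \<longrightarrow> s \<in> servers E (x ! n)))"

lemma first_ix_without:
  assumes "k < length x"
  shows "first_ix_without E k s x \<noteq> k"
    and "first_ix_without E k s x < length x \<Longrightarrow> s \<in> servers E (x ! first_ix_without E k s x)"
    and "n < first_ix_without E k s x \<Longrightarrow> n \<noteq> k \<Longrightarrow> n < length x \<Longrightarrow> s \<notin> servers E (x ! n)"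
proof -
  let ?P = "\<lambda>n. n \<noteq> k \<and> (n < length x \<longrightarrow> s \<in> servers E (x ! n))"
  have "?P (length x)" using assms by simp
  then have "?P (first_ix_without E k s x)"
    unfolding first_ix_without_def by (rule LeastI)
  then show "first_ix_without E k s x \<noteq> k"
    and "first_ix_without E k s x < length x \<Longrightarrow> s \<in> servers E (x ! first_ix_without E k s x)" by auto
  show "s \<notin> servers E (x ! n)" if "n < first_ix_without E k s x" "n \<noteq> k" "n < length x"
  proof -
    have "\<not> ?P n" using that(1) unfolding first_ix_without_def by (rule not_less_Least)
    then show ?thesis using that by simp
  qed
qed

lemma first_ix_in: "first_ix E s x < length x \<Longrightarrow> s \<in> servers E (x ! first_ix E s x)"
  unfolding first_ix_def using nth_length_takeWhile[of "\<lambda>d. s \<notin> servers E d" x] by blast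

lemma before_first_ix:
  assumes "n < first_ix E s x" shows "s \<notin> servers E (x ! n)"
proof -
  let ?t = "takeWhile (\<lambda>d. s \<notin> servers E d) x"
  have n: "n < length ?t" using assms by (simp add: first_ix_def)
  then have "s \<notin> servers E (?t ! n)" using set_takeWhileD[OF nth_mem[OF n]] by blast
  then show ?thesis by (simp add: takeWhile_nth[OF n])
qed

lemma first_ix_le_member:
  assumes "n < length x" "s \<in> servers E (x ! n)" shows "first_ix E s x \<le> n"
  using before_first_ix[of n E s x] assms by (meson not_le)

text \<open>A customer who has to wait at \<open>s\<close> for an earlier one departs later than that one, so that
  only the first clock of every server matters.\<close>

lemma redundancy_dep_late:
  fixes E :: "('s::finite \<times> 'c) set"
  assumes b: "\<And>p. 0 < b p" and "0 \<le> u" and ar: "\<And>m. m \<le> n \<Longrightarrow> 0 \<le> ar m"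
    and "servers E (ty n) \<noteq> {}"
    and late: "\<And>s. s \<in> servers E (ty n) \<Longrightarrow>
       u < b (s, n) \<or> (\<exists>m<n. s \<in> servers E (ty m) \<and> u < redundancy_dep E ar ty b m)"
  shows "u < redundancy_dep E ar ty b n"
proof -
  let ?start = "\<lambda>s. Max (insert (ar n) ((\<lambda>m. redundancy_dep E ar ty b m) ` {m. m < n \<and> s \<in> servers E (ty m)}))"
  have "u < ?start s + b (s, n)" if s: "s \<in> servers E (ty n)" for s
  proof -
    have "0 \<le> ?start s" using ar[of n] by (intro order_trans[OF _ Max_ge]) auto
    have max: "redundancy_dep E ar ty b m \<le> ?start s" if "m < n" "s \<in> servers E (ty m)" for m
      using that by (intro Max_ge) auto
    from late[OF s] show ?thesis
    proof (elim disjE exE conjE)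
      fix m assume "m < n" "s \<in> servers E (ty m)" "u < redundancy_dep E ar ty b m"
      then show ?thesis using max[of m] b[of "(s, n)"] by linarith
    qed (use \<open>0 \<le> ?start s\<close> in linarith)
  qed
  then show ?thesis
    using \<open>servers E (ty n) \<noteq> {}\<close> by (subst redundancy_dep.simps) (subst Min_gr_iff, auto)
qed

lemma redundancy_dep_first:
  fixes E :: "('s::finite \<times> 'c) set"
  assumes "s \<in> servers E (ty n)" "\<And>m. m < n \<Longrightarrow> s \<notin> servers E (ty m)"
  shows "redundancy_dep E ar ty b n \<le> ar n + b (s, n)"
proof -
  let ?start = "\<lambda>s. Max (insert (ar n) ((\<lambda>m. redundancy_dep E ar ty b m) ` {m. m < n \<and> s \<in> servers E (ty m)}))"
  have "redundancy_dep E ar ty b n \<le> ?start s + b (s, n)"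
    using assms(1) by (subst redundancy_dep.simps) (rule Min_le, auto)
  moreover have "{m. m < n \<and> s \<in> servers E (ty m)} = {}" using assms(2) by auto
  ultimately show ?thesis by simp
qed

section \<open>First-order lower bounds for the redundancy queue, then for the matching
  queue\<close>

context parallel_fcfs
begin

lemma servers_nonempty: "servers E c \<noteq> {}"
  using capacity_pos[of "{c}"] by (auto simp: capacity_def)

lemma redundancy_trans_ge:
  assumes "0 < u"
  shows "step_bound (5 * total_rate\<^sup>2) x u y \<le> redundancy_trans E lam mu x u y"
proof -
  define first where "first s = first_ix E s x" for s
  \<comment> \<open>Clocks are numbered by customers here. A server idle in \<open>x\<close> has
    \<open>first s = length x\<close>, the number of the arriving customer, so its first clock
    matters for an arrival. After a service the servers turn to their first customer among the
    remaining ones, whose clock must stay silent too.\<close>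
  define guard :: "'c + 's \<Rightarrow> ('s \<times> nat) set" where
    "guard e = (case e of Inl c \<Rightarrow> range (\<lambda>s. (s, first s))
      | Inr s \<Rightarrow> (\<lambda>s'. (s', first s')) ` (- {s}) \<union>
          (if first s < length x then range (\<lambda>s'. (s', first_ix_without E (first s) s' x)) else {}))" for e
  have "0 \<le> u" using \<open>0 < u\<close> by simp
  show ?thesis
    unfolding redundancy_trans_def
  proof (rule transition_lower_bound[where guard=guard and first=first])
    fix a :: "'c \<times> nat \<Rightarrow> real" and b :: "'s \<times> nat \<Rightarrow> real"
    assume a: "regular a" and b: "regular b"
    let ?ar = "cust_time x a" and ?ty = "cust_type x a"
    let ?dep = "redundancy_dep E ?ar ?ty b"
    have ty: "?ty n = x ! n" if "n < length x" for n using that by (simp add: cust_type_def)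
    have b_pos: "0 < b p" for p using b by (rule regular_pos)
    have dep_late: "u < ?dep n"
      if "n \<le> length x" "\<And>m. m \<le> n \<Longrightarrow> 0 \<le> ?ar m"
        "\<And>m s. m \<le> n \<Longrightarrow> s \<in> servers E (?ty m) \<Longrightarrow> u < b (s, first s)" for n
      using that
    proof (induction n rule: less_induct)
      case (less n)
      show ?case
      proof (rule redundancy_dep_late)
        fix s assume s: "s \<in> servers E (?ty n)"
        have "first s \<le> n"
        proof (cases "n = length x")
          case True then show ?thesis by (simp add: first_def first_ix_le)
        next
          case False
          then show ?thesis using s less.prems(1) unfolding first_def
            by (intro first_ix_le_member) (auto simp: ty)
        qed
        moreover have "s \<in> servers E (?ty (first s)) \<and> u < ?dep (first s)" if "first s < n"
        proof -
          have "first s < length x" using that less.prems(1) by simp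
          then have "s \<in> servers E (?ty (first s))"
            using first_ix_in[of E s x] ty[of "first s"] by (simp add: first_def)
          moreover have "u < ?dep (first s)"
          proof (rule less.IH[OF that])
            show "first s \<le> length x" by (simp add: first_def first_ix_le)
            show "0 \<le> ?ar m" if "m \<le> first s" for m
              using that \<open>first s < n\<close> by (intro less.prems(2)) simp
            show "u < b (s', first s')" if "m \<le> first s" "s' \<in> servers E (?ty m)" for m s'
              using that \<open>first s < n\<close> by (intro less.prems(3)[of m]) simp_all
          qed
          ultimately show ?thesis ..
        qed
        ultimately show "u < b (s, n) \<or> (\<exists>m<n. s \<in> servers E (?ty m) \<and> u < ?dep m)"
          using less.prems(3)[of n s] s by (cases "first s = n") auto
      qed (use b_pos \<open>0 \<le> u\<close> servers_nonempty less.prems in auto)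
    qed
    {
      assume late: "\<And>c. u < a (c, 0)" "\<And>s. s \<in> (\<Union>c\<in>set x. servers E c) \<Longrightarrow> u < b (s, first s)"
      have "u < ?dep n" if n: "n < length x" for n
      proof (rule dep_late)
        fix m s assume m: "m \<le> n" and s: "s \<in> servers E (?ty m)"
        have "m < length x" using m n by simp
        then have "s \<in> (\<Union>c\<in>set x. servers E c)" using s nth_mem[of m x] by (auto simp: ty)
        then show "u < b (s, first s)" by (rule late(2))
      qed (use n in \<open>auto simp: cust_time_def\<close>)
      then show "redundancy_state E x a b u = x"
        unfolding redundancy_state_def using \<open>0 < u\<close> no_arrival[OF a late(1)] by (intro content_unchanged)
    next
      fix c assume c: "a (c, 0) \<le> u" "u < a (c, 1)" "\<And>d. d \<noteq> c \<Longrightarrow> u < a (d, 0)"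
        and "\<And>q. q \<in> guard (Inl c) \<Longrightarrow> u < b q"
      then have late: "u < b (s, first s)" for s by (auto simp: guard_def)
      note arr = one_arrival[OF a c]
      have "0 \<le> ?ar n" if "n \<le> length x" for n
        using that arr(1) regular_pos[OF a, of "(c, 0)"] by (auto simp: cust_time_def)
      then have "u < ?dep n" if "n \<le> length x" for n
        using that late by (intro dep_late) auto
      then show "redundancy_state E x a b u = x @ [c]"
        unfolding redundancy_state_def using \<open>0 < u\<close> arr c(1) by (intro content_arrival) auto
    next
      fix s assume s: "s \<in> (\<Union>c\<in>set x. servers E c)" and late: "\<And>c. u < a (c, 0)"
        and ring: "b (s, first s) \<le> u" and guard: "\<And>q. q \<in> guard (Inr s) \<Longrightarrow> u < b q"
      define k where "k = first s"
      have k: "k < length x" using s first_ix_less_iff[of E s x] by (simp add: k_def first_def)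
      have next_late: "u < b (s', first_ix_without E k s' x)" for s'
        using guard k by (auto simp: guard_def k_def)
      have "?dep k \<le> ?ar k + b (s, k)"
        using k first_ix_in[of E s x] before_first_ix[of _ E s x]
        by (intro redundancy_dep_first) (auto simp: ty k_def first_def)
      then have "?dep k \<le> u" using k ring by (simp add: cust_time_def k_def)
      \<comment> \<open>Waiting for \<open>k\<close> can only delay a copy. At each of its servers,
        customer \<open>n\<close> is therefore held up by its own silent clock or by an earlier
        customer other than \<open>k\<close>, who is late by induction.\<close>
      moreover have "u < ?dep n" if "n < length x" "n \<noteq> k" for n
        using that
      proof (induction n rule: less_induct)
        case (less n)
        show ?case
        proof (rule redundancy_dep_late)
          fix s' assume s': "s' \<in> servers E (?ty n)"
          define m where "m = first_ix_without E k s' x"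
          have "m \<le> n"
            using first_ix_without(3)[OF k, of n E s'] s' less.prems unfolding m_def
            by (simp add: ty) (meson not_le)
          moreover have "m \<noteq> k" unfolding m_def by (rule first_ix_without(1)[OF k])
          moreover have "s' \<in> servers E (?ty m)" if "m < n"
          proof -
            have "m < length x" using that less.prems by simp
            then show ?thesis
              using first_ix_without(2)[OF k, of E s'] ty[of m] by (simp add: m_def)
          qed
          ultimately show "u < b (s', n) \<or> (\<exists>m<n. s' \<in> servers E (?ty m) \<and> u < ?dep m)"
            using less.IH[of m] less.prems next_late[of s'] unfolding m_def[symmetric]
            by (cases "m = n") auto
        qed (use b_pos \<open>0 \<le> u\<close> servers_nonempty less.prems in \<open>auto simp: cust_time_def\<close>)
      qed
      ultimately show "redundancy_state E x a b u = serve E s x"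
        unfolding redundancy_state_def serve_def using \<open>0 < u\<close> no_arrival[OF a late] k
        by (subst content_served[where k=k]) (auto simp: k_def first_def)
    }
  next
    fix e :: "'c + 's"
    show "finite (guard e)" by (auto simp: guard_def split: sum.split)
    have sum_range: "(\<Sum>q\<in>(\<lambda>s. (s, h s)) ` S. mu (fst q)) \<le> sum mu UNIV" for S and h :: "'s \<Rightarrow> nat"
      by (subst sum.reindex) (auto simp: inj_on_def intro!: sum_mono2 less_imp_le[OF mu_pos])
    have un: "(\<Sum>q\<in>A \<union> B. mu (fst q)) \<le> (\<Sum>q\<in>A. mu (fst q)) + (\<Sum>q\<in>B. mu (fst q))"
      if "finite A" "finite B" for A B :: "('s \<times> nat) set"
      using that by (subst sum_Un) (auto intro!: sum_nonneg less_imp_le[OF mu_pos])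
    have mu_nonneg: "0 \<le> sum mu UNIV" by (intro sum_nonneg less_imp_le[OF mu_pos])
    show "(\<Sum>q\<in>guard e. mu (fst q)) \<le> 3 * sum mu UNIV"
    proof (cases e)
      case (Inl c)
      then show ?thesis using sum_range[of first UNIV] mu_nonneg by (simp add: guard_def)
    next
      case (Inr s)
      define A where "A = (\<lambda>s'. (s', first s')) ` (- {s})"
      define B where "B = (if first s < length x then range (\<lambda>s'. (s', first_ix_without E (first s) s' x)) else {})"
      have "(\<Sum>q\<in>B. mu (fst q)) \<le> sum mu UNIV"
        using sum_range[of "\<lambda>s'. first_ix_without E (first s) s' x" UNIV] mu_nonneg by (simp add: B_def)
      moreover have "(\<Sum>q\<in>A. mu (fst q)) \<le> sum mu UNIV"
        unfolding A_def by (rule sum_range)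
      moreover have "(\<Sum>q\<in>guard e. mu (fst q)) \<le> (\<Sum>q\<in>A. mu (fst q)) + (\<Sum>q\<in>B. mu (fst q))"
      proof -
        have "guard e = A \<union> B" by (simp add: guard_def Inr A_def B_def)
        then show ?thesis by (simp only:) (rule un, auto simp: A_def B_def)
      qed
      ultimately show ?thesis using mu_nonneg by linarith
    qed
    fix s s' :: 's
    show "(s, first s) \<notin> guard (Inr s)"
      using first_ix_without(1)[of "first s" x E s] by (auto simp: guard_def)
    show "(s', first s') \<in> guard (Inr s)" if "s' \<noteq> s"
      using that by (auto simp: guard_def)
  qed (use \<open>0 < u\<close> measurable_redundancy_state in auto)
qed

lemma matching_dep_ge:
  assumes v: "regular v" and "servers E (ty n) \<noteq> {}"
    and bound: "\<And>s k. \<lbrakk>s \<in> servers E (ty n); ar n < epoch v s k;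
        \<And>m. m < n \<Longrightarrow> s \<in> servers E (ty m) \<Longrightarrow> matching_dep E ar ty v m < epoch v s k\<rbrakk> \<Longrightarrow> d \<le> epoch v s k"
  shows "d \<le> matching_dep E ar ty v n"
proof -
  let ?S = "{epoch v s k | s k. s \<in> servers E (ty n) \<and> ar n < epoch v s k \<and>
            (\<forall>m\<in>{..<n}. s \<in> servers E (ty m) \<longrightarrow> matching_dep E ar ty v m < epoch v s k)}"
  obtain s where s: "s \<in> servers E (ty n)" using assms(2) by blast
  \<comment> \<open>A server arriving after \<open>t\<close> meets all conditions of the infimum,
    which is thus taken over a nonempty set.\<close>
  define t where "t = Max (insert (ar n) (matching_dep E ar ty v ` {..<n}))"
  have t: "ar n \<le> t" "\<And>m. m < n \<Longrightarrow> matching_dep E ar ty v m \<le> t" by (auto simp: t_def)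
  obtain k where k: "t < epoch v s k" using epoch_unbounded[OF v] by blast
  have "epoch v s k \<in> ?S"
    using s t k by (auto intro!: exI[of _ s] exI[of _ k] intro: le_less_trans)
  then have "d \<le> Inf ?S"
    using bound by (intro cInf_greatest) auto
  then show ?thesis by (subst matching_dep.simps)
qed

lemma matching_dep_late:
  fixes v :: "'s \<times> nat \<Rightarrow> real"
  assumes v: "regular v" and late: "\<And>s. s \<in> servers E (ty n) \<Longrightarrow> u < v (s, 0)"
  shows "u < matching_dep E ar ty v n"
proof -
  define d where "d = Min ((\<lambda>s. v (s, 0)) ` servers E (ty n))"
  have d: "u < d" "\<And>s. s \<in> servers E (ty n) \<Longrightarrow> d \<le> v (s, 0)"
    using late servers_nonempty by (auto simp: d_def)
  have "d \<le> matching_dep E ar ty v n"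
  proof (rule matching_dep_ge[OF v servers_nonempty])
    fix s k assume "s \<in> servers E (ty n)"
    then show "d \<le> epoch v s k" using d(2)[of s] epoch_mono[OF v, of 0 k s] by simp
  qed
  then show ?thesis using d(1) by simp
qed

lemma matching_trans_ge:
  assumes "0 < u"
  shows "step_bound (5 * total_rate\<^sup>2) x u y \<le> matching_trans E lam mu x u y"
proof -
  \<comment> \<open>Clocks are numbered by server arrivals here, so the first one has number 0 in
    every state; after a service by \<open>s\<close>, its second gap must outlast
    \<open>u\<close>.\<close>
  define guard :: "'c + 's \<Rightarrow> ('s \<times> nat) set" where
    "guard e = (case e of Inl c \<Rightarrow> range (\<lambda>s. (s, 0))
      | Inr s \<Rightarrow> insert (s, 1) ((\<lambda>s'. (s', 0)) ` (- {s})))" for e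
  show ?thesis
    unfolding matching_trans_def
  proof (rule transition_lower_bound[where guard=guard and first="\<lambda>_. 0"])
    fix a :: "'c \<times> nat \<Rightarrow> real" and v :: "'s \<times> nat \<Rightarrow> real"
    assume a: "regular a" and v: "regular v"
    let ?ar = "cust_time x a" and ?ty = "cust_type x a"
    let ?dep = "matching_dep E ?ar ?ty v"
    have ty: "?ty n = x ! n" if "n < length x" for n using that by (simp add: cust_type_def)
    {
      assume late: "\<And>c. u < a (c, 0)" "\<And>s. s \<in> (\<Union>c\<in>set x. servers E c) \<Longrightarrow> u < v (s, 0)"
      have "u < ?dep n" if "n < length x" for n
      proof (rule matching_dep_late[OF v])
        fix s assume "s \<in> servers E (?ty n)"
        then have "s \<in> (\<Union>c\<in>set x. servers E c)" using nth_mem[OF that] by (auto simp: ty[OF that])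
        then show "u < v (s, 0)" by (rule late(2))
      qed
      then show "matching_state E x a v u = x"
        unfolding matching_state_def using \<open>0 < u\<close> no_arrival[OF a late(1)] by (intro content_unchanged)
    next
      fix c assume c: "a (c, 0) \<le> u" "u < a (c, 1)" "\<And>d. d \<noteq> c \<Longrightarrow> u < a (d, 0)"
        and "\<And>q. q \<in> guard (Inl c) \<Longrightarrow> u < v q"
      then have late: "u < v (s, 0)" for s by (auto simp: guard_def)
      note arr = one_arrival[OF a c]
      have "u < ?dep n" for n by (rule matching_dep_late[OF v late])
      then show "matching_state E x a v u = x @ [c]"
        unfolding matching_state_def using \<open>0 < u\<close> arr c(1) by (intro content_arrival) auto
    next
      fix s assume s: "s \<in> (\<Union>c\<in>set x. servers E c)" and late: "\<And>c. u < a (c, 0)"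
        and ring: "v (s, 0) \<le> u" and guard: "\<And>q. q \<in> guard (Inr s) \<Longrightarrow> u < v q"
      define k where "k = first_ix E s x"
      have k: "k < length x" using s first_ix_less_iff[of E s x] by (simp add: k_def)
      have v1: "u < v (s, 1)" and v0: "\<And>s'. s' \<noteq> s \<Longrightarrow> u < v (s', 0)"
        using guard by (auto simp: guard_def)
      define d where "d = Min (insert (v (s, 0) + v (s, 1)) ((\<lambda>s'. v (s', 0)) ` (- {s})))"
      have d: "u < d" "d \<le> v (s, 0) + v (s, 1)" "\<And>s'. s' \<noteq> s \<Longrightarrow> d \<le> v (s', 0)"
        using v1 v0 regular_pos[OF v, of "(s, 0)"] by (auto simp: d_def)
      have gap: "d \<le> epoch v s' j" if "(s', j) \<noteq> (s, 0)" for s' j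
      proof (cases "s' = s")
        case True
        then have "epoch v s 1 \<le> epoch v s j" using that by (intro epoch_mono[OF v]) auto
        then show ?thesis using d(2) True by simp
      next
        case False
        then show ?thesis using epoch_mono[OF v, of 0 j s'] d(3)[of s'] by simp
      qed
      have dep_k: "?dep k = v (s, 0)"
      proof (subst matching_dep.simps, rule cInf_eq_minimum)
        let ?S = "{epoch v s k' | s k'. s \<in> servers E (?ty k) \<and> ?ar k < epoch v s k' \<and>
            (\<forall>m\<in>{..<k}. s \<in> servers E (?ty m) \<longrightarrow> ?dep m < epoch v s k')}"
        have "s \<in> servers E (?ty k)" using k first_ix_in[of E s x] by (simp add: ty k_def)
        moreover have "?ar k < epoch v s 0" using k regular_pos[OF v, of "(s, 0)"] by (simp add: cust_time_def)
        moreover have "s \<notin> servers E (?ty m)" if "m < k" for m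
          using that k before_first_ix[of m E s x] by (simp add: ty k_def)
        ultimately have "epoch v s 0 \<in> ?S" by blast
        then show "v (s, 0) \<in> ?S" by simp
        show "v (s, 0) \<le> e" if e_in: "e \<in> ?S" for e
        proof -
          obtain s' j where e: "e = epoch v s' j" using e_in by blast
          show ?thesis using gap[of s' j] ring d(1) unfolding e by (cases "(s', j) = (s, 0)") auto
        qed
      qed
      have "u < ?dep n" if n: "n < length x" "n \<noteq> k" for n
      proof -
        have "d \<le> ?dep n"
        proof (rule matching_dep_ge[OF v servers_nonempty])
          fix s' j assume s': "s' \<in> servers E (?ty n)"
            and after: "\<And>m. m < n \<Longrightarrow> s' \<in> servers E (?ty m) \<Longrightarrow> ?dep m < epoch v s' j"
          \<comment> \<open>The first arrival of \<open>s\<close> is taken by \<open>k\<close>: a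
            later customer compatible with \<open>s\<close> needs an epoch strictly after the
            departure of \<open>k\<close>, and no earlier customer is compatible with
            \<open>s\<close>.\<close>
          have "(s', j) \<noteq> (s, 0)"
          proof
            assume eq: "(s', j) = (s, 0)"
            have "k \<le> n" using s' n(1) eq unfolding k_def by (intro first_ix_le_member) (auto simp: ty)
            then have "k < n" using n(2) by simp
            moreover have "s' \<in> servers E (?ty k)" using eq k first_ix_in[of E s x] by (simp add: ty k_def)
            ultimately show False using after[of k] dep_k eq by simp
          qed
          then show "d \<le> epoch v s' j" by (rule gap)
        qed
        then show ?thesis using d(1) by simp
      qed
      then show "matching_state E x a v u = serve E s x"
        unfolding matching_state_def serve_def using \<open>0 < u\<close> no_arrival[OF a late] k dep_k ring
        by (subst content_served[where k=k]) (auto simp: k_def)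
    }
  next
    fix e :: "'c + 's"
    show "finite (guard e)" by (auto simp: guard_def split: sum.split)
    have mu_nonneg: "0 \<le> sum mu UNIV" by (intro sum_nonneg less_imp_le[OF mu_pos])
    show "(\<Sum>q\<in>guard e. mu (fst q)) \<le> 3 * sum mu UNIV"
    proof (cases e)
      case (Inl c)
      then show ?thesis using mu_nonneg by (simp add: guard_def sum.reindex inj_on_def)
    next
      case (Inr s)
      have "(\<Sum>q\<in>guard e. mu (fst q)) = mu s + (\<Sum>s\<in>- {s}. mu s)"
        unfolding guard_def Inr by (simp, subst sum.insert) (auto simp: sum.reindex inj_on_def)
      also have "\<dots> = sum mu UNIV"
        by (subst sum.remove[of UNIV s]) (auto simp: Compl_eq_Diff_UNIV)
      finally show ?thesis using mu_nonneg by simp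
    qed
    fix s s' :: 's
    show "(s, 0) \<notin> guard (Inr s)" by (auto simp: guard_def)
    show "(s', 0) \<in> guard (Inr s)" if "s' \<noteq> s"
      using that by (auto simp: guard_def)
  qed (use \<open>0 < u\<close> measurable_matching_state in auto)
qed

end

theorem theorem7p1:
  fixes E :: "('s::finite \<times> 'c::finite) set"
    and lam :: "'c \<Rightarrow> real" and mu :: "'s \<Rightarrow> real"
    and M :: "'w measure" and X :: "real \<Rightarrow> 'w \<Rightarrow> 'c list"
  assumes lam_pos: "\<And>c. 0 < lam c"
    and mu_pos: "\<And>s. 0 < mu s"
    and stability: "\<And>C. C \<noteq> {} \<Longrightarrow> (\<Sum>c\<in>C. lam c) < (\<Sum>s\<in>(\<Union>c\<in>C. servers E c). mu s)"
    and queue: "stationary_chain M X (redundancy_trans E lam mu) \<or>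
                stationary_chain M X (matching_trans E lam mu)"
  shows "((\<forall>c. poisson_process M (departures X c) (lam c)) \<and>
          independent_processes M (departures X)) \<and>
         (\<forall>t. independent_of_past M (X t) (departures X) t)"
proof -
  interpret parallel_fcfs E lam mu
    using lam_pos mu_pos stability by unfold_locales
  obtain P where chain: "stationary_chain M X P"
    and P: "P = redundancy_trans E lam mu \<or> P = matching_trans E lam mu"
    using queue by blast
  interpret prob_space M using chain by (simp add: stationary_chain_def)
  \<comment> \<open>The same constant serves both models, so the choice between them plays no
    further part.\<close>
  interpret stationary_fcfs E lam mu M X P "5 * total_rate\<^sup>2"
  proof unfold_locales
    show "step_bound (5 * total_rate\<^sup>2) x h y \<le> P x h y" if "0 < h" for x y h
      using P redundancy_trans_ge[OF that, of y x] matching_trans_ge[OF that, of y x] by blast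
  qed (use chain in auto)
  show ?thesis
    using departures_poisson departures_independent state_independent_of_past by blast
qed

end
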